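(* Let $n\ge2$, $\boldsymbol\lambda\in\mathbb C^n$ with $\sum_l\lambda_l=0$, and let $\xi$ be a $2n$-th root of unity. Then, for either choice of sign and all $z\in\mathbb U$, $$J(z;\boldsymbol\lambda;\xi)=(\pm\xi)^{\frac{n-1}2}J(\pm\xi z;\boldsymbol\lambda;\pm1),$$ and $B_m(\boldsymbol\lambda;\xi)=(\pm\xi)^{-m}B_m(\boldsymbol\lambda;\pm1)$ for all $m\ge0$.
   Context: $\mathbb U$ is the universal cover of $\mathbb C\smallsetminus\{0\}$, with elements $z=|z|e^{i\arg z}$, $\arg z\in\mathbb R$, and $z^a=e^{a\log z}$, $\log z=\log|z|+i\arg z$. Roots of unity are regarded as points of $\mathbb U$: a choice of $\arg\xi$ is fixed, $\arg1=0$, the parameter $-1$ of $J(\cdot;\boldsymbol\lambda;-1)$ has $\arg(-1)=\pi$, and in the formula $+\xi=\xi$ while $-\xi$ is the point of $\mathbb U$ with $\arg(-\xi)=\arg\xi-\pi$. Also $\arg(i\overline\xi)=\frac\pi2-\arg\xi$. For a $2n$-th root of unity $\xi$ let $\varsigma=\xi^n\in\{+1,-1\}$. Bessel equation of index $\boldsymbol\lambda$ and sign $\varsigma$: $$\sum_{j=1}^nV_{n,j}(\boldsymbol\lambda)z^jw^{(j)}+\big(V_{n,0}(\boldsymbol\lambda)-\varsigma(in)^nz^n\big)w=0,\qquad V_{n,j}(\boldsymbol\lambda)=\sum_{m=0}^{n-j}A_{j,n-j-m}\,n^m\sigma_m(\boldsymbol\lambda),$$ where $\sigma_m$ is the $m$-th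 elementary symmetric polynomial, $A_{0,0}=1$, $A_{0,m}=0$ ($m\ge1$), $A_{j,m}=\sum_{r=1}^j\frac{(-1)^{j-r}r^{m+j}}{r!(j-r)!}$ ($j\ge1,m\ge0$). There is a unique sequence of symmetric polynomials $B_m(\boldsymbol\lambda;\xi)$ in $\boldsymbol\lambda$ with $B_0=1$ such that $\widehat J(z;\boldsymbol\lambda;\xi)=e^{in\xi z}z^{-\frac{n-1}2}\sum_{m\ge0}B_m(\boldsymbol\lambda;\xi)z^{-m}$ is a formal solution of this equation. $J(z;\boldsymbol\lambda;\xi)$ is the unique solution of the equation on $\mathbb U$ having $\widehat J(z;\boldsymbol\lambda;\xi)$ as its asymptotic expansion (as $|z|\to\infty$) on the sector $\{z\in\mathbb U:|\arg z-\arg(i\overline\xi)|<\frac\pi n\}$. *)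

theory Defs
  imports
    "HOL-Complex_Analysis.Complex_Analysis"
    "HOL-Library.Landau_Symbols"
    "HOL-Computational_Algebra.Formal_Power_Series"
begin

no_notation fps_nth (infixl \<open>$\<close> 75)

section \<open>The universal cover of the punctured plane\<close>

text \<open>A point is the pair of its modulus (positive) and its argument (any real number).\<close>

typedef ucover = "{p :: real \<times> real. 0 < fst p}"
  by (rule exI[of _ "(1, 0)"]) simp

definition upoint :: "real \<Rightarrow> real \<Rightarrow> ucover" where
  "upoint r \<theta> = Abs_ucover (r, \<theta>)"

definition umod :: "ucover \<Rightarrow> real" where
  "umod z = fst (Rep_ucover z)"

definition uarg :: "ucover \<Rightarrow> real" where
  "uarg z = snd (Rep_ucover z)"

definition uproj :: "ucover \<Rightarrow> complex" where
  "uproj z = rcis (umod z) (uarg z)"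

definition ulog :: "ucover \<Rightarrow> complex" where
  "ulog z = Complex (ln (umod z)) (uarg z)"

definition uexp :: "complex \<Rightarrow> ucover" where
  "uexp s = upoint (exp (Re s)) (Im s)"

definition umult :: "ucover \<Rightarrow> ucover \<Rightarrow> ucover" where
  "umult z u = upoint (umod z * umod u) (uarg z + uarg u)"

definition upowr :: "ucover \<Rightarrow> complex \<Rightarrow> complex" where
  "upowr z a = exp (a * ulog z)"

text \<open>
  The complex structure is read in the global chart \<open>ulog\<close>, whose inverse is \<open>uexp\<close>.
  The derivative is the one with respect to \<open>z\<close> itself, not to \<open>log z\<close>:
  \<open>dw/dz = z\<^sup>-\<^sup>1 dw/d(log z)\<close>.
\<close>

definition uholomorphic :: "(ucover \<Rightarrow> complex) \<Rightarrow> bool" where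
  "uholomorphic w \<longleftrightarrow> (w \<circ> uexp) holomorphic_on UNIV"

definition uderiv :: "(ucover \<Rightarrow> complex) \<Rightarrow> ucover \<Rightarrow> complex" where
  "uderiv w z = deriv (w \<circ> uexp) (ulog z) / uproj z"

definition u_one :: ucover where
  "u_one = upoint 1 0"

definition u_minus_one :: ucover where
  "u_minus_one = upoint 1 pi"

text \<open>Here \<open>arg (-z) = arg z - pi\<close>. In particular \<open>u_neg u_one\<close>, whose argument is \<open>-pi\<close>, is not
  \<open>u_minus_one\<close>; rather \<open>u_neg u_minus_one = u_one\<close>.\<close>

definition u_neg :: "ucover \<Rightarrow> ucover" where
  "u_neg z = upoint (umod z) (uarg z - pi)"

section \<open>The Bessel equation\<close>

text \<open>The rank \<open>n\<close> is \<open>CARD('n)\<close>.\<close>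

definition esym :: "nat \<Rightarrow> complex ^ 'n \<Rightarrow> complex" where
  "esym m lam = (\<Sum>S\<in>{S :: 'n set. card S = m}. \<Prod>i\<in>S. lam $ i)"

definition bessel_A :: "nat \<Rightarrow> nat \<Rightarrow> complex" where
  "bessel_A j m =
     (if j = 0 then (if m = 0 then 1 else 0)
      else (\<Sum>r = 1..j. (- 1) ^ (j - r) * of_nat r ^ (m + j) / (fact r * fact (j - r))))"

definition bessel_V :: "complex ^ 'n \<Rightarrow> nat \<Rightarrow> complex" where
  "bessel_V lam j =
     (\<Sum>m = 0..CARD('n) - j. bessel_A j (CARD('n) - j - m) * of_nat CARD('n) ^ m * esym m lam)"

definition bessel_solution :: "complex ^ 'n \<Rightarrow> complex \<Rightarrow> (ucover \<Rightarrow> complex) \<Rightarrow> bool" where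
  "bessel_solution lam sg w \<longleftrightarrow>
     uholomorphic w \<and>
     (\<forall>z. (\<Sum>j = 1..CARD('n). bessel_V lam j * uproj z ^ j * (uderiv ^^ j) w z)
        + (bessel_V lam 0 - sg * (\<i> * of_nat CARD('n)) ^ CARD('n) * uproj z ^ CARD('n)) * w z = 0)"

section \<open>Formal solutions\<close>

text \<open>
  A power series \<open>F(X)\<close> stands for the formal expression \<open>e\<^bsup>a z\<^esup> z\<^bsup>\<rho>\<^esup> F(1/z)\<close>.
  Its formal derivative with respect to \<open>z\<close> is
  \<open>e\<^bsup>a z\<^esup> z\<^bsup>\<rho>\<^esup> (a F + \<rho> X F - X\<^sup>2 F')(1/z)\<close>.
\<close>

definition formal_deriv :: "complex \<Rightarrow> complex \<Rightarrow> complex fps \<Rightarrow> complex fps" where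
  "formal_deriv a \<rho> F =
     fps_const a * F + fps_const \<rho> * fps_X * F - fps_X ^ 2 * fps_deriv F"

text \<open>The Bessel equation for such an expression, multiplied by \<open>z\<^sup>-\<^sup>n = X\<^sup>n\<close> so that only
  nonnegative powers of \<open>X\<close> occur.\<close>

definition formal_bessel_solution ::
    "complex ^ 'n \<Rightarrow> complex \<Rightarrow> complex \<Rightarrow> complex \<Rightarrow> complex fps \<Rightarrow> bool" where
  "formal_bessel_solution lam sg a \<rho> F \<longleftrightarrow>
     (\<Sum>j = 1..CARD('n).
        fps_const (bessel_V lam j) * fps_X ^ (CARD('n) - j) * (formal_deriv a \<rho> ^^ j) F)
     + (fps_const (bessel_V lam 0) * fps_X ^ CARD('n)
        - fps_const (sg * (\<i> * of_nat CARD('n)) ^ CARD('n))) * F = 0"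

definition bessel_rho :: "'n itself \<Rightarrow> complex" where
  "bessel_rho _ = - ((of_nat CARD('n) - 1) / 2)"

definition symmetric_polynomial :: "(complex ^ 'n \<Rightarrow> complex) \<Rightarrow> bool" where
  "symmetric_polynomial p \<longleftrightarrow>
     (\<exists>(E :: ('n \<Rightarrow> nat) set) c. finite E \<and> (\<forall>x. p x = (\<Sum>e\<in>E. c e * (\<Prod>i\<in>UNIV. (x $ i) ^ e i)))) \<and>
     (\<forall>\<pi> x. bij \<pi> \<longrightarrow> p (\<chi> i. x $ \<pi> i) = p x)"

definition bessel_coeff_family :: "ucover \<Rightarrow> (nat \<Rightarrow> complex ^ 'n \<Rightarrow> complex) \<Rightarrow> bool" where
  "bessel_coeff_family \<xi> b \<longleftrightarrow>
     (\<forall>m. symmetric_polynomial (b m)) \<and>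
     (\<forall>lam. b 0 lam = 1) \<and>
     (\<forall>lam. (\<Sum>l\<in>UNIV. lam $ l) = 0 \<longrightarrow>
        formal_bessel_solution lam (uproj \<xi> ^ CARD('n)) (\<i> * of_nat CARD('n) * uproj \<xi>)
          (bessel_rho TYPE('n)) (Abs_fps (\<lambda>m. b m lam)))"

text \<open>
  The index \<open>lam\<close> ranges over the hyperplane \<open>\<Sum>\<^sub>l lam\<^sub>l = 0\<close> (elsewhere the exponent
  \<open>-(n-1)/2\<close> is not the right one), so the polynomials are unique as functions on that
  hyperplane: \<open>bessel_B m lam \<xi>\<close> is the common value at \<open>lam\<close> of all representatives.
\<close>

definition bessel_B :: "nat \<Rightarrow> complex ^ 'n \<Rightarrow> ucover \<Rightarrow> complex" where
  "bessel_B m lam \<xi> = (THE c. \<exists>b. bessel_coeff_family \<xi> b \<and> c = b m lam)"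

section \<open>Bessel functions of the second kind\<close>

text \<open>Note \<open>arg (\<i> * cnj \<xi>) = pi/2 - arg \<xi>\<close>.\<close>

definition bessel_sector :: "'n itself \<Rightarrow> ucover \<Rightarrow> ucover set" where
  "bessel_sector _ \<xi> = {z. \<bar>uarg z - (pi / 2 - uarg \<xi>)\<bar> < pi / of_nat CARD('n)}"

text \<open>Poincare's sense: after dividing by \<open>e\<^bsup>i n \<xi> z\<^esup> z\<^bsup>-(n-1)/2\<^esup>\<close>, the remainder of the \<open>M\<close>-th
  partial sum is \<open>O(|z|\<^sup>-\<^sup>M)\<close> as \<open>|z|\<close> tends to infinity within the sector.\<close>

definition bessel_asymptotic :: "complex ^ 'n \<Rightarrow> ucover \<Rightarrow> (ucover \<Rightarrow> complex) \<Rightarrow> bool" where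
  "bessel_asymptotic lam \<xi> w \<longleftrightarrow>
     (\<forall>M::nat.
        (\<lambda>z. w z / (exp (\<i> * of_nat CARD('n) * uproj \<xi> * uproj z) * upowr z (bessel_rho TYPE('n)))
              - (\<Sum>m<M. bessel_B m lam \<xi> / uproj z ^ m))
        \<in> O[inf (filtercomap umod at_top) (principal (bessel_sector TYPE('n) \<xi>))](
              \<lambda>z. 1 / of_real (umod z) ^ M))"

definition bessel_J :: "ucover \<Rightarrow> complex ^ 'n \<Rightarrow> ucover \<Rightarrow> complex" where
  "bessel_J z lam \<xi> =
     (THE w. bessel_solution lam (uproj \<xi> ^ CARD('n)) w \<and> bessel_asymptotic lam \<xi> w) z"

end

theory Submission
  imports Defs "HOL-Combinatorics.Stirling"
begin

text \<open>
  Rotating the variable, \<open>w \<mapsto> \<zeta>\<^bsup>(n-1)/2\<^esup> w(\<zeta> z)\<close>, carries the conditions that characterise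
  \<open>J(z; \<lambda>; \<eta>)\<close> to those for \<open>J(z; \<lambda>; \<zeta> \<eta>)\<close>, and \<open>B\<^sub>m \<mapsto> \<zeta>\<^bsup>-m\<^esup> B\<^sub>m\<close> does the same for formal solutions. So
  both formulas follow once these objects are known to exist uniquely for one parameter; we take
  \<open>\<xi> = \<i>\<close>, where the dominant factor is \<open>exp (- n z)\<close>.

  The coefficients \<open>B\<^sub>m\<close> are given by a recursion, which can be solved because the sum of the indices
  vanishes. For \<open>J\<close>, the equation is split along the exponentials \<open>exp (\<nu> z)\<close> with
  \<open>\<nu>\<^sup>n = (- n)\<^sup>n\<close>, all of which satisfy \<open>Re \<nu> \<ge> - n\<close>. Each first-order equation \<open>u' = \<nu> u + f\<close> is
  integrated from infinity along horizontal rays, and the weight \<open>exp (- n Re z) |z|\<^bsup>-2p\<^esup>\<close> makes the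
  coupling terms, which are \<open>O(1/z)\<close>, a contraction for large \<open>p\<close>. This corrects truncated formal
  solutions to actual ones on \<open>Re z > 0\<close>, \<open>|z| > 1\<close>, and the same estimate shows that a solution
  decaying faster than \<open>exp (- n z)\<close> by a high power vanishes. In the logarithmic chart the equation
  has entire coefficients, so solutions extend to the whole universal cover.
\<close>

section \<open>The coefficients of the equation\<close>

text \<open>The parameter \<open>\<i>\<close> need not be a 2n-th root of unity (for odd n it is
  not), so existence and uniqueness are carried out for every parameter \<xi> of modulus one, with
  the complex number \<xi>^n in place of the sign. What \<open>\<i>\<close> offers is geometry:
  along horizontal rays to the right no exponential of the equation decays faster than exp(-nz), so
  all n components can be integrated from infinity along the same rays, and since n \<ge> 2 the
  sector |arg z| < pi/n stays in the right half-plane.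

  The obstacle is the coupling of size 1/|z|, whose integral to infinity diverges, so an iteration
  for integrable perturbations does not apply. The weight |z|^(-2p) restores convergence and yields
  a small factor 1/sqrt p, but it controls a correction only after a long truncation. The solution
  constructed may therefore depend on the order M of the expansion. Uniqueness already at one fixed
  order K identifies all these solutions, which gives the full expansion without summing the formal
  series.\<close>

lemma Stirling_explicit:
  "(\<Sum>r\<le>k. (- 1) ^ (k - r) * of_nat r ^ N / (fact r * fact (k - r)))
     = (of_nat (Stirling N k) :: 'a :: field_char_0)"
proof (induction N arbitrary: k)
  case 0
  have "(\<Sum>r\<le>k. (- 1) ^ (k - r) * of_nat r ^ 0 / (fact r * fact (k - r)) :: 'a)
      = (\<Sum>r\<le>k. of_nat (k choose r) * 1 ^ r * (- 1) ^ (k - r)) / fact k"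
    by (simp add: sum_divide_distrib binomial_fact field_simps)
  also have "\<dots> = (1 + (- 1)) ^ k / fact k"
    by (subst binomial_ring) simp
  also have "\<dots> = of_nat (Stirling 0 k)"
    by (cases k) auto
  finally show ?case .
next
  case (Suc N)
  show ?case
  proof (cases k)
    case 0
    then show ?thesis by simp
  next
    case (Suc l)
    let ?t = "\<lambda>r. (- 1) ^ (Suc l - r) * of_nat r ^ N / (fact r * fact (Suc l - r)) :: 'a"
    \<comment> \<open>The extra factor r is split as (l+1) - (l+1-r). The first part gives (l+1)
      S(N,l+1); in the second, l+1-r cancels against the factorial and flips the sign, leaving
      S(N,l). This is the recursion of the Stirling numbers of the second kind.\<close>
    have eq: "(of_nat (Suc l) - of_nat r) * ?t r
        = - ((- 1) ^ (l - r) * of_nat r ^ N / (fact r * fact (l - r)))" if "r \<le> l" for r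
    proof -
      have "Suc l - r = Suc (l - r)" using that by simp
      moreover have "(of_nat (Suc l) - of_nat r :: 'a) = of_nat (Suc (l - r))"
        using that by (simp add: of_nat_diff)
      moreover have "of_nat (Suc (l - r)) \<noteq> (0 :: 'a)" by (rule of_nat_neq_0)
      ultimately show ?thesis
        by (simp add: fact_Suc field_simps del: of_nat_Suc)
    qed
    have "(\<Sum>r\<le>Suc l. (- 1) ^ (Suc l - r) * of_nat r ^ Suc N / (fact r * fact (Suc l - r)) :: 'a)
        = (\<Sum>r\<le>Suc l. of_nat (Suc l) * ?t r - (of_nat (Suc l) - of_nat r) * ?t r)"
    proof (intro sum.cong refl)
      fix r
      have "(- 1) ^ (Suc l - r) * of_nat r ^ Suc N / (fact r * fact (Suc l - r)) = of_nat r * ?t r"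
        by simp
      also have "\<dots> = of_nat (Suc l) * ?t r - (of_nat (Suc l) - of_nat r) * ?t r"
        by (simp only: left_diff_distrib) (simp only: diff_diff_eq2 add_diff_cancel_left')
      finally show "(- 1) ^ (Suc l - r) * of_nat r ^ Suc N / (fact r * fact (Suc l - r))
        = of_nat (Suc l) * ?t r - (of_nat (Suc l) - of_nat r) * ?t r" .
    qed
    also have "\<dots> = of_nat (Suc l) * (\<Sum>r\<le>Suc l. ?t r)
        - (\<Sum>r\<le>Suc l. (of_nat (Suc l) - of_nat r) * ?t r)"
      by (simp only: sum_subtractf sum_distrib_left)
    also have "(\<Sum>r\<le>Suc l. (of_nat (Suc l) - of_nat r) * ?t r)
        = (\<Sum>r\<le>l. (of_nat (Suc l) - of_nat r) * ?t r)"
      by (subst sum.atMost_Suc) simp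
    also have "\<dots> = - (\<Sum>r\<le>l. (- 1) ^ (l - r) * of_nat r ^ N / (fact r * fact (l - r)))"
      unfolding sum_negf[symmetric] by (intro sum.cong refl eq) simp
    finally show ?thesis
      unfolding Suc Suc.IH by (simp add: algebra_simps del: sum.atMost_Suc power_Suc)
  qed
qed

text \<open>The two leading coefficients of the equation come from S(n,n) = 1 and S(n,n-1) =
  n(n-1)/2. For positive j the term r = 0, which the sum omits, vanishes because the exponent m + j
  is positive.\<close>

lemma bessel_A_eq_Stirling: "bessel_A j m = of_nat (Stirling (m + j) j)"
proof (cases "j = 0")
  case True
  then show ?thesis by (cases m) (auto simp: bessel_A_def)
next
  case False
  have "{..j} = insert 0 {1..j}" by auto
  then show ?thesis
    using False by (simp add: bessel_A_def Stirling_explicit[symmetric] power_0_left)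
qed

lemma Stirling_Suc_n_n: "Stirling (Suc n) n = Suc n choose 2"
  by (induction n) (auto simp: numeral_2_eq_2)

lemma esym_0: "esym 0 lam = 1"
proof -
  have "{S :: 'a set. card S = 0} = {{}}" by auto
  then show ?thesis by (simp add: esym_def)
qed

lemma esym_1: "esym 1 lam = (\<Sum>l\<in>UNIV. lam $ l)"
proof -
  have "{S :: 'a set. card S = 1} = (\<lambda>i. {i}) ` UNIV" by (auto simp: card_1_singleton_iff)
  then show ?thesis by (simp add: esym_def sum.reindex inj_def)
qed

lemma bessel_V_card: "bessel_V (lam :: complex ^ 'n) CARD('n) = 1"
  by (simp add: bessel_V_def esym_0 bessel_A_eq_Stirling)

text \<open>With vanishing sum of the indices this coefficient is n(n-1)/2, and -(n-1)/2 is exactly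
  the exponent that turns it into -n\<rho>. This relation leaves the constant term of the formal
  series free.\<close>

lemma bessel_V_card_minus_1:
  fixes lam :: "complex ^ 'n"
  assumes "(\<Sum>l\<in>UNIV. lam $ l) = 0"
  shows "bessel_V lam (CARD('n) - 1) = - (of_nat CARD('n) * bessel_rho TYPE('n))"
proof -
  obtain k where k: "CARD('n) = Suc k"
    using zero_less_card_finite[where 'a = 'n] by (metis not0_implies_Suc less_irrefl)
  have "{0..Suc k - k} = {0, 1}" by auto
  then have "bessel_V lam (CARD('n) - 1) = of_nat (Suc k choose 2)"
    using assms by (simp add: bessel_V_def k esym_0 esym_1[unfolded One_nat_def] bessel_A_eq_Stirling Stirling_Suc_n_n)
  also have "\<dots> = of_nat (Suc k) * of_nat k / 2"
  proof -
    have "2 * (Suc k choose 2) = Suc k * k" by (simp add: choose_two)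
    then have "of_nat (2 * (Suc k choose 2)) = (of_nat (Suc k * k) :: complex)" by (rule arg_cong)
    then show ?thesis by (simp add: field_simps)
  qed
  finally show ?thesis by (simp add: bessel_rho_def k)
qed

section \<open>Symmetric polynomials\<close>

definition monomial_sum :: "(complex ^ 'n \<Rightarrow> complex) \<Rightarrow> bool" where
  "monomial_sum p \<longleftrightarrow>
     (\<exists>(E :: ('n \<Rightarrow> nat) set) c. finite E \<and> (\<forall>x. p x = (\<Sum>e\<in>E. c e * (\<Prod>i\<in>UNIV. (x $ i) ^ e i))))"

text \<open>The exponent map \<open>e\<close> may repeat values; equal monomials are collected over
  its fibres. Sums and products of polynomials can then be indexed by disjoint unions and products
  of index sets.\<close>

lemma monomial_sumI:
  fixes e :: "'b \<Rightarrow> 'n :: finite \<Rightarrow> nat"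
  assumes "finite I" and "\<And>x. p x = (\<Sum>t\<in>I. c t * (\<Prod>i\<in>UNIV. (x $ i) ^ e t i))"
  shows "monomial_sum p"
proof -
  have "p x = (\<Sum>m\<in>e ` I. (\<Sum>t\<in>{t \<in> I. e t = m}. c t) * (\<Prod>i\<in>UNIV. (x $ i) ^ m i))" for x
    unfolding assms(2) sum.image_gen[OF assms(1), of _ e] sum_distrib_right
    by (intro sum.cong refl) simp
  then show ?thesis
    unfolding monomial_sum_def
    by (intro exI[of _ "e ` I"] exI[of _ "\<lambda>m. \<Sum>t\<in>{t \<in> I. e t = m}. c t"]) (simp add: assms(1))
qed

lemma monomial_sum_const: "monomial_sum (\<lambda>_. c)"
  by (rule monomial_sumI[where I = "{()}" and c = "\<lambda>_. c" and e = "\<lambda>_ _. 0"]) auto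

lemma monomial_sum_mult:
  assumes "monomial_sum p" "monomial_sum q"
  shows "monomial_sum (\<lambda>x. p x * q x)"
proof -
  obtain E c where E: "finite E" "\<And>x. p x = (\<Sum>e\<in>E. c e * (\<Prod>i\<in>UNIV. (x $ i) ^ e i))"
    using assms(1) unfolding monomial_sum_def by blast
  obtain F d where F: "finite F" "\<And>x. q x = (\<Sum>e\<in>F. d e * (\<Prod>i\<in>UNIV. (x $ i) ^ e i))"
    using assms(2) unfolding monomial_sum_def by blast
  show ?thesis
    by (rule monomial_sumI[where I = "E \<times> F" and c = "\<lambda>(e, f). c e * d f" and e = "\<lambda>(e, f) i. e i + f i"])
       (auto simp: E F sum_product sum.cartesian_product power_add prod.distrib mult_ac intro!: sum.cong)
qed

lemma monomial_sum_add:
  assumes "monomial_sum p" "monomial_sum q"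
  shows "monomial_sum (\<lambda>x. p x + q x)"
proof -
  obtain E c where E: "finite E" "\<And>x. p x = (\<Sum>e\<in>E. c e * (\<Prod>i\<in>UNIV. (x $ i) ^ e i))"
    using assms(1) unfolding monomial_sum_def by blast
  obtain F d where F: "finite F" "\<And>x. q x = (\<Sum>e\<in>F. d e * (\<Prod>i\<in>UNIV. (x $ i) ^ e i))"
    using assms(2) unfolding monomial_sum_def by blast
  show ?thesis
    by (rule monomial_sumI[where I = "E <+> F" and c = "case_sum c d" and e = "case_sum id id"])
       (auto simp: E F sum.Plus)
qed

lemma symmetric_polynomial_iff:
  "symmetric_polynomial p \<longleftrightarrow>
     monomial_sum p \<and> (\<forall>\<pi> x. bij \<pi> \<longrightarrow> p (\<chi> i. x $ \<pi> i) = p x)"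
  by (simp add: symmetric_polynomial_def monomial_sum_def)

lemma symmetric_polynomial_const: "symmetric_polynomial (\<lambda>_. c)"
  by (simp add: symmetric_polynomial_iff monomial_sum_const)

lemma symmetric_polynomial_mult:
  "symmetric_polynomial p \<Longrightarrow> symmetric_polynomial q \<Longrightarrow> symmetric_polynomial (\<lambda>x. p x * q x)"
  by (simp add: symmetric_polynomial_iff monomial_sum_mult)

lemma symmetric_polynomial_add:
  "symmetric_polynomial p \<Longrightarrow> symmetric_polynomial q \<Longrightarrow> symmetric_polynomial (\<lambda>x. p x + q x)"
  by (simp add: symmetric_polynomial_iff monomial_sum_add)

lemma symmetric_polynomial_cmult:
  "symmetric_polynomial p \<Longrightarrow> symmetric_polynomial (\<lambda>x. c * p x)"
  by (intro symmetric_polynomial_mult symmetric_polynomial_const)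

lemma symmetric_polynomial_sum:
  "(\<And>t. t \<in> I \<Longrightarrow> symmetric_polynomial (p t)) \<Longrightarrow> symmetric_polynomial (\<lambda>x. \<Sum>t\<in>I. p t x)"
  by (induction I rule: infinite_finite_induct)
     (auto simp: symmetric_polynomial_const intro!: symmetric_polynomial_add)

lemma symmetric_polynomial_esym: "symmetric_polynomial (esym m :: complex ^ 'n \<Rightarrow> complex)"
proof -
  have "monomial_sum (esym m :: complex ^ 'n \<Rightarrow> complex)"
  proof (rule monomial_sumI[where I = "{S :: 'n set. card S = m}" and c = "\<lambda>_. 1" and e = "\<lambda>S i. if i \<in> S then 1 else 0"])
    fix x :: "complex ^ 'n"
    have "(\<Prod>i\<in>UNIV. (x $ i) ^ (if i \<in> S then 1 else 0)) = (\<Prod>i\<in>S. x $ i)" for S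
      by (rule sym, rule prod.mono_neutral_cong_left) auto
    then show "esym m x = (\<Sum>S | card S = m. 1 * (\<Prod>i\<in>UNIV. (x $ i) ^ (if i \<in> S then 1 else 0)))"
      by (simp add: esym_def)
  qed simp
  moreover have "esym m (\<chi> i. x $ \<pi> i) = esym m x" if "bij \<pi>" for \<pi> :: "'n \<Rightarrow> 'n" and x :: "complex ^ 'n"
  proof -
    have inj: "inj \<pi>" and surj: "surj \<pi>" using that by (auto simp: bij_def)
    have "esym m (\<chi> i. x $ \<pi> i) = (\<Sum>S | card S = m. \<Prod>i\<in>\<pi> ` S. x $ i)"
      unfolding esym_def
      by (intro sum.cong refl) (subst prod.reindex, auto intro: inj_on_subset[OF inj])
    also have "\<dots> = (\<Sum>S\<in>(`) \<pi> ` {S. card S = m}. \<Prod>i\<in>S. x $ i)"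
      by (subst sum.reindex) (simp_all add: inj_on_def inj_image_eq_iff[OF inj])
    also have "(`) \<pi> ` {S. card S = m} = {S. card S = m}"
    proof safe
      fix S :: "'n set"
      show "card (\<pi> ` S) = card S" by (rule card_image) (rule inj_on_subset[OF inj], simp)
    next
      fix S :: "'n set"
      have "S = \<pi> ` (\<pi> -` S)" using surj by (simp add: surj_image_vimage_eq)
      moreover have "card (\<pi> -` S) = card S"
        by (metis calculation card_image inj inj_on_subset subset_UNIV)
      ultimately show "S \<in> (`) \<pi> ` {T. card T = card S}" by blast
    qed
    finally show ?thesis by (simp add: esym_def)
  qed
  ultimately show ?thesis by (simp add: symmetric_polynomial_iff)
qed

lemma symmetric_polynomial_bessel_V: "symmetric_polynomial (\<lambda>lam. bessel_V lam j)"
  unfolding bessel_V_def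
  by (intro symmetric_polynomial_sum symmetric_polynomial_cmult symmetric_polynomial_esym)

section \<open>The formal solution\<close>

definition bessel_op ::
    "nat \<Rightarrow> (nat \<Rightarrow> complex) \<Rightarrow> complex \<Rightarrow> complex \<Rightarrow> complex \<Rightarrow> complex fps \<Rightarrow> complex fps" where
  "bessel_op n V \<kappa> a \<rho> F =
     (\<Sum>j\<le>n. fps_const (V j) * fps_X ^ (n - j) * (formal_deriv a \<rho> ^^ j) F) - fps_const \<kappa> * F"

lemma formal_bessel_solution_iff:
  fixes lam :: "complex ^ 'n"
  shows "formal_bessel_solution lam sg a \<rho> F \<longleftrightarrow>
    bessel_op CARD('n) (bessel_V lam) (sg * (\<i> * of_nat CARD('n)) ^ CARD('n)) a \<rho> F = 0"
proof -
  have "{..CARD('n)} = insert 0 {1..CARD('n)}" by auto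
  then show ?thesis
    unfolding formal_bessel_solution_def bessel_op_def by (simp add: algebra_simps)
qed

section \<open>Triangular form of the formal operator\<close>

lemma fps_nth_formal_deriv:
  "fps_nth (formal_deriv a \<rho> F) i =
     a * fps_nth F i + (if i = 0 then 0 else (\<rho> - of_nat (i - 1)) * fps_nth F (i - 1))"
proof (cases i)
  case 0
  then show ?thesis by (simp add: formal_deriv_def)
next
  case (Suc k)
  show ?thesis
  proof (cases k)
    case 0
    then show ?thesis
      using Suc by (simp add: formal_deriv_def fps_X_power_mult_nth mult.assoc)
  next
    case (Suc l)
    then show ?thesis
      using \<open>i = Suc k\<close>
      by (simp add: formal_deriv_def fps_X_power_mult_nth mult.assoc) (simp add: algebra_simps)
  qed
qed

text \<open>Lower triangular matrix of the j-th formal derivative: the share of coefficient k of the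
  series in coefficient i of the result. The recursion reflects that differentiating exp(az)
  z^(\<rho>-k) gives a times itself plus (\<rho>-k) exp(az) z^(\<rho>-k-1).\<close>

primrec formal_deriv_coeff :: "complex \<Rightarrow> complex \<Rightarrow> nat \<Rightarrow> nat \<Rightarrow> nat \<Rightarrow> complex" where
  "formal_deriv_coeff a \<rho> 0 k i = (if k = i then 1 else 0)"
| "formal_deriv_coeff a \<rho> (Suc j) k i =
     a * formal_deriv_coeff a \<rho> j k i +
     (if i = 0 then 0 else (\<rho> - of_nat (i - 1)) * formal_deriv_coeff a \<rho> j k (i - 1))"

lemma formal_deriv_coeff_less: "i < k \<Longrightarrow> formal_deriv_coeff a \<rho> j k i = 0"
  by (induction j arbitrary: i) auto

lemma formal_deriv_coeff_diag: "formal_deriv_coeff a \<rho> j k k = a ^ j"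
  by (induction j) (auto simp: formal_deriv_coeff_less)

lemma formal_deriv_coeff_Suc:
  "formal_deriv_coeff a \<rho> j k (Suc k) = of_nat j * a ^ (j - 1) * (\<rho> - of_nat k)"
proof (induction j)
  case (Suc j)
  \<comment> \<open>For j = 0 the truncated exponent j - 1 is off, but the factor j is then
    zero.\<close>
  have e: "of_nat j * a ^ (j - 1) * a = of_nat j * a ^ j"
    by (cases j) simp_all
  have "formal_deriv_coeff a \<rho> (Suc j) k (Suc k)
      = of_nat j * a ^ (j - 1) * a * (\<rho> - of_nat k) + (\<rho> - of_nat k) * a ^ j"
    by (simp add: Suc.IH formal_deriv_coeff_diag)
  then show ?case unfolding e by (simp add: algebra_simps del: formal_deriv_coeff.simps)
qed simp

lemma fps_nth_formal_deriv_funpow: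
  "fps_nth ((formal_deriv a \<rho> ^^ j) F) i = (\<Sum>k\<le>i. formal_deriv_coeff a \<rho> j k i * fps_nth F k)"
proof (induction j arbitrary: i)
  case 0
  then show ?case by (simp add: if_distrib[of "\<lambda>c. c * _"] sum.delta cong: if_cong)
next
  case (Suc j)
  show ?case
  proof (cases i)
    case 0
    then show ?thesis by (simp add: fps_nth_formal_deriv Suc.IH)
  next
    case (Suc l)
    have "fps_nth ((formal_deriv a \<rho> ^^ Suc j) F) i =
        a * (\<Sum>k\<le>i. formal_deriv_coeff a \<rho> j k i * fps_nth F k)
        + (\<rho> - of_nat l) * (\<Sum>k\<le>l. formal_deriv_coeff a \<rho> j k l * fps_nth F k)"
      using Suc by (simp add: fps_nth_formal_deriv Suc.IH)
    also have "(\<Sum>k\<le>l. formal_deriv_coeff a \<rho> j k l * fps_nth F k)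
        = (\<Sum>k\<le>i. formal_deriv_coeff a \<rho> j k l * fps_nth F k)"
      by (simp add: Suc formal_deriv_coeff_less)
    finally show ?thesis
      using Suc by (simp add: sum_distrib_left sum.distrib sum_subtractf algebra_simps del: sum.atMost_Suc)
  qed
qed

definition bessel_op_coeff ::
    "nat \<Rightarrow> (nat \<Rightarrow> complex) \<Rightarrow> complex \<Rightarrow> complex \<Rightarrow> complex \<Rightarrow> nat \<Rightarrow> nat \<Rightarrow> complex" where
  "bessel_op_coeff n V \<kappa> a \<rho> k i =
     (\<Sum>j\<le>n. V j * (if i < n - j then 0 else formal_deriv_coeff a \<rho> j k (i - (n - j))))
       - (if k = i then \<kappa> else 0)"

lemma fps_nth_bessel_op:
  "fps_nth (bessel_op n V \<kappa> a \<rho> F) i = (\<Sum>k\<le>i. bessel_op_coeff n V \<kappa> a \<rho> k i * fps_nth F k)"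
proof -
  have *: "fps_nth (fps_const (V j) * fps_X ^ (n - j) * (formal_deriv a \<rho> ^^ j) F) i
      = (\<Sum>k\<le>i. V j * (if i < n - j then 0 else formal_deriv_coeff a \<rho> j k (i - (n - j))) * fps_nth F k)"
    for j
  proof (cases "i < n - j")
    case True
    then show ?thesis by (simp add: fps_X_power_mult_nth mult.assoc)
  next
    case False
    have "(\<Sum>k\<le>i - (n - j). formal_deriv_coeff a \<rho> j k (i - (n - j)) * fps_nth F k)
        = (\<Sum>k\<le>i. formal_deriv_coeff a \<rho> j k (i - (n - j)) * fps_nth F k)"
      by (rule sum.mono_neutral_left) (auto simp: formal_deriv_coeff_less)
    then show ?thesis
      using False by (simp add: fps_X_power_mult_nth mult.assoc fps_nth_formal_deriv_funpow sum_distrib_left)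
  qed
  have "fps_nth (bessel_op n V \<kappa> a \<rho> F) i =
     (\<Sum>j\<le>n. \<Sum>k\<le>i. V j * (if i < n - j then 0 else formal_deriv_coeff a \<rho> j k (i - (n - j))) * fps_nth F k)
     - (\<Sum>k\<le>i. (if k = i then \<kappa> else 0) * fps_nth F k)"
    by (simp add: bessel_op_def fps_sum_nth * if_distrib[of "\<lambda>c. c * _"] sum.delta cong: if_cong)
  also have "\<dots> = (\<Sum>k\<le>i. bessel_op_coeff n V \<kappa> a \<rho> k i * fps_nth F k)"
    by (subst sum.swap) (simp add: bessel_op_coeff_def sum_subtractf sum_distrib_right left_diff_distrib)
  finally show ?thesis .
qed

text \<open>On the diagonal only the term j = n survives the shift by X^(n-j), so the entry is the
  characteristic value a^n - \<kappa>.\<close>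

lemma bessel_op_coeff_diag:
  assumes "V n = 1" "a ^ n = \<kappa>"
  shows "bessel_op_coeff n V \<kappa> a \<rho> k k = 0"
proof -
  have "(\<Sum>j\<le>n. V j * (if k < n - j then 0 else formal_deriv_coeff a \<rho> j k (k - (n - j))))
      = (\<Sum>j\<in>{n}. V j * (if k < n - j then 0 else formal_deriv_coeff a \<rho> j k (k - (n - j))))"
    by (rule sum.mono_neutral_right) (auto simp: formal_deriv_coeff_less)
  then show ?thesis
    using assms by (simp add: bessel_op_coeff_def formal_deriv_coeff_diag)
qed

text \<open>Two terms reach the first subdiagonal, V(n-1) a^(n-1) and n a^(n-1) (\<rho>-k). The
  assumption on V(n-1) cancels \<rho>; for nonzero a the entry is then zero at k = 0 only.\<close>

lemma bessel_op_coeff_Suc: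
  assumes "V n = 1" "V (n - 1) = - (of_nat n * \<rho>)" "n \<ge> 1"
  shows "bessel_op_coeff n V \<kappa> a \<rho> k (Suc k) = - (of_nat k * of_nat n * a ^ (n - 1))"
proof -
  have "(\<Sum>j\<le>n. V j * (if Suc k < n - j then 0 else formal_deriv_coeff a \<rho> j k (Suc k - (n - j))))
      = (\<Sum>j\<in>{n - 1, n}. V j * (if Suc k < n - j then 0 else formal_deriv_coeff a \<rho> j k (Suc k - (n - j))))"
    using assms(3) by (intro sum.mono_neutral_right) (auto simp: formal_deriv_coeff_less)
  also have "\<dots> = - (of_nat k * of_nat n * a ^ (n - 1))"
    using assms by (simp add: formal_deriv_coeff_diag formal_deriv_coeff_Suc algebra_simps)
  finally show ?thesis by (simp add: bessel_op_coeff_def)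
qed

text \<open>As the diagonal vanishes, coefficient m+2 of the equation does not see F_(m+2) and is
  solved for F_(m+1) through the subdiagonal entry. This explains the two different index
  shifts.\<close>

fun bessel_formal_coeff ::
    "nat \<Rightarrow> (nat \<Rightarrow> complex) \<Rightarrow> complex \<Rightarrow> complex \<Rightarrow> complex \<Rightarrow> nat \<Rightarrow> complex" where
  "bessel_formal_coeff n V \<kappa> a \<rho> 0 = 1"
| "bessel_formal_coeff n V \<kappa> a \<rho> (Suc m) =
     inverse (of_nat (Suc m) * of_nat n * a ^ (n - 1)) *
     (\<Sum>k\<le>m. bessel_op_coeff n V \<kappa> a \<rho> k (Suc (Suc m)) * bessel_formal_coeff n V \<kappa> a \<rho> k)"

text \<open>Coefficient 0 of the equation holds by a^n = \<kappa>, coefficient 1 by the choice of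
  \<rho>, and coefficient m+2 is the recursion for F_(m+1). So the normalisation F_0 = 1 leaves one
  solution.\<close>

lemma bessel_op_eq_0_iff:
  assumes "V n = 1" "V (n - 1) = - (of_nat n * \<rho>)" "n \<ge> 1" "a ^ n = \<kappa>" "a \<noteq> 0"
    and "fps_nth F 0 = 1"
  shows "bessel_op n V \<kappa> a \<rho> F = 0 \<longleftrightarrow> F = Abs_fps (bessel_formal_coeff n V \<kappa> a \<rho>)"
proof -
  let ?L = "bessel_op_coeff n V \<kappa> a \<rho>"
  have nth_Suc: "fps_nth (bessel_op n V \<kappa> a \<rho> F) (Suc m) =
      (\<Sum>k<m. ?L k (Suc m) * fps_nth F k) - of_nat m * of_nat n * a ^ (n - 1) * fps_nth F m" for m
    using assms
    by (simp add: fps_nth_bessel_op bessel_op_coeff_diag bessel_op_coeff_Suc lessThan_Suc_atMost[symmetric])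
  have nth_0: "fps_nth (bessel_op n V \<kappa> a \<rho> F) 0 = 0"
    using assms by (simp add: fps_nth_bessel_op bessel_op_coeff_diag)
  have rec: "fps_nth (bessel_op n V \<kappa> a \<rho> F) (Suc (Suc m)) = 0 \<longleftrightarrow>
      fps_nth F (Suc m) = inverse (of_nat (Suc m) * of_nat n * a ^ (n - 1)) *
        (\<Sum>k\<le>m. ?L k (Suc (Suc m)) * fps_nth F k)" for m
  proof -
    have "of_nat (Suc m) * of_nat n * a ^ (n - 1) \<noteq> 0"
      using assms by (simp del: of_nat_Suc)
    then show ?thesis
      unfolding nth_Suc lessThan_Suc_atMost by (auto simp: field_simps simp del: of_nat_Suc)
  qed
  have one: "fps_nth (bessel_op n V \<kappa> a \<rho> F) (Suc 0) = 0"
    by (simp add: nth_Suc)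
  show ?thesis
  proof
    assume "bessel_op n V \<kappa> a \<rho> F = 0"
    then have r: "fps_nth F (Suc m) = inverse (of_nat (Suc m) * of_nat n * a ^ (n - 1)) *
        (\<Sum>k\<le>m. ?L k (Suc (Suc m)) * fps_nth F k)" for m
      by (intro rec[THEN iffD1]) simp
    have "fps_nth F m = bessel_formal_coeff n V \<kappa> a \<rho> m" for m
    proof (induction m rule: less_induct)
      case (less m)
      then show ?case
        using assms(6) r by (cases m) (auto intro!: sum.cong)
    qed
    then show "F = Abs_fps (bessel_formal_coeff n V \<kappa> a \<rho>)" by (simp add: fps_eq_iff)
  next
    assume F: "F = Abs_fps (bessel_formal_coeff n V \<kappa> a \<rho>)"
    have "fps_nth (bessel_op n V \<kappa> a \<rho> F) (Suc (Suc m)) = 0" for m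
      unfolding rec by (simp add: F)
    then show "bessel_op n V \<kappa> a \<rho> F = 0"
      using nth_0 one by (metis fps_ext fps_zero_nth not0_implies_Suc)
  qed
qed

text \<open>The recursion divides only by (m+1) n a^(n-1), which is independent of the indices, and
  otherwise forms sums and products of the symmetric V_j. It thus defines polynomials on the whole
  space, also off the hyperplane on which the series is a solution.\<close>

lemma symmetric_polynomial_bessel_formal_coeff:
  "symmetric_polynomial (\<lambda>lam :: complex ^ 'n. bessel_formal_coeff n (bessel_V lam) \<kappa> a \<rho> m)"
proof (induction m rule: less_induct)
  case (less m)
  have L: "symmetric_polynomial (\<lambda>lam :: complex ^ 'n. bessel_op_coeff n (bessel_V lam) \<kappa> a \<rho> k i)" for k i
    unfolding bessel_op_coeff_def diff_conv_add_uminus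
    by (intro symmetric_polynomial_add symmetric_polynomial_sum symmetric_polynomial_mult
        symmetric_polynomial_bessel_V symmetric_polynomial_const)
  show ?case
  proof (cases m)
    case 0
    then show ?thesis by (simp add: symmetric_polynomial_const)
  next
    case (Suc k)
    show ?thesis
      unfolding Suc bessel_formal_coeff.simps
      by (intro symmetric_polynomial_cmult symmetric_polynomial_sum symmetric_polynomial_mult L less)
         (simp add: Suc)
  qed
qed

section \<open>Decaying solutions of first-order equations on a half-plane\<close>

text \<open>Bernoulli's inequality (1 + (s/a)^2)^p \<ge> 1 + p (s/a)^2 dominates the derivative by
  that of an arctangent. The scale a/sqrt p of its argument produces the factor 1/sqrt p that makes
  the later iteration contract.\<close>

lemma arctan_increment_bound:
  fixes y g :: "real \<Rightarrow> complex"
  assumes der: "\<And>s. s \<ge> 0 \<Longrightarrow> (y has_vector_derivative g s) (at s)"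
    and bnd: "\<And>s. s \<ge> 0 \<Longrightarrow> norm (g s) \<le> A / (a\<^sup>2 + s\<^sup>2) ^ p"
    and "a > 0" "p \<ge> 1" "A \<ge> 0" "0 \<le> s" "s \<le> t"
  defines "\<phi> \<equiv> (\<lambda>s. A * a / (a ^ (2 * p) * sqrt (real p)) * arctan (sqrt (real p) * s / a))"
  shows "norm (y t - y s) \<le> \<phi> t - \<phi> s"
proof (cases "s = t")
  case False
  define \<phi>' where "\<phi>' = (\<lambda>s. A / (a ^ (2 * p) * (1 + real p * (s / a)\<^sup>2)))"
  have sp: "sqrt (real p) > 0" "(sqrt (real p))\<^sup>2 = real p" using \<open>p \<ge> 1\<close> by simp_all
  have d\<phi>: "(\<phi> has_real_derivative \<phi>' x) (at x)" for x
  proof -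
    have "1 + (sqrt (real p) * x / a)\<^sup>2 = 1 + real p * (x / a)\<^sup>2"
      by (simp add: power_mult_distrib power_divide)
    moreover have "((\<lambda>x. sqrt (real p) * x / a) has_real_derivative sqrt (real p) / a) (at x)"
      using \<open>a > 0\<close> by (auto intro!: derivative_eq_intros)
    then have "(\<phi> has_real_derivative A * a / (a ^ (2 * p) * sqrt (real p)) *
        (inverse (1 + (sqrt (real p) * x / a)\<^sup>2) * (sqrt (real p) / a))) (at x)"
      unfolding \<phi>_def by (intro DERIV_cmult DERIV_chain2[OF DERIV_arctan])
    ultimately have "(\<phi> has_real_derivative A * inverse (1 + real p * (x / a)\<^sup>2) / a ^ (2 * p)) (at x)"
      using sp(1) \<open>a > 0\<close> by simp
    then show ?thesis by (simp add: \<phi>'_def divide_inverse mult_ac)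
  qed
  have le: "norm (g x) \<le> \<phi>' x" if "x \<ge> 0" for x
  proof -
    have "a ^ (2 * p) * (1 + real p * (x / a)\<^sup>2) \<le> a ^ (2 * p) * (1 + (x / a)\<^sup>2) ^ p"
      using \<open>a > 0\<close> order_trans[OF _ zero_le_power2, of "- 1" "x / a"]
      by (intro mult_left_mono Bernoulli_inequality) auto
    also have "\<dots> = (a\<^sup>2 * (1 + (x / a)\<^sup>2)) ^ p"
      by (simp add: power_mult_distrib power_mult)
    also have "a\<^sup>2 * (1 + (x / a)\<^sup>2) = a\<^sup>2 + x\<^sup>2"
      using \<open>a > 0\<close> by (simp add: field_simps)
    finally have *: "a ^ (2 * p) * (1 + real p * (x / a)\<^sup>2) \<le> (a\<^sup>2 + x\<^sup>2) ^ p" .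
    have pos: "0 < a ^ (2 * p) * (1 + real p * (x / a)\<^sup>2)"
      using \<open>a > 0\<close> by (intro mult_pos_pos add_pos_nonneg) auto
    have "A / (a\<^sup>2 + x\<^sup>2) ^ p \<le> \<phi>' x"
      unfolding \<phi>'_def by (rule frac_le[OF \<open>A \<ge> 0\<close> order_refl pos *])
    then show ?thesis using bnd[OF that] by linarith
  qed
  show ?thesis
  proof (rule differentiable_bound_general[where f = y and \<phi> = \<phi> and f' = g and \<phi>' = \<phi>'])
    show "s < t" using False assms by simp
    show "continuous_on {s..t} y"
      using has_vector_derivative_continuous[OF der] \<open>0 \<le> s\<close>
      by (intro continuous_at_imp_continuous_on) auto
    show "continuous_on {s..t} \<phi>"
      using d\<phi> by (intro continuous_at_imp_continuous_on) (auto intro: DERIV_isCont)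
  qed (use der le d\<phi> \<open>0 \<le> s\<close> in \<open>auto simp: has_real_derivative_iff_has_vector_derivative\<close>)
qed simp

lemma arctan_majorant_tendsto:
  assumes "a > 0" "p \<ge> (1 :: nat)"
  shows "((\<lambda>s. A * a / (a ^ (2 * p) * sqrt (real p)) * arctan (sqrt (real p) * s / a))
    \<longlongrightarrow> A * (pi / (2 * sqrt (real p))) * a / a ^ (2 * p)) at_top"
proof -
  have "filterlim (\<lambda>s. (sqrt (real p) / a) * s) at_top at_top"
    using assms by (intro filterlim_tendsto_pos_mult_at_top[OF tendsto_const] filterlim_ident) simp
  then have "((\<lambda>s. arctan ((sqrt (real p) / a) * s)) \<longlongrightarrow> pi / 2) at_top"
    by (rule filterlim_compose[OF tendsto_arctan_at_top])
  then have "((\<lambda>s. A * a / (a ^ (2 * p) * sqrt (real p)) * arctan ((sqrt (real p) / a) * s))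
    \<longlongrightarrow> A * a / (a ^ (2 * p) * sqrt (real p)) * (pi / 2)) at_top"
    by (intro tendsto_intros)
  then show ?thesis by (simp add: field_simps)
qed

lemma convergent_at_top_of_bound:
  fixes y g :: "real \<Rightarrow> complex"
  assumes der: "\<And>s. s \<ge> 0 \<Longrightarrow> (y has_vector_derivative g s) (at s)"
    and bnd: "\<And>s. s \<ge> 0 \<Longrightarrow> norm (g s) \<le> A / (a\<^sup>2 + s\<^sup>2) ^ p"
    and "a > 0" "p \<ge> 1" "A \<ge> 0"
  shows "\<exists>L. (y \<longlongrightarrow> L) at_top"
proof -
  define \<phi> where "\<phi> = (\<lambda>s. A * a / (a ^ (2 * p) * sqrt (real p)) * arctan (sqrt (real p) * s / a))"
  define M where "M = A * (pi / (2 * sqrt (real p))) * a / a ^ (2 * p)"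
  have lim: "(\<phi> \<longlongrightarrow> M) at_top"
    unfolding \<phi>_def M_def using assms by (intro arctan_majorant_tendsto)
  have inc: "norm (y t - y s) \<le> \<phi> t - \<phi> s" if "0 \<le> s" "s \<le> t" for s t
    unfolding \<phi>_def using assms that by (intro arctan_increment_bound) auto
  have "(\<lambda>N. \<phi> (real N)) \<longlonglongrightarrow> M"
    using lim by (rule filterlim_compose) (rule filterlim_real_sequentially)
  then have C: "Cauchy (\<lambda>N. \<phi> (real N))" by (rule LIMSEQ_imp_Cauchy)
  have "Cauchy (\<lambda>N. y (real N))"
  proof (rule metric_CauchyI)
    fix e :: real
    assume "e > 0"
    then obtain K where K: "\<And>m k. m \<ge> K \<Longrightarrow> k \<ge> K \<Longrightarrow> dist (\<phi> (real m)) (\<phi> (real k)) < e"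
      using metric_CauchyD[OF C] by blast
    have "dist (y (real m)) (y (real k)) < e" if "m \<ge> K" "k \<ge> K" for m k
    proof (cases "m \<le> k")
      case True
      then show ?thesis
        using K[OF that] inc[of "real m" "real k"] by (simp add: dist_norm norm_minus_commute)
    next
      case False
      then show ?thesis
        using K[OF that] inc[of "real k" "real m"] by (simp add: dist_norm norm_minus_commute)
    qed
    then show "\<exists>K. \<forall>m\<ge>K. \<forall>k\<ge>K. dist (y (real m)) (y (real k)) < e" by blast
  qed
  then obtain L where L: "(\<lambda>N. y (real N)) \<longlonglongrightarrow> L"
    using Cauchy_convergent_iff convergent_def by blast
  \<comment> \<open>The limit along the integers is the limit over the reals: in the increment bound
    from t, the other point runs through the integers.\<close>
  have "norm (y t - L) \<le> M - \<phi> t" if "t \<ge> 0" for t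
  proof (rule tendsto_le)
    show "(\<lambda>N. norm (y t - y (real N))) \<longlonglongrightarrow> norm (y t - L)" by (intro tendsto_intros L)
    show "(\<lambda>N. \<phi> (real N) - \<phi> t) \<longlonglongrightarrow> M - \<phi> t"
      by (intro tendsto_intros filterlim_compose[OF lim] filterlim_real_sequentially)
    show "\<forall>\<^sub>F N in sequentially. norm (y t - y (real N)) \<le> \<phi> (real N) - \<phi> t"
      using eventually_ge_at_top[of "nat \<lceil>t\<rceil>"]
    proof eventually_elim
      case (elim N)
      then have "t \<le> real N" by linarith
      then show ?case using inc[OF that, of "real N"] by (simp add: norm_minus_commute)
    qed
  qed simp
  then have "\<forall>\<^sub>F t in at_top. norm (y t - L) \<le> M - \<phi> t"
    by (rule eventually_mono[OF eventually_ge_at_top[of 0]])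
  moreover have "((\<lambda>t. M - \<phi> t) \<longlongrightarrow> 0) at_top"
    using tendsto_diff[OF tendsto_const[of M] lim] by simp
  ultimately have "((\<lambda>t. y t - L) \<longlongrightarrow> 0) at_top"
    by (rule Lim_null_comparison)
  then show ?thesis by (metis LIM_zero_iff)
qed

text \<open>The integrating factor turns the equation into y' = exp(-\<nu> s) f, and Re \<nu> \<ge>
  -c means that it costs at most the decay exp(-cs) of f. The limit zero at infinity excludes the
  homogeneous solution, so y(0) is minus the total increment of y.\<close>

lemma decaying_solution_bound:
  fixes u f :: "real \<Rightarrow> complex"
  assumes der: "\<And>s. s \<ge> 0 \<Longrightarrow> (u has_vector_derivative (\<nu> * u s + f s)) (at s)"
    and bnd: "\<And>s. s \<ge> 0 \<Longrightarrow> norm (f s) \<le> A * exp (- c * s) / (a\<^sup>2 + s\<^sup>2) ^ p"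
    and "a > 0" "p \<ge> 1" "A \<ge> 0" "Re \<nu> \<ge> - c"
    and lim: "((\<lambda>s. exp (- \<nu> * of_real s) * u s) \<longlongrightarrow> 0) at_top"
  shows "norm (u 0) \<le> A * (pi / (2 * sqrt (real p))) * a / a ^ (2 * p)"
proof -
  define y where "y = (\<lambda>s. exp (- \<nu> * of_real s) * u s)"
  define \<phi> where "\<phi> = (\<lambda>s. A * a / (a ^ (2 * p) * sqrt (real p)) * arctan (sqrt (real p) * s / a))"
  have dy: "(y has_vector_derivative exp (- \<nu> * of_real s) * f s) (at s)" if "s \<ge> 0" for s
  proof -
    have "((\<lambda>s. exp (- \<nu> * of_real s)) has_vector_derivative exp (- \<nu> * of_real s) * (- \<nu>)) (at s)"
      by (rule has_vector_derivative_real_field) (auto intro!: derivative_eq_intros)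
    from has_vector_derivative_mult[OF this der[OF that]]
    show ?thesis unfolding y_def by (simp add: algebra_simps)
  qed
  have yb: "norm (exp (- \<nu> * of_real s) * f s) \<le> A / (a\<^sup>2 + s\<^sup>2) ^ p" if "s \<ge> 0" for s
  proof -
    have "norm (exp (- \<nu> * of_real s) * f s) = exp (- Re \<nu> * s) * norm (f s)"
      by (simp add: norm_mult)
    also have "\<dots> \<le> exp (c * s) * (A * exp (- c * s) / (a\<^sup>2 + s\<^sup>2) ^ p)"
      using mult_right_mono[of "- Re \<nu>" c s] assms(6) that by (intro mult_mono bnd) auto
    also have "\<dots> = A / (a\<^sup>2 + s\<^sup>2) ^ p"
      by (simp add: exp_minus field_simps)
    finally show ?thesis .
  qed
  have inc: "norm (y s - y 0) \<le> \<phi> s - \<phi> 0" if "0 \<le> s" for s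
    unfolding \<phi>_def by (rule arctan_increment_bound[OF dy yb]) (use assms that in auto)
  have "norm (0 - y 0) \<le> A * (pi / (2 * sqrt (real p))) * a / a ^ (2 * p) - \<phi> 0"
  proof (rule tendsto_le)
    show "((\<lambda>s. norm (y s - y 0)) \<longlongrightarrow> norm (0 - y 0)) at_top"
      using lim unfolding y_def[symmetric] by (intro tendsto_intros)
    show "((\<lambda>s. \<phi> s - \<phi> 0) \<longlongrightarrow> A * (pi / (2 * sqrt (real p))) * a / a ^ (2 * p) - \<phi> 0) at_top"
      unfolding \<phi>_def using assms by (intro tendsto_intros arctan_majorant_tendsto)
    show "\<forall>\<^sub>F s in at_top. norm (y s - y 0) \<le> \<phi> s - \<phi> 0"
      by (rule eventually_mono[OF eventually_ge_at_top[of 0]]) (rule inc)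
  qed simp
  then show ?thesis by (simp add: y_def \<phi>_def)
qed

text \<open>The region is stable under translation to the right and is the exponential of a convex
  half-strip. The condition |z| > 1 keeps away from the singular point and lets powers of |z| be
  compared by their exponents.\<close>

definition half_plane_ext :: "complex set" where
  "half_plane_ext = {z. Re z > 0 \<and> norm z > 1}"

lemma open_half_plane_ext: "open half_plane_ext"
  unfolding half_plane_ext_def by (intro open_Collect_conj open_Collect_less continuous_intros)

lemma Ln_half_plane_ext:
  assumes "z \<in> half_plane_ext"
  shows "Re (Ln z) > 0" "\<bar>Im (Ln z)\<bar> < pi / 2" "z \<noteq> 0"
proof -
  show z: "z \<noteq> 0" using assms by (auto simp: half_plane_ext_def)
  then show "\<bar>Im (Ln z)\<bar> < pi / 2" using assms Re_Ln_pos_lt by (auto simp: half_plane_ext_def)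
  show "Re (Ln z) > 0" using z assms by (auto simp: half_plane_ext_def)
qed

lemma exp_in_half_plane_ext:
  assumes "Re s > 0" "\<bar>Im s\<bar> < pi / 2"
  shows "exp s \<in> half_plane_ext"
  using assms by (auto simp: half_plane_ext_def Re_exp intro!: mult_pos_pos cos_gt_zero_pi)

lemma half_plane_ext_add: "z \<in> half_plane_ext \<Longrightarrow> s \<ge> 0 \<Longrightarrow> z + of_real s \<in> half_plane_ext"
  and norm_half_plane_ext_add: "z \<in> half_plane_ext \<Longrightarrow> s \<ge> 0 \<Longrightarrow> (norm z)\<^sup>2 + s\<^sup>2 \<le> (norm (z + of_real s))\<^sup>2"
proof -
  assume z: "z \<in> half_plane_ext" and s: "s \<ge> 0"
  have "(norm (z + of_real s))\<^sup>2 = (norm z)\<^sup>2 + s\<^sup>2 + 2 * s * Re z"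
    unfolding cmod_power2 by (simp add: power2_eq_square algebra_simps)
  moreover have "2 * s * Re z \<ge> 0" using z s by (auto simp: half_plane_ext_def)
  ultimately show *: "(norm z)\<^sup>2 + s\<^sup>2 \<le> (norm (z + of_real s))\<^sup>2" by linarith
  then have "(norm z)\<^sup>2 \<le> (norm (z + of_real s))\<^sup>2" using zero_le_power2[of s] by linarith
  then have "norm z \<le> norm (z + of_real s)" by simp
  then show "z + of_real s \<in> half_plane_ext" using z s by (auto simp: half_plane_ext_def)
qed

text \<open>The region is not convex, but the principal logarithm maps it onto a half-strip that is.
  There g(exp s) exp s has a primitive, and composing it with the logarithm gives one of g.\<close>

lemma holomorphic_half_plane_ext_primitive:
  assumes "g holomorphic_on half_plane_ext"
  shows "\<exists>G. \<forall>z\<in>half_plane_ext. (G has_field_derivative g z) (at z)"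
proof -
  define T where "T = {s. Re s > 0} \<inter> {s. Im s < pi / 2} \<inter> {s. Im s > - pi / 2}"
  have T: "convex T" "open T"
    unfolding T_def
    by (intro convex_Int convex_halfspace_Re_gt convex_halfspace_Im_lt convex_halfspace_Im_gt)
       (intro open_Int open_halfspace_Re_gt open_halfspace_Im_lt open_halfspace_Im_gt)
  have expT: "exp s \<in> half_plane_ext" if "s \<in> T" for s
    using that by (intro exp_in_half_plane_ext) (auto simp: T_def abs_less_iff)
  have "(\<lambda>s. g (exp s) * exp s) holomorphic_on T"
    using holomorphic_on_compose_gen[OF holomorphic_on_exp assms, of T] expT
    by (intro holomorphic_intros) (auto simp: o_def)
  then obtain H where H: "\<And>s. s \<in> T \<Longrightarrow> (H has_field_derivative g (exp s) * exp s) (at s within T)"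
    using holomorphic_convex_primitive'[OF T] by blast
  have "((H \<circ> Ln) has_field_derivative g z) (at z)" if "z \<in> half_plane_ext" for z
  proof -
    note Lz = Ln_half_plane_ext[OF that]
    have "Ln z \<in> T" using Lz by (auto simp: T_def abs_less_iff)
    then have "(H has_field_derivative g (exp (Ln z)) * exp (Ln z)) (at (Ln z))"
      using H[of "Ln z"] at_within_open[OF _ T(2), of "Ln z"] by simp
    moreover have "(Ln has_field_derivative inverse z) (at z)"
      using that by (intro has_field_derivative_Ln) (auto simp: half_plane_ext_def complex_nonpos_Reals_iff)
    ultimately have "((H \<circ> Ln) has_field_derivative g (exp (Ln z)) * exp (Ln z) * inverse z) (at z)"
      by (rule DERIV_chain)
    then show ?thesis using Lz(3) by (simp add: mult.assoc)
  qed
  then show ?thesis by blast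
qed

text \<open>The solution is exp(\<nu> z) (G - L) for a primitive G of exp(-\<nu> z) f and its limit
  L at infinity. Holomorphy needs the same L on every horizontal ray, so each ray is compared with
  the one starting at 2.\<close>

lemma half_plane_ext_ode:
  assumes f: "f holomorphic_on half_plane_ext"
    and bnd: "\<And>z. z \<in> half_plane_ext \<Longrightarrow> norm (f z) \<le> A * exp (- c * Re z) / norm z ^ (2 * p)"
    and "p \<ge> 1" "Re \<nu> \<ge> - c"
  shows "\<exists>u. \<forall>z\<in>half_plane_ext. (u has_field_derivative \<nu> * u z + f z) (at z) \<and>
    norm (u z) \<le> A * (pi / (2 * sqrt (real p))) * exp (- c * Re z) * norm z / norm z ^ (2 * p)"
proof -
  define g where "g = (\<lambda>z. exp (- \<nu> * z) * f z)"
  have "g holomorphic_on half_plane_ext"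
    unfolding g_def by (intro holomorphic_intros f)
  then obtain G where G: "\<And>z. z \<in> half_plane_ext \<Longrightarrow> (G has_field_derivative g z) (at z)"
    using holomorphic_half_plane_ext_primitive by blast
  have two: "2 \<in> half_plane_ext" by (simp add: half_plane_ext_def)
  have "0 \<le> A * exp (- c * Re 2) / norm (2 :: complex) ^ (2 * p)"
    using norm_ge_zero bnd[OF two] order_trans by blast
  then have A: "A \<ge> 0"
    by (rule contrapos_pp) (simp add: not_le divide_neg_pos mult_neg_pos)
  have line: "((\<lambda>s. h (z + of_real s)) has_vector_derivative h' (z + of_real s)) (at s)"
    if "(h has_field_derivative h' (z + of_real s)) (at (z + of_real s))"
    for h h' :: "complex \<Rightarrow> complex" and z s
  proof -
    have "((\<lambda>s. z + of_real s) has_vector_derivative 1) (at s)"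
      using has_vector_derivative_add[OF has_vector_derivative_const has_vector_derivative_of_real[OF DERIV_ident]]
      by simp
    then show ?thesis
      using field_vector_diff_chain_at[where f = "\<lambda>s. z + of_real s" and g = h and x = s] that
      by (force simp: o_def)
  qed
  have gb: "norm (g z) \<le> A * exp (Im \<nu> * Im z - (Re \<nu> + c) * Re z) / norm z ^ (2 * p)"
    if "z \<in> half_plane_ext" for z
  proof -
    have "norm (g z) = exp (Im \<nu> * Im z - Re \<nu> * Re z) * norm (f z)"
      by (simp add: g_def norm_mult algebra_simps)
    also have "\<dots> \<le> exp (Im \<nu> * Im z - Re \<nu> * Re z) * (A * exp (- c * Re z) / norm z ^ (2 * p))"
      by (intro mult_left_mono bnd that) simp
    also have "\<dots> = A * (exp (Im \<nu> * Im z - Re \<nu> * Re z) * exp (- c * Re z)) / norm z ^ (2 * p)"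
      by simp
    also have "exp (Im \<nu> * Im z - Re \<nu> * Re z) * exp (- c * Re z) = exp (Im \<nu> * Im z - (Re \<nu> + c) * Re z)"
      by (simp add: exp_add[symmetric] algebra_simps)
    finally show ?thesis .
  qed
  have nz: "norm z > 0" if "z \<in> half_plane_ext" for z
    using that by (auto simp: half_plane_ext_def)
  have pow: "((norm z)\<^sup>2 + s\<^sup>2) ^ p \<le> norm (z + of_real s) ^ (2 * p)" if "z \<in> half_plane_ext" "s \<ge> 0" for z s
    unfolding power_mult using norm_half_plane_ext_add[OF that] by (intro power_mono) auto
  have pos: "((norm z)\<^sup>2 + s\<^sup>2) ^ p > 0" if "z \<in> half_plane_ext" for z and s :: real
    using nz[OF that] by (intro zero_less_power add_pos_nonneg) auto
  have ex: "\<exists>L. ((\<lambda>s. G (z + of_real s)) \<longlongrightarrow> L) at_top" if z: "z \<in> half_plane_ext" for z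
  proof (rule convergent_at_top_of_bound[where g = "\<lambda>s. g (z + of_real s)" and a = "norm z" and p = p])
    fix s :: real
    assume s: "s \<ge> 0"
    note zs = half_plane_ext_add[OF z s]
    show "((\<lambda>s. G (z + of_real s)) has_vector_derivative g (z + of_real s)) (at s)"
      by (intro line G zs)
    have "norm (g (z + of_real s)) \<le> A * exp (Im \<nu> * Im z - (Re \<nu> + c) * (Re z + s)) / norm (z + of_real s) ^ (2 * p)"
      using gb[OF zs] by simp
    also have "\<dots> \<le> A * exp (Im \<nu> * Im z - (Re \<nu> + c) * Re z) / ((norm z)\<^sup>2 + s\<^sup>2) ^ p"
      using assms(4) s A pow[OF z s] pos[OF z] by (intro frac_le mult_left_mono) (auto intro!: mult_left_mono)
    finally show "norm (g (z + of_real s)) \<le> A * exp (Im \<nu> * Im z - (Re \<nu> + c) * Re z) / ((norm z)\<^sup>2 + s\<^sup>2) ^ p" .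
  qed (use nz[OF z] A assms in auto)
  from ex[OF two] obtain L where L: "((\<lambda>s. G (2 + of_real s)) \<longlongrightarrow> L) at_top" by blast
  \<comment> \<open>The points z + s and 2 + s are joined by a segment of length independent of s on
    which |t| \<ge> s. There the derivative of G is O(1/s), so the two limits agree.\<close>
  have lim: "((\<lambda>s. G (z + of_real s)) \<longlongrightarrow> L) at_top" if z: "z \<in> half_plane_ext" for z
  proof -
    define K where "K = A * exp (\<bar>Im \<nu>\<bar> * \<bar>Im z\<bar>) * norm (z - 2)"
    have "norm (G (z + of_real s) - G (2 + of_real s)) \<le> K / s" if s: "s \<ge> 1" for s
    proof -
      have seg: "t \<in> half_plane_ext \<and> norm t \<ge> s \<and> \<bar>Im t\<bar> \<le> \<bar>Im z\<bar> \<and> Re t \<ge> 0"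
        if t: "t \<in> closed_segment (z + of_real s) (2 + of_real s)" for t
      proof -
        obtain v where v: "0 \<le> v" "v \<le> 1" "t = (1 - v) *\<^sub>R (z + of_real s) + v *\<^sub>R (2 + of_real s)"
          using t by (auto simp: in_segment)
        have "Re t = (1 - v) * Re z + v * 2 + s" unfolding v(3) by (simp add: algebra_simps)
        moreover have "(1 - v) * Re z + v * 2 > 0"
        proof (cases "v = 0")
          case False
          then show ?thesis
            using v(1,2) z by (intro add_nonneg_pos) (auto simp: half_plane_ext_def)
        qed (use z in \<open>auto simp: half_plane_ext_def\<close>)
        ultimately have "Re t > s" by linarith
        moreover have "norm t \<ge> Re t" by (rule complex_Re_le_cmod)
        moreover have "\<bar>Im t\<bar> \<le> \<bar>Im z\<bar>"
          using v by (simp add: abs_mult mult_left_le_one_le)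
        ultimately show ?thesis using s by (auto simp: half_plane_ext_def)
      qed
      have "norm (G (z + of_real s) - G (2 + of_real s))
          \<le> A * exp (\<bar>Im \<nu>\<bar> * \<bar>Im z\<bar>) / s * norm (z + of_real s - (2 + of_real s))"
      proof (rule field_differentiable_bound[where S = "closed_segment (z + of_real s) (2 + of_real s)" and f' = g])
        fix t
        assume t: "t \<in> closed_segment (z + of_real s) (2 + of_real s)"
        note st = seg[OF t]
        show "(G has_field_derivative g t) (at t within closed_segment (z + of_real s) (2 + of_real s))"
          using G st by (blast intro: has_field_derivative_at_within)
        have e: "Im \<nu> * Im t - (Re \<nu> + c) * Re t \<le> \<bar>Im \<nu>\<bar> * \<bar>Im z\<bar>"
        proof -
          have "Im \<nu> * Im t \<le> \<bar>Im \<nu>\<bar> * \<bar>Im t\<bar>" by (simp add: abs_mult[symmetric])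
          also have "\<dots> \<le> \<bar>Im \<nu>\<bar> * \<bar>Im z\<bar>" using st by (intro mult_left_mono) auto
          finally show ?thesis using assms(4) st by (smt (verit) mult_nonneg_nonneg)
        qed
        have "s \<le> norm t ^ 1" using st by simp
        also have "\<dots> \<le> norm t ^ (2 * p)" using st s assms(3) by (intro power_increasing) auto
        finally have "s \<le> norm t ^ (2 * p)" .
        then have "A * exp (Im \<nu> * Im t - (Re \<nu> + c) * Re t) / norm t ^ (2 * p) \<le> A * exp (\<bar>Im \<nu>\<bar> * \<bar>Im z\<bar>) / s"
          using e A s by (intro frac_le mult_left_mono) auto
        then show "norm (g t) \<le> A * exp (\<bar>Im \<nu>\<bar> * \<bar>Im z\<bar>) / s"
          using gb[of t] st by linarith
      qed auto
      then show ?thesis by (simp add: K_def)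
    qed
    then have "\<forall>\<^sub>F s in at_top. norm (G (z + of_real s) - G (2 + of_real s)) \<le> K / s"
      by (rule eventually_mono[OF eventually_ge_at_top[of 1]])
    moreover have "((\<lambda>s. K / s) \<longlongrightarrow> 0) at_top"
      by (intro tendsto_divide_0[OF tendsto_const] filterlim_at_top_imp_at_infinity filterlim_ident)
    ultimately have "((\<lambda>s. G (z + of_real s) - G (2 + of_real s)) \<longlongrightarrow> 0) at_top"
      by (rule Lim_null_comparison)
    from tendsto_add[OF this L] show ?thesis by simp
  qed
  define u where "u = (\<lambda>z. exp (\<nu> * z) * (G z - L))"
  have du: "(u has_field_derivative \<nu> * u z + f z) (at z)" if "z \<in> half_plane_ext" for z
  proof -
    have "(u has_field_derivative exp (\<nu> * z) * \<nu> * (G z - L) + exp (\<nu> * z) * g z) (at z)"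
      unfolding u_def by (rule derivative_eq_intros G that refl | simp)+
    moreover have "exp (\<nu> * z) * g z = f z"
      by (simp add: g_def mult.assoc[symmetric] exp_add[symmetric])
    ultimately show ?thesis by (simp add: u_def mult_ac)
  qed
  have "norm (u z) \<le> A * (pi / (2 * sqrt (real p))) * exp (- c * Re z) * norm z / norm z ^ (2 * p)"
    if z: "z \<in> half_plane_ext" for z
  proof -
    have "norm (u (z + of_real 0)) \<le> (A * exp (- c * Re z)) * (pi / (2 * sqrt (real p))) * norm z / norm z ^ (2 * p)"
    proof (rule decaying_solution_bound[where u = "\<lambda>s. u (z + of_real s)" and f = "\<lambda>s. f (z + of_real s)" and c = c])
      fix s :: real
      assume s: "s \<ge> 0"
      note zs = half_plane_ext_add[OF z s]
      show "((\<lambda>s. u (z + of_real s)) has_vector_derivative \<nu> * u (z + of_real s) + f (z + of_real s)) (at s)"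
        using line[of u "\<lambda>z. \<nu> * u z + f z"] du[OF zs] by simp
      have "norm (f (z + of_real s)) \<le> A * exp (- c * (Re z + s)) / norm (z + of_real s) ^ (2 * p)"
        using bnd[OF zs] by simp
      also have "\<dots> \<le> A * exp (- c * (Re z + s)) / ((norm z)\<^sup>2 + s\<^sup>2) ^ p"
        using A pow[OF z s] pos[OF z] by (intro divide_left_mono mult_pos_pos mult_nonneg_nonneg) (auto intro: order_less_le_trans)
      also have "A * exp (- c * (Re z + s)) = A * exp (- c * Re z) * exp (- c * s)"
        by (simp add: exp_add[symmetric] algebra_simps)
      finally show "norm (f (z + of_real s)) \<le> A * exp (- c * Re z) * exp (- c * s) / ((norm z)\<^sup>2 + s\<^sup>2) ^ p" .
    next
      have "((\<lambda>s. exp (\<nu> * z) * (G (z + of_real s) - L)) \<longlongrightarrow> exp (\<nu> * z) * (L - L)) at_top"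
        by (intro tendsto_intros lim z)
      moreover have "exp (\<nu> * z) * (G (z + of_real s) - L) = exp (- \<nu> * of_real s) * u (z + of_real s)" for s
      proof -
        have "exp (\<nu> * z) = exp (- \<nu> * of_real s) * exp (\<nu> * (z + of_real s))"
          by (simp add: exp_add[symmetric] algebra_simps)
        then show ?thesis by (simp add: u_def mult.assoc)
      qed
      ultimately show "((\<lambda>s. exp (- \<nu> * of_real s) * u (z + of_real s)) \<longlongrightarrow> 0) at_top" by simp
    qed (use nz[OF z] A assms in auto)
    then show ?thesis by (simp add: mult_ac)
  qed
  then show ?thesis using du by blast
qed

text \<open>Solving a scalar equation costs a factor |z| pi/(2 sqrt p), a coupling coefficient gives
  back C/|z|, and the sum over n components leaves a factor of at most 1/2. So successive source
  terms halve, and the sum of all corrections at most doubles the first bound.\<close>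

lemma half_plane_ext_system:
  fixes \<nu> :: "nat \<Rightarrow> complex" and q :: "nat \<Rightarrow> complex \<Rightarrow> complex"
  assumes q: "\<And>k. k < n \<Longrightarrow> q k holomorphic_on half_plane_ext"
    and qb: "\<And>k z. k < n \<Longrightarrow> z \<in> half_plane_ext \<Longrightarrow> norm (q k z) \<le> C / norm z"
    and f: "f holomorphic_on half_plane_ext"
    and fb: "\<And>z. z \<in> half_plane_ext \<Longrightarrow> norm (f z) \<le> A * exp (- c * Re z) / norm z ^ (2 * p)"
    and p: "p \<ge> 1" "real n * C * (pi / (2 * sqrt (real p))) \<le> 1 / 2"
    and c: "c \<ge> 0" "\<And>k. k < n \<Longrightarrow> Re (\<nu> k) \<ge> - c"
  shows "\<exists>u. \<forall>k<n. \<forall>z\<in>half_plane_ext.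
    (u k has_field_derivative \<nu> k * u k z + (f z + (\<Sum>l<n. q l z * u l z))) (at z) \<and>
    norm (u k z) \<le> 2 * A * (pi / (2 * sqrt (real p))) * exp (- c * Re z) * norm z / norm z ^ (2 * p)"
proof -
  define \<Omega> where "\<Omega> = half_plane_ext"
  define r where "r = pi / (2 * sqrt (real p))"
  define hyp where "hyp = (\<lambda>f A. f holomorphic_on \<Omega> \<and>
    (\<forall>z\<in>\<Omega>. norm (f z) \<le> A * exp (- c * Re z) / norm z ^ (2 * p)))"
  define concl where "concl = (\<lambda>f A k u. \<forall>z\<in>\<Omega>. (u has_field_derivative \<nu> k * u z + f z) (at z) \<and>
    norm (u z) \<le> A * r * exp (- c * Re z) * norm z / norm z ^ (2 * p))"
  \<comment> \<open>A solution is chosen for each component and each pair of a source and its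
    constant, because the estimate that the chosen solution satisfies refers to that
    constant.\<close>
  have "\<forall>fA k. \<exists>u. hyp (fst fA) (snd fA) \<longrightarrow> k < n \<longrightarrow> concl (fst fA) (snd fA) k u"
  proof (intro allI)
    fix fA k
    show "\<exists>u. hyp (fst fA) (snd fA) \<longrightarrow> k < n \<longrightarrow> concl (fst fA) (snd fA) k u"
    proof (cases "hyp (fst fA) (snd fA) \<and> k < n")
      case True
      then have "\<exists>u. concl (fst fA) (snd fA) k u"
        unfolding hyp_def concl_def \<Omega>_def r_def
        by (intro half_plane_ext_ode p(1) c(2)) auto
      then show ?thesis by blast
    qed auto
  qed
  then obtain S where S: "\<And>f A k. hyp f A \<Longrightarrow> k < n \<Longrightarrow> concl f A k (S (f, A) k)"
    unfolding choice_iff by auto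
  \<comment> \<open>\<open>g i\<close> is the source of the i-th correction and carries the constant
    A/2^i; the coupling terms of that correction form the next source.\<close>
  define g where "g = rec_nat f (\<lambda>i h z. \<Sum>l<n. q l z * S (h, A / 2 ^ i) l z)"
  have g0: "g 0 = f" and gS: "g (Suc i) = (\<lambda>z. \<Sum>l<n. q l z * S (g i, A / 2 ^ i) l z)" for i
    by (simp_all add: g_def)
  have op: "open \<Omega>" by (simp add: \<Omega>_def open_half_plane_ext)
  have nz: "norm z > 1" "z \<noteq> 0" "Re z > 0" if "z \<in> \<Omega>" for z
    using that by (auto simp: \<Omega>_def half_plane_ext_def)
  have two: "2 \<in> half_plane_ext" by (simp add: half_plane_ext_def)
  have "0 \<le> A * exp (- c * Re 2) / norm (2 :: complex) ^ (2 * p)"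
    using norm_ge_zero fb[OF two] order_trans by blast
  then have A: "A \<ge> 0"
    by (rule contrapos_pp) (simp add: not_le divide_neg_pos mult_neg_pos)
  have r: "r > 0" using p(1) by (simp add: r_def)
  have hyp: "hyp (g i) (A / 2 ^ i)" for i
  proof (induction i)
    case 0
    then show ?case using f fb by (simp add: hyp_def g0 \<Omega>_def)
  next
    case (Suc i)
    note C = S[OF Suc, unfolded concl_def]
    have "S (g i, A / 2 ^ i) l holomorphic_on \<Omega>" if "l < n" for l
      using C[OF that] op holomorphic_on_open by blast
    then have "g (Suc i) holomorphic_on \<Omega>"
      unfolding gS using q by (intro holomorphic_intros) (auto simp: \<Omega>_def)
    moreover have "norm (g (Suc i) z) \<le> A / 2 ^ Suc i * exp (- c * Re z) / norm z ^ (2 * p)"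
      if z: "z \<in> \<Omega>" for z
    proof -
      let ?e = "exp (- c * Re z)" and ?N = "norm z ^ (2 * p)"
      have "norm (g (Suc i) z) \<le> (\<Sum>l<n. C / norm z * (A / 2 ^ i * r * ?e * norm z / ?N))"
        unfolding gS
      proof (rule sum_norm_le)
        fix l
        assume "l \<in> {..<n}"
        then have l: "l < n" by simp
        have "norm (q l z) \<le> C / norm z" using qb l z by (simp add: \<Omega>_def)
        moreover have "norm (S (g i, A / 2 ^ i) l z) \<le> A / 2 ^ i * r * ?e * norm z / ?N"
          using C[OF l] z by blast
        ultimately show "norm (q l z * S (g i, A / 2 ^ i) l z) \<le> C / norm z * (A / 2 ^ i * r * ?e * norm z / ?N)"
          unfolding norm_mult
          by (intro mult_mono) (auto intro: order_trans[OF norm_ge_zero])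
      qed
      also have "\<dots> = (real n * C * r) * (A / 2 ^ i * ?e / ?N)"
        using nz[OF z] by simp
      also have "\<dots> \<le> 1 / 2 * (A / 2 ^ i * ?e / ?N)"
        using p(2) A by (intro mult_right_mono) (auto simp: r_def)
      finally show ?thesis by (simp add: mult.assoc)
    qed
    ultimately show ?case by (simp add: hyp_def)
  qed
  note C = S[OF hyp, unfolded concl_def]
  define v where "v = (\<lambda>k i z. S (g i, A / 2 ^ i) k z)"
  define u where "u = (\<lambda>k z. \<Sum>i. v k i z)"
  have vd: "(v k i has_field_derivative \<nu> k * v k i z + g i z) (at z)"
    and vb: "norm (v k i z) \<le> (A * r * exp (- c * Re z) * norm z / norm z ^ (2 * p)) * (1 / 2) ^ i"
    if "k < n" "z \<in> \<Omega>" for k i z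
    using C[OF that(1)] that(2) by (auto simp: v_def power_divide field_simps)
  have half: "summable (\<lambda>i. K * (1 / 2) ^ i)" for K :: real
    by (intro summable_mult summable_geometric) simp
  have vs: "summable (\<lambda>i. v k i z)" if "k < n" "z \<in> \<Omega>" for k z
    by (rule summable_comparison_test'[OF half, of 0]) (rule vb[OF that])
  \<comment> \<open>As c \<ge> 0 and p \<ge> 1, the weight is at most 1 on the whole region, so a
    geometric series is a majorant. Uniform convergence then lets the derivative pass to the
    limit.\<close>
  have unif: "uniform_limit \<Omega> (\<lambda>N z. \<Sum>i<N. v k i z) (u k) sequentially" if k: "k < n" for k
    unfolding u_def
  proof (rule Weierstrass_m_test[OF _ half])
    fix i z
    assume z: "z \<in> \<Omega>"
    have "exp (- c * Re z) * norm z / norm z ^ (2 * p) \<le> 1"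
    proof -
      have "norm z ^ 1 \<le> norm z ^ (2 * p)"
        using nz[OF z] p(1) by (intro power_increasing) auto
      moreover have "exp (- c * Re z) \<le> 1" using nz[OF z] c(1) by simp
      ultimately have "exp (- c * Re z) * norm z \<le> 1 * norm z ^ (2 * p)"
        by (intro mult_mono) auto
      then show ?thesis using nz[OF z] by (simp add: divide_le_eq)
    qed
    then have "A * r * (exp (- c * Re z) * norm z / norm z ^ (2 * p)) * (1 / 2) ^ i \<le> A * r * 1 * (1 / 2) ^ i"
      using A r by (intro mult_right_mono mult_left_mono) auto
    then show "norm (v k i z) \<le> (A * r) * (1 / 2) ^ i"
      using vb[OF k z, of i] by (simp add: mult.assoc)
  qed
  have "(u k has_field_derivative \<nu> k * u k z + (f z + (\<Sum>l<n. q l z * u l z))) (at z) \<and>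
    norm (u k z) \<le> 2 * A * r * exp (- c * Re z) * norm z / norm z ^ (2 * p)"
    if k: "k < n" and z: "z \<in> \<Omega>" for k z
  proof
    have "g (Suc i) z = (\<Sum>l<n. q l z * v l i z)" for i by (simp add: gS v_def)
    then have "(\<lambda>i. g (Suc i) z) sums (\<Sum>l<n. q l z * u l z)"
      unfolding u_def
      by (auto intro!: sums_sum sums_mult summable_sums vs z)
    then have gs: "(\<lambda>i. g i z) sums ((\<Sum>l<n. q l z * u l z) + f z)"
      using sums_Suc[of "\<lambda>i. g i z"] by (simp add: g0)
    have "(\<lambda>i. \<nu> k * v k i z + g i z) sums (\<nu> k * u k z + ((\<Sum>l<n. q l z * u l z) + f z))"
      unfolding u_def by (intro sums_add sums_mult summable_sums vs k z gs[unfolded u_def])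
    then have lim: "(\<lambda>N. \<Sum>i<N. \<nu> k * v k i z + g i z) \<longlonglongrightarrow> \<nu> k * u k z + ((\<Sum>l<n. q l z * u l z) + f z)"
      by (simp add: sums_def)
    have "\<exists>u'. \<forall>x\<in>\<Omega>. (u k has_field_derivative u' x) (at x) \<and>
        (\<lambda>N. \<Sum>i<N. \<nu> k * v k i x + g i x) \<longlonglongrightarrow> u' x"
    proof (rule has_complex_derivative_uniform_sequence[OF op])
      show "((\<lambda>z. \<Sum>i<N. v k i z) has_field_derivative (\<Sum>i<N. \<nu> k * v k i x + g i x)) (at x)"
        if "x \<in> \<Omega>" for N x
        by (intro DERIV_sum vd k that)
      show "\<exists>d>0. cball x d \<subseteq> \<Omega> \<and> uniform_limit (cball x d) (\<lambda>N z. \<Sum>i<N. v k i z) (u k) sequentially"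
        if "x \<in> \<Omega>" for x
        using op that unif[OF k] uniform_limit_on_subset open_contains_cball by metis
    qed
    then obtain u' where "(u k has_field_derivative u' z) (at z)"
        "(\<lambda>N. \<Sum>i<N. \<nu> k * v k i z + g i z) \<longlonglongrightarrow> u' z"
      using z by blast
    then show "(u k has_field_derivative \<nu> k * u k z + (f z + (\<Sum>l<n. q l z * u l z))) (at z)"
      using LIMSEQ_unique[OF lim] by (simp add: add.commute)
    have "norm (u k z) \<le> (\<Sum>i. (A * r * exp (- c * Re z) * norm z / norm z ^ (2 * p)) * (1 / 2) ^ i)"
      unfolding u_def by (rule norm_suminf_le[OF vb half]) (rule k z)+
    also have "\<dots> = A * r * exp (- c * Re z) * norm z / norm z ^ (2 * p) * 2"
      by (subst suminf_mult) (auto simp: suminf_geometric summable_geometric)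
    finally show "norm (u k z) \<le> 2 * A * r * exp (- c * Re z) * norm z / norm z ^ (2 * p)"
      by (simp add: mult_ac)
  qed
  then show ?thesis unfolding \<Omega>_def r_def by blast
qed

section \<open>The dominated equation near infinity\<close>

text \<open>The characteristic exponents at infinity, that is the roots of \<nu>^n = (-n)^n, with
  the recessive one -n at k = 0.\<close>

definition bessel_root :: "nat \<Rightarrow> nat \<Rightarrow> complex" where
  "bessel_root n k = - of_nat n * exp (2 * of_real pi * \<i> * of_nat k / of_nat n)"

lemma bessel_root_power_sum:
  assumes "n \<ge> 1"
  shows "(\<Sum>k<n. bessel_root n k ^ m) = (if n dvd m then of_nat n * (- of_nat n) ^ m else 0)"
proof -
  define w where "w = exp (2 * of_real pi * \<i> * of_nat m / of_nat n)"
  have "bessel_root n k ^ m = (- of_nat n) ^ m * w ^ k" for k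
    unfolding bessel_root_def w_def power_mult_distrib exp_of_nat_mult[symmetric] by (simp add: mult_ac)
  then have "(\<Sum>k<n. bessel_root n k ^ m) = (- of_nat n) ^ m * (\<Sum>k<n. w ^ k)"
    by (simp add: sum_distrib_left)
  moreover have "w = 1 \<longleftrightarrow> n dvd m"
    unfolding w_def using assms by (rule complex_root_unity_eq_1)
  moreover have "w ^ n = 1"
    unfolding w_def using assms by (intro complex_root_unity) simp
  ultimately show ?thesis by (auto simp: geometric_sum)
qed

lemma bessel_root_power: "n \<ge> 1 \<Longrightarrow> bessel_root n k ^ n = (- of_nat n) ^ n"
  unfolding bessel_root_def power_mult_distrib by (simp add: complex_root_unity)

lemma norm_bessel_root: "norm (bessel_root n k) = real n"
proof -
  have "2 * of_real pi * \<i> * of_nat k / of_nat n = \<i> * of_real (2 * pi * real k / real n)"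
    by simp
  then show ?thesis unfolding bessel_root_def norm_mult by (simp only: norm_exp_i_times) simp
qed

lemma Re_bessel_root: "Re (bessel_root n k) \<ge> - real n"
  using abs_Re_le_cmod[of "bessel_root n k"] by (simp add: norm_bessel_root)

text \<open>The equation for the parameter \<open>\<i>\<close>, divided by z^n: the sign times
  (in)^n becomes \<i>^n (\<i>n)^n = (-n)^n, and apart from this constant all coefficients below
  order n decay at infinity.\<close>

definition bessel_diff_op :: "nat \<Rightarrow> (nat \<Rightarrow> complex) \<Rightarrow> (complex \<Rightarrow> complex) \<Rightarrow> complex \<Rightarrow> complex" where
  "bessel_diff_op n V W z =
     (\<Sum>j\<le>n. V j * (deriv ^^ j) W z / z ^ (n - j)) - (- of_nat n) ^ n * W z"

text \<open>For the components \<open>u\<^sub>l\<close> of a function along the exponentials \<open>exp (bessel_root n l * z)\<close>,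
  this expresses the lower-order terms of the equation.\<close>

definition bessel_coupling :: "nat \<Rightarrow> (nat \<Rightarrow> complex) \<Rightarrow> nat \<Rightarrow> complex \<Rightarrow> complex" where
  "bessel_coupling n V l z =
     - (\<Sum>j<n. V j / z ^ (n - j) * (bessel_root n l ^ Suc j / (of_nat n * (- of_nat n) ^ n)))"

lemma holomorphic_bessel_coupling: "bessel_coupling n V l holomorphic_on half_plane_ext"
  unfolding bessel_coupling_def by (intro holomorphic_intros) (auto simp: half_plane_ext_def)

lemma norm_bessel_coupling:
  assumes "n \<ge> 1" "norm z \<ge> 1"
  shows "norm (bessel_coupling n V l z) \<le> (\<Sum>j<n. norm (V j)) / norm z"
proof -
  have "norm (bessel_coupling n V l z) \<le> (\<Sum>j<n. norm (V j) / norm z)"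
    unfolding bessel_coupling_def norm_minus_cancel
  proof (rule sum_norm_le)
    fix j
    assume "j \<in> {..<n}"
    then have j: "j < n" by simp
    \<comment> \<open>The denominator n (-n)^n has modulus n^(n+1), which dominates |\<nu>|^(j+1) =
      n^(j+1).\<close>
    have "real n ^ Suc j \<le> real n ^ Suc n" using assms j by (intro power_increasing) auto
    then have a: "norm (bessel_root n l ^ Suc j / (of_nat n * (- of_nat n) ^ n)) \<le> 1"
      using assms by (simp add: norm_divide norm_mult norm_power norm_bessel_root divide_le_eq)
    have "norm z ^ 1 \<le> norm z ^ (n - j)" using assms j by (intro power_increasing) auto
    then have "norm (V j / z ^ (n - j)) \<le> norm (V j) / norm z"
      using assms by (auto simp: norm_divide norm_power intro!: divide_left_mono mult_pos_pos)
    from mult_mono[OF this a]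
    show "norm (V j / z ^ (n - j) * (bessel_root n l ^ Suc j / (of_nat n * (- of_nat n) ^ n))) \<le> norm (V j) / norm z"
      by (simp only: norm_mult) simp
  qed
  then show ?thesis by (simp add: sum_divide_distrib)
qed

lemma sum_bessel_coupling:
  "(\<Sum>l<n. bessel_coupling n V l z * u l)
     = - (\<Sum>j<n. V j / z ^ (n - j) * (\<Sum>l<n. bessel_root n l ^ Suc j / (of_nat n * (- of_nat n) ^ n) * u l))"
  unfolding bessel_coupling_def sum_distrib_left mult_minus_left sum_negf sum_distrib_right
  by (subst sum.swap) (simp add: mult.assoc)

lemma bessel_diff_op_split:
  assumes "V n = 1"
  shows "bessel_diff_op n V W z =
    (deriv ^^ n) W z - (- of_nat n) ^ n * W z + (\<Sum>j<n. V j / z ^ (n - j) * (deriv ^^ j) W z)"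
  using assms by (simp add: bessel_diff_op_def lessThan_Suc_atMost[symmetric])

text \<open>Partial fractions: 1/(x^n - (-n)^n) is the sum of \<nu>_k/N times 1/(x - \<nu>_k) with N
  = n (-n)^n, because 1/(n \<nu>_k^(n-1)) = \<nu>_k/(n \<nu>_k^n). So solutions of the n first-order
  equations with a common source F, combined with these weights, give W^(n) - (-n)^n W = F. The
  coupling terms inside F account for the lower-order coefficients.\<close>

lemma bessel_diff_op_solvable:
  assumes n: "n \<ge> 1" and V: "V n = 1"
    and p: "p \<ge> 1" "real n * (\<Sum>j<n. norm (V j)) * (pi / (2 * sqrt (real p))) \<le> 1 / 2"
    and f: "f holomorphic_on half_plane_ext"
    and fb: "\<And>z. z \<in> half_plane_ext \<Longrightarrow> norm (f z) \<le> A * exp (- real n * Re z) / norm z ^ (2 * p)"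
  shows "\<exists>W B. W holomorphic_on half_plane_ext \<and> (\<forall>z\<in>half_plane_ext. bessel_diff_op n V W z = f z \<and>
    norm (W z) \<le> B * exp (- real n * Re z) * norm z / norm z ^ (2 * p))"
proof -
  define \<Omega> where "\<Omega> = half_plane_ext"
  have op: "open \<Omega>" by (simp add: \<Omega>_def open_half_plane_ext)
  define r where "r = pi / (2 * sqrt (real p))"
  define \<nu> where "\<nu> = bessel_root n"
  define N :: complex where "N = of_nat n * (- of_nat n) ^ n"
  have N: "N \<noteq> 0" using n by (simp add: N_def)
  define q where "q = bessel_coupling n V"
  have "\<exists>u. \<forall>k<n. \<forall>z\<in>half_plane_ext.
    (u k has_field_derivative \<nu> k * u k z + (f z + (\<Sum>l<n. q l z * u l z))) (at z) \<and>
    norm (u k z) \<le> 2 * A * (pi / (2 * sqrt (real p))) * exp (- real n * Re z) * norm z / norm z ^ (2 * p)"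
  proof (rule half_plane_ext_system[OF _ _ f fb p])
    show "norm (q k z) \<le> (\<Sum>j<n. norm (V j)) / norm z" if "z \<in> half_plane_ext" for k z
      unfolding q_def using that by (intro norm_bessel_coupling n) (auto simp: half_plane_ext_def)
  qed (auto simp: q_def \<nu>_def holomorphic_bessel_coupling Re_bessel_root)
  then obtain u where u: "\<And>k z. k < n \<Longrightarrow> z \<in> \<Omega> \<Longrightarrow>
      (u k has_field_derivative \<nu> k * u k z + (f z + (\<Sum>l<n. q l z * u l z))) (at z)"
    and ub: "\<And>k z. k < n \<Longrightarrow> z \<in> \<Omega> \<Longrightarrow>
      norm (u k z) \<le> 2 * A * r * exp (- real n * Re z) * norm z / norm z ^ (2 * p)"
    unfolding \<Omega>_def r_def by blast
  define F where "F = (\<lambda>z. f z + (\<Sum>l<n. q l z * u l z))"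
  define W where "W = (\<lambda>z. \<Sum>k<n. \<nu> k ^ Suc 0 / N * u k z)"
  have psum: "(\<Sum>k<n. \<nu> k ^ m) = (if n dvd m then of_nat n * (- of_nat n) ^ m else 0)" for m
    unfolding \<nu>_def by (rule bessel_root_power_sum[OF n])
  have der: "((\<lambda>z. \<Sum>k<n. \<nu> k ^ Suc j / N * u k z) has_field_derivative
      (\<Sum>k<n. \<nu> k ^ Suc (Suc j) / N * u k z) + (\<Sum>k<n. \<nu> k ^ Suc j) / N * F z) (at z)"
    if z: "z \<in> \<Omega>" for j z
  proof -
    have "((\<lambda>z. \<Sum>k<n. \<nu> k ^ Suc j / N * u k z) has_field_derivative
        (\<Sum>k<n. \<nu> k ^ Suc j / N * (\<nu> k * u k z + F z))) (at z)"
      unfolding F_def by (intro DERIV_sum DERIV_cmult u z) simp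
    moreover have "(\<Sum>k<n. \<nu> k ^ Suc j / N * (\<nu> k * u k z + F z)) =
        (\<Sum>k<n. \<nu> k ^ Suc (Suc j) / N * u k z) + (\<Sum>k<n. \<nu> k ^ Suc j) / N * F z"
      unfolding sum_divide_distrib sum_distrib_right sum.distrib[symmetric]
      by (intro sum.cong refl) (simp add: algebra_simps add_divide_distrib)
    ultimately show ?thesis by simp
  qed
  have eq: "(deriv ^^ j) W z = (\<Sum>k<n. \<nu> k ^ Suc j / N * u k z)" if "j < n" "z \<in> \<Omega>" for j z
    using that
  proof (induction j arbitrary: z)
    case 0
    then show ?case by (simp add: W_def)
  next
    case (Suc j)
    have "\<forall>\<^sub>F w in nhds z. (deriv ^^ j) W w = (\<Sum>k<n. \<nu> k ^ Suc j / N * u k w)"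
      using eventually_nhds_in_open[OF op Suc.prems(2)] Suc by (auto elim: eventually_mono)
    then have "(deriv ^^ Suc j) W z = deriv (\<lambda>w. \<Sum>k<n. \<nu> k ^ Suc j / N * u k w) z"
      unfolding funpow.simps o_def by (intro deriv_cong_ev) auto
    also have "\<dots> = (\<Sum>k<n. \<nu> k ^ Suc (Suc j) / N * u k z) + (\<Sum>k<n. \<nu> k ^ Suc j) / N * F z"
      by (intro DERIV_imp_deriv der Suc.prems)
    \<comment> \<open>Below order n the power sums of the roots vanish, so the source does not enter
      the derivatives of W; at order n the power sum is N, and F appears exactly once.\<close>
    also have "(\<Sum>k<n. \<nu> k ^ Suc j) = 0"
      unfolding psum using Suc.prems(1) by (auto dest: dvd_imp_le)
    finally show ?case by simp
  qed
  have eqn: "(deriv ^^ n) W z = (- of_nat n) ^ n * W z + F z" if z: "z \<in> \<Omega>" for z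
  proof -
    obtain j where j: "n = Suc j" using n by (cases n) auto
    have "\<forall>\<^sub>F w in nhds z. (deriv ^^ j) W w = (\<Sum>k<n. \<nu> k ^ Suc j / N * u k w)"
      using eventually_nhds_in_open[OF op z] eq[of j] j by (auto elim: eventually_mono)
    then have "(deriv ^^ Suc j) W z = deriv (\<lambda>w. \<Sum>k<n. \<nu> k ^ Suc j / N * u k w) z"
      unfolding funpow.simps o_def by (intro deriv_cong_ev) auto
    also have "\<dots> = (\<Sum>k<n. \<nu> k ^ Suc (Suc j) / N * u k z) + (\<Sum>k<n. \<nu> k ^ Suc j) / N * F z"
      by (intro DERIV_imp_deriv der z)
    also have "(\<Sum>k<n. \<nu> k ^ Suc j) = N"
      unfolding psum j[symmetric] N_def by simp
    finally have D: "(deriv ^^ n) W z = (\<Sum>k<n. \<nu> k ^ Suc (Suc j) / N * u k z) + F z"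
      using N by (simp add: j)
    have pw: "\<nu> k ^ Suc (Suc j) = (- of_nat n) ^ n * \<nu> k ^ Suc 0" for k
      using bessel_root_power[OF n, of k] by (simp add: \<nu>_def j mult_ac)
    have "(- of_nat n) ^ n * W z = (\<Sum>k<n. (- of_nat n) ^ n * \<nu> k ^ Suc 0 / N * u k z)"
      unfolding W_def sum_distrib_left by (simp add: mult.assoc)
    then show ?thesis
      unfolding D pw by simp
  qed
  have "bessel_diff_op n V W z = f z" if z: "z \<in> \<Omega>" for z
  proof -
    have "(\<Sum>j<n. V j / z ^ (n - j) * (deriv ^^ j) W z) = - (\<Sum>l<n. q l z * u l z)"
      unfolding q_def sum_bessel_coupling using eq z by (simp add: \<nu>_def N_def)
    then show ?thesis unfolding bessel_diff_op_split[of V n, OF V] eqn[OF z] F_def by simp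
  qed
  moreover have "W holomorphic_on \<Omega>"
    unfolding W_def using u op holomorphic_on_open by (intro holomorphic_intros) blast+
  moreover have "norm (W z) \<le> (\<Sum>k<n. norm (\<nu> k ^ Suc 0 / N)) * (2 * A * r) * exp (- real n * Re z) * norm z / norm z ^ (2 * p)"
    if z: "z \<in> \<Omega>" for z
  proof -
    have "norm (W z) \<le> (\<Sum>k<n. norm (\<nu> k ^ Suc 0 / N) * (2 * A * r * exp (- real n * Re z) * norm z / norm z ^ (2 * p)))"
      unfolding W_def by (intro sum_norm_le) (simp only: norm_mult, intro mult_left_mono ub z, auto)
    then show ?thesis
      unfolding sum_distrib_right[symmetric] by (simp only: mult.assoc times_divide_eq_right)
  qed
  ultimately show ?thesis unfolding \<Omega>_def by blast
qed

text \<open>This runs the decomposition backwards. Since (x^n - \<nu>^n)/(x - \<nu>) is the sum of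
  \<nu>^(n-1-j) x^j, the matching combinations u_k of derivatives of d satisfy first-order equations
  whose common source is the coupling. The ray estimate halves every bound of the given weight, and
  iterating it forces zero.\<close>

lemma bessel_diff_op_unique:
  assumes n: "n \<ge> 1" and V: "V n = 1"
    and p: "p \<ge> 1" "real n * (\<Sum>j<n. norm (V j)) * (pi / (2 * sqrt (real p))) \<le> 1 / 2"
    and d: "d holomorphic_on half_plane_ext" "\<And>z. z \<in> half_plane_ext \<Longrightarrow> bessel_diff_op n V d z = 0"
    and X: "X > 1" "\<And>x j. x \<ge> X \<Longrightarrow> j < n \<Longrightarrow>
      norm ((deriv ^^ j) d (of_real x)) \<le> B * exp (- real n * x) * x / x ^ (2 * p)"
    and x: "x \<ge> X"
  shows "d (of_real x) = 0"
proof -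
  define \<Omega> where "\<Omega> = half_plane_ext"
  have op: "open \<Omega>" by (simp add: \<Omega>_def open_half_plane_ext)
  define r where "r = pi / (2 * sqrt (real p))"
  define \<nu> where "\<nu> = bessel_root n"
  define N :: complex where "N = of_nat n * (- of_nat n) ^ n"
  have N: "N \<noteq> 0" using n by (simp add: N_def)
  define q where "q = bessel_coupling n V"
  define C where "C = (\<Sum>j<n. norm (V j))"
  have C: "C \<ge> 0" unfolding C_def by (intro sum_nonneg) auto
  have psum: "(\<Sum>k<n. \<nu> k ^ m) = (if n dvd m then of_nat n * (- of_nat n) ^ m else 0)" for m
    unfolding \<nu>_def by (rule bessel_root_power_sum[OF n])
  have \<nu>n: "\<nu> k ^ n = (- of_nat n) ^ n" for k
    unfolding \<nu>_def by (rule bessel_root_power[OF n])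
  define u where "u = (\<lambda>k z. \<Sum>j<n. \<nu> k ^ (n - Suc j) * (deriv ^^ j) d z)"
  have inv: "(deriv ^^ j) d z = (\<Sum>k<n. \<nu> k ^ Suc j / N * u k z)" if j: "j < n" for j z
  proof -
    have "(\<Sum>k<n. \<nu> k ^ Suc j / N * u k z) = (\<Sum>i<n. (\<Sum>k<n. \<nu> k ^ (Suc j + (n - Suc i))) / N * (deriv ^^ i) d z)"
      unfolding u_def sum_distrib_left sum_divide_distrib sum_distrib_right
      by (subst sum.swap) (simp only: power_add times_divide_eq_left times_divide_eq_right mult_ac)
    also have "\<dots> = (\<Sum>i<n. if i = j then (deriv ^^ i) d z else 0)"
    proof (intro sum.cong refl)
      fix i
      assume "i \<in> {..<n}"
      then have i: "i < n" by simp
      \<comment> \<open>The exponent is n + j - i, strictly between 0 and 2n.\<close>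
      have "n dvd Suc j + (n - Suc i) \<longleftrightarrow> i = j"
      proof
        assume "n dvd Suc j + (n - Suc i)"
        then obtain t where t: "Suc j + (n - Suc i) = n * t" by (auto simp: dvd_def)
        then have "0 < n * t" "n * t < n * 2" using i j by linarith+
        then have "0 < t" "t < 2" by auto
        then have "t = 1" by simp
        then show "i = j" using t i j by simp
      qed (use i in simp)
      then show "(\<Sum>k<n. \<nu> k ^ (Suc j + (n - Suc i))) / N * (deriv ^^ i) d z = (if i = j then (deriv ^^ i) d z else 0)"
        unfolding psum using N i by (auto simp: N_def)
    qed
    also have "\<dots> = (deriv ^^ j) d z" using j by simp
    finally show ?thesis by simp
  qed
  define F where "F = (\<lambda>z. \<Sum>l<n. q l z * u l z)"
  have Dn: "(deriv ^^ n) d z - (- of_nat n) ^ n * d z = F z" if "z \<in> \<Omega>" for z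
  proof -
    have "F z = - (\<Sum>j<n. V j / z ^ (n - j) * (deriv ^^ j) d z)"
      unfolding F_def q_def sum_bessel_coupling using inv by (simp add: \<nu>_def N_def)
    moreover have "(deriv ^^ n) d z - (- of_nat n) ^ n * d z
        = - (\<Sum>j<n. V j / z ^ (n - j) * (deriv ^^ j) d z)"
      using d(2)[of z] that unfolding bessel_diff_op_split[of V n, OF V] \<Omega>_def eq_neg_iff_add_eq_0 by blast
    ultimately show ?thesis by (simp only:)
  qed
  have du: "(u k has_field_derivative \<nu> k * u k z + F z) (at z)" if z: "z \<in> \<Omega>" for k z
  proof -
    have D: "(u k has_field_derivative (\<Sum>j<n. \<nu> k ^ (n - Suc j) * (deriv ^^ Suc j) d z)) (at z)"
      unfolding u_def
      using d(1) op z by (intro DERIV_sum DERIV_cmult has_field_derivative_higher_deriv[of d \<Omega>]) (auto simp: \<Omega>_def)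
    have "(\<Sum>i<n. \<nu> k ^ (n - i) * (deriv ^^ i) d z) = \<nu> k * u k z"
      unfolding u_def sum_distrib_left
    proof (intro sum.cong refl)
      fix i
      assume "i \<in> {..<n}"
      then have "n - i = Suc (n - Suc i)" by auto
      then show "\<nu> k ^ (n - i) * (deriv ^^ i) d z = \<nu> k * (\<nu> k ^ (n - Suc i) * (deriv ^^ i) d z)"
        by simp
    qed
    \<comment> \<open>Adding the term of order n to \<nu> u and splitting off the term of order 0
      leaves the derivative of u.\<close>
    then have "\<nu> k * u k z + (deriv ^^ n) d z = (\<Sum>i<Suc n. \<nu> k ^ (n - i) * (deriv ^^ i) d z)"
      by simp
    also have "\<dots> = \<nu> k ^ n * d z + (\<Sum>j<n. \<nu> k ^ (n - Suc j) * (deriv ^^ Suc j) d z)"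
      by (subst sum.lessThan_Suc_shift) simp
    finally have "(\<Sum>j<n. \<nu> k ^ (n - Suc j) * (deriv ^^ Suc j) d z) = \<nu> k * u k z + F z"
      unfolding Dn[OF z, symmetric] \<nu>n by (simp add: algebra_simps)
    with D show ?thesis by simp
  qed
  have real_in: "of_real x \<in> \<Omega>" if "x \<ge> X" for x
    using that X(1) by (auto simp: \<Omega>_def half_plane_ext_def)
  define bd where "bd = (\<lambda>B. \<forall>k<n. \<forall>x\<ge>X. norm (u k (of_real x)) \<le> B * exp (- real n * x) * x / x ^ (2 * p))"
  have step: "bd (B / 2)" if bdB: "bd B" for B
    unfolding bd_def
  proof safe
    fix k x
    assume k: "k < n" and x: "x \<ge> X"
    have x1: "x > 1" using x X(1) by simp
    have "0 \<le> B * exp (- real n * x) * x / x ^ (2 * p)"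
      using bdB k x norm_ge_zero order_trans unfolding bd_def by blast
    then have B: "B \<ge> 0"
      by (rule contrapos_pp) (use x1 in \<open>simp add: not_le divide_neg_pos mult_neg_pos\<close>)
    let ?A = "real n * C * B * exp (- real n * x)"
    have "norm (u k (of_real (x + 0))) \<le> ?A * r * x / x ^ (2 * p)"
      unfolding r_def
    proof (rule decaying_solution_bound[where u = "\<lambda>s. u k (of_real (x + s))" and f = "\<lambda>s. F (of_real (x + s))"
          and \<nu> = "\<nu> k" and c = "real n"])
      fix s :: real
      assume s: "s \<ge> 0"
      have xs: "x + s \<ge> X" "x + s > 1" using s x x1 by auto
      have "((\<lambda>s. of_real (x + s)) has_vector_derivative of_real 1) (at s)"
        by (intro has_vector_derivative_of_real) (auto intro!: derivative_eq_intros)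
      from field_vector_diff_chain_at[OF this du[OF real_in[OF xs(1)]]]
      show "((\<lambda>s. u k (of_real (x + s))) has_vector_derivative \<nu> k * u k (of_real (x + s)) + F (of_real (x + s))) (at s)"
        by (simp add: o_def)
      have "norm (F (of_real (x + s))) \<le> (\<Sum>l<n. C / (x + s) * (B * exp (- real n * (x + s)) * (x + s) / (x + s) ^ (2 * p)))"
        unfolding F_def
      proof (rule sum_norm_le)
        fix l
        assume "l \<in> {..<n}"
        then have l: "l < n" by simp
        have nr: "norm (complex_of_real (x + s)) = x + s" using xs by (simp only: norm_of_real)
        have "norm (q l (of_real (x + s))) \<le> C / (x + s)"
          using norm_bessel_coupling[OF n, of "of_real (x + s)" V l] xs unfolding nr by (simp add: q_def C_def)
        moreover have "norm (u l (of_real (x + s))) \<le> B * exp (- real n * (x + s)) * (x + s) / (x + s) ^ (2 * p)"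
          using bdB l xs unfolding bd_def by blast
        ultimately show "norm (q l (of_real (x + s)) * u l (of_real (x + s)))
            \<le> C / (x + s) * (B * exp (- real n * (x + s)) * (x + s) / (x + s) ^ (2 * p))"
          unfolding norm_mult using C xs by (intro mult_mono) auto
      qed
      also have "\<dots> = real n * C * B * exp (- real n * (x + s)) / (x + s) ^ (2 * p)"
        using xs by simp
      also have "exp (- real n * (x + s)) = exp (- real n * x) * exp (- real n * s)"
        by (simp add: exp_add[symmetric] algebra_simps)
      also have "real n * C * B * (exp (- real n * x) * exp (- real n * s)) / (x + s) ^ (2 * p)
          \<le> ?A * exp (- real n * s) / (x\<^sup>2 + s\<^sup>2) ^ p"
      proof -
        have "x\<^sup>2 + s\<^sup>2 \<le> (x + s)\<^sup>2" using x1 s by (simp add: power2_sum)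
        then have "(x\<^sup>2 + s\<^sup>2) ^ p \<le> (x + s) ^ (2 * p)"
          unfolding power_mult by (intro power_mono) auto
        moreover have "(x\<^sup>2 + s\<^sup>2) ^ p > 0"
          using x1 by (intro zero_less_power add_pos_nonneg) auto
        ultimately have "?A * exp (- real n * s) / (x + s) ^ (2 * p) \<le> ?A * exp (- real n * s) / (x\<^sup>2 + s\<^sup>2) ^ p"
          using B C xs by (intro divide_left_mono mult_pos_pos mult_nonneg_nonneg) auto
        then show ?thesis by (simp add: mult_ac)
      qed
      finally show "norm (F (of_real (x + s))) \<le> ?A * exp (- real n * s) / (x\<^sup>2 + s\<^sup>2) ^ p" .
    next
      \<comment> \<open>The vanishing limit comes from the assumed decay: exp(-\<nu> s) costs at
        most exp(ns), which the weight returns, and a factor 1/(x+s) remains because p \<ge>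
        1.\<close>
      have "norm (exp (- \<nu> k * of_real s) * u k (of_real (x + s))) \<le> B / (x + s)" if s: "s \<ge> 0" for s
      proof -
        have xs: "x + s \<ge> X" "x + s > 1" using s x x1 by auto
        have e: "exp (- Re (\<nu> k) * s) \<le> exp (real n * s)"
          using mult_right_mono[of "- Re (\<nu> k)" "real n" s] Re_bessel_root[of n k] s by (simp add: \<nu>_def)
        have w: "(x + s) / (x + s) ^ (2 * p) \<le> 1 / (x + s)"
        proof -
          have "(x + s) ^ 2 \<le> (x + s) ^ (2 * p)" using xs p(1) by (intro power_increasing) auto
          then show ?thesis using xs by (simp add: field_simps power2_eq_square)
        qed
        have "norm (exp (- \<nu> k * of_real s) * u k (of_real (x + s))) = exp (- Re (\<nu> k) * s) * norm (u k (of_real (x + s)))"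
          by (simp add: norm_mult)
        also have "\<dots> \<le> exp (real n * s) * (B * exp (- real n * (x + s)) * (x + s) / (x + s) ^ (2 * p))"
          using bdB[unfolded bd_def, rule_format, OF k xs(1)] by (intro mult_mono e) auto
        also have "\<dots> = B * (exp (real n * s) * exp (- real n * (x + s))) * ((x + s) / (x + s) ^ (2 * p))"
          by simp
        also have "\<dots> \<le> B * 1 * (1 / (x + s))"
        proof (intro mult_mono w)
          have "exp (real n * s) * exp (- real n * (x + s)) = exp (- (real n * x))"
            by (simp add: exp_add[symmetric] algebra_simps)
          then show "exp (real n * s) * exp (- real n * (x + s)) \<le> 1" using x1 by simp
        qed (use B xs in auto)
        finally show ?thesis by simp
      qed
      then have "\<forall>\<^sub>F s in at_top. norm (exp (- \<nu> k * of_real s) * u k (of_real (x + s))) \<le> B / (x + s)"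
        by (intro eventually_mono[OF eventually_ge_at_top[of 0]])
      moreover have "((\<lambda>s. B / (x + s)) \<longlongrightarrow> 0) at_top"
        by (intro tendsto_divide_0[OF tendsto_const] filterlim_at_top_imp_at_infinity
            filterlim_tendsto_add_at_top[OF tendsto_const] filterlim_ident)
      ultimately show "((\<lambda>s. exp (- \<nu> k * of_real s) * u k (of_real (x + s))) \<longlongrightarrow> 0) at_top"
        by (rule Lim_null_comparison)
    qed (use x1 p B C in \<open>auto simp: \<nu>_def intro: Re_bessel_root\<close>)
    also have "?A * r * x / x ^ (2 * p) = (real n * C * r) * (B * exp (- real n * x) * x / x ^ (2 * p))"
      by simp
    also have "\<dots> \<le> 1 / 2 * (B * exp (- real n * x) * x / x ^ (2 * p))"
      using p(2) B x1 by (intro mult_right_mono) (auto simp: C_def r_def)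
    finally show "norm (u k (of_real x)) \<le> B / 2 * exp (- real n * x) * x / x ^ (2 * p)" by simp
  qed
  \<comment> \<open>There are n summands, each with |\<nu>^(n-1-j)| \<le> n^n.\<close>
  define B0 where "B0 = real n ^ n * real n * \<bar>B\<bar>"
  have "bd B0"
    unfolding bd_def
  proof safe
    fix k x
    assume k: "k < n" and x: "x \<ge> X"
    let ?w = "exp (- real n * x) * x / x ^ (2 * p)"
    have w: "?w \<ge> 0" using x X(1) by simp
    have "norm (u k (of_real x)) \<le> (\<Sum>j<n. real n ^ n * (\<bar>B\<bar> * ?w))"
      unfolding u_def
    proof (rule sum_norm_le)
      fix j
      assume "j \<in> {..<n}"
      then have j: "j < n" by simp
      have "norm (\<nu> k ^ (n - Suc j)) \<le> real n ^ n"
        using n by (simp add: \<nu>_def norm_power norm_bessel_root power_increasing)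
      moreover have "norm ((deriv ^^ j) d (of_real x)) \<le> \<bar>B\<bar> * ?w"
        using X(2)[OF x j] mult_right_mono[OF abs_ge_self w, of B] by (simp add: mult.assoc)
      ultimately show "norm (\<nu> k ^ (n - Suc j) * (deriv ^^ j) d (of_real x)) \<le> real n ^ n * (\<bar>B\<bar> * ?w)"
        unfolding norm_mult by (intro mult_mono) auto
    qed
    then show "norm (u k (of_real x)) \<le> B0 * exp (- real n * x) * x / x ^ (2 * p)"
      by (simp add: B0_def mult_ac)
  qed
  then have bds: "bd (B0 / 2 ^ i)" for i
  proof (induction i)
    case (Suc i)
    then show ?case using step[of "B0 / 2 ^ i"] by (simp add: mult.commute)
  qed simp
  have "u k (of_real x) = 0" if k: "k < n" for k
  proof -
    let ?w = "exp (- real n * x) * x / x ^ (2 * p)"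
    have "(\<lambda>i. B0 * ?w * (1 / 2) ^ i) \<longlonglongrightarrow> B0 * ?w * 0"
      by (intro tendsto_mult tendsto_const LIMSEQ_power_zero) simp
    moreover have "norm (u k (of_real x)) \<le> B0 * ?w * (1 / 2) ^ i" for i
      using bds[of i, unfolded bd_def, rule_format, OF k x] by (simp add: power_divide mult_ac)
    ultimately have "norm (u k (of_real x)) \<le> B0 * ?w * 0"
      by (intro LIMSEQ_le_const) auto
    then show ?thesis by simp
  qed
  then show ?thesis using inv[of 0 "of_real x"] n by simp
qed

section \<open>Continuation of solutions of linear equations with entire coefficients\<close>

lemma higher_deriv_sum:
  fixes f :: "'b \<Rightarrow> complex \<Rightarrow> complex"
  assumes "\<And>k. k \<in> I \<Longrightarrow> f k holomorphic_on S" "open S" "z \<in> S"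
  shows "(deriv ^^ m) (\<lambda>w. \<Sum>k\<in>I. f k w) z = (\<Sum>k\<in>I. (deriv ^^ m) (f k) z)"
  using assms(1)
proof (induction I rule: infinite_finite_induct)
  case (insert k I)
  then show ?case
    using higher_deriv_add[OF _ _ assms(2,3), of "f k" "\<lambda>w. \<Sum>k\<in>I. f k w" m]
    by (auto intro!: holomorphic_intros)
qed auto

text \<open>After cancellation this compares the i consecutive factors ending at m with those ending
  at m+k. It absorbs the Leibniz binomials into a single factorial.\<close>

lemma choose_fact_fact_le:
  assumes "i \<le> m"
  shows "(m choose i) * fact i * fact (m - i + k) \<le> (fact (m + k) :: nat)"
proof -
  have "fact m * fact (m - i + k) \<le> (fact (m + k) * fact (m - i) :: nat)"
  proof (induction k)
    case (Suc k)
    have "fact m * fact (m - i + Suc k) = (m - i + Suc k) * (fact m * fact (m - i + k) :: nat)"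
      by (simp add: algebra_simps)
    also have "\<dots> \<le> (m + Suc k) * (fact (m + k) * fact (m - i))"
      by (rule mult_le_mono[OF _ Suc]) simp
    also have "\<dots> = fact (m + Suc k) * fact (m - i)" by (simp add: algebra_simps)
    finally show ?case .
  qed simp
  also have "(fact m :: nat) = fact i * fact (m - i) * (m choose i)"
    using binomial_fact_lemma[OF assms] by simp
  finally have "fact (m - i) * ((m choose i) * fact i * fact (m - i + k)) \<le> fact (m - i) * (fact (m + k) :: nat)"
    by (simp add: mult_ac)
  then show ?thesis by (rule mult_left_le_imp_le) simp
qed

text \<open>Differentiating the equation m times expresses the derivative of order n+m through lower
  ones, with Leibniz binomials and Cauchy estimates of the coefficients. The induction closes
  because m! exceeds (m-1)! by the factor m, which eventually beats any constant.\<close>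

lemma linear_ode_higher_deriv_bound:
  fixes p :: "nat \<Rightarrow> complex \<Rightarrow> complex" and r :: real
  assumes S: "open S" "c \<in> S" and g: "g holomorphic_on S"
    and p: "\<And>k. k < n \<Longrightarrow> p k holomorphic_on UNIV"
    and ode: "\<And>s. s \<in> S \<Longrightarrow> (deriv ^^ n) g s = (\<Sum>k<n. p k s * (deriv ^^ k) g s)"
    and r: "r \<ge> 1"
  shows "\<exists>A. \<forall>m. norm ((deriv ^^ m) g c) \<le> A * fact m / r ^ m"
proof -
  define d where "d = (\<lambda>m. (deriv ^^ m) g c)"
  \<comment> \<open>Twice the target radius, so that the Leibniz terms are summed by a geometric
    series of ratio 1/2.\<close>
  define R where "R = 2 * r"
  have R: "R > 0" "R \<ge> 1" using r by (auto simp: R_def)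
  have "\<exists>M\<ge>0. \<forall>k<n. \<forall>s\<in>cball c R. norm (p k s) \<le> M"
  proof -
    have "\<exists>M. \<forall>s\<in>cball c R. norm (p k s) \<le> M" if "k < n" for k
    proof -
      have "bounded (p k ` cball c R)"
        by (intro compact_imp_bounded compact_continuous_image holomorphic_on_imp_continuous_on
            holomorphic_on_subset[OF p[OF that]]) auto
      then show ?thesis by (auto simp: bounded_iff)
    qed
    then obtain M where M: "\<And>k s. k < n \<Longrightarrow> s \<in> cball c R \<Longrightarrow> norm (p k s) \<le> M k" by metis
    have "norm (p k s) \<le> (\<Sum>k<n. \<bar>M k\<bar>)" if "k < n" "s \<in> cball c R" for k s
    proof -
      have "norm (p k s) \<le> \<bar>M k\<bar>" using M[OF that] by linarith
      also have "\<dots> \<le> (\<Sum>k<n. \<bar>M k\<bar>)" using that by (intro member_le_sum) auto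
      finally show ?thesis .
    qed
    then show ?thesis by (intro exI[of _ "\<Sum>k<n. \<bar>M k\<bar>"]) (auto intro: sum_nonneg)
  qed
  then obtain M where M: "M \<ge> 0" "\<And>k s. k < n \<Longrightarrow> s \<in> cball c R \<Longrightarrow> norm (p k s) \<le> M" by blast
  have pb: "norm ((deriv ^^ i) (p k) c) \<le> fact i * M / R ^ i" if "k < n" for k i
  proof (rule Cauchy_inequality)
    show "p k holomorphic_on ball c R" "continuous_on (cball c R) (p k)"
      using p[OF that] by (auto intro: holomorphic_on_subset holomorphic_on_imp_continuous_on)
  qed (use R M(2)[OF that] in \<open>auto simp: dist_norm\<close>)
  have pS: "p k holomorphic_on S" if "k < n" for k
    using p[OF that] by (rule holomorphic_on_subset) simp
  have rec: "d (n + m) = (\<Sum>k<n. \<Sum>i = 0..m. of_nat (m choose i) * (deriv ^^ i) (p k) c * d (m - i + k))" for m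
  proof -
    have hol: "(\<lambda>s. p k s * (deriv ^^ k) g s) holomorphic_on S" if "k < n" for k
      using pS[OF that] g S(1) by (intro holomorphic_intros)
    have "d (n + m) = (deriv ^^ m) ((deriv ^^ n) g) c"
      by (simp add: d_def add.commute[of n] funpow_add)
    also have "\<dots> = (deriv ^^ m) (\<lambda>s. \<Sum>k<n. p k s * (deriv ^^ k) g s) c"
      using hol g S
      by (intro higher_deriv_transform_within_open[OF _ _ S] ode holomorphic_higher_deriv holomorphic_on_sum) auto
    also have "\<dots> = (\<Sum>k<n. (deriv ^^ m) (\<lambda>s. p k s * (deriv ^^ k) g s) c)"
      using hol S by (intro higher_deriv_sum[of _ _ S]) auto
    also have "\<dots> = (\<Sum>k<n. \<Sum>i = 0..m. of_nat (m choose i) * (deriv ^^ i) (p k) c * d (m - i + k))"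
    proof (intro sum.cong refl)
      fix k
      assume "k \<in> {..<n}"
      then have k: "k < n" by simp
      have "(deriv ^^ m) (\<lambda>s. p k s * (deriv ^^ k) g s) c
          = (\<Sum>i = 0..m. of_nat (m choose i) * (deriv ^^ i) (p k) c * (deriv ^^ (m - i)) ((deriv ^^ k) g) c)"
        using pS[OF k] g S by (intro higher_deriv_mult[of _ S] holomorphic_higher_deriv)
      then show "(deriv ^^ m) (\<lambda>s. p k s * (deriv ^^ k) g s) c
          = (\<Sum>i = 0..m. of_nat (m choose i) * (deriv ^^ i) (p k) c * d (m - i + k))"
        by (simp only: d_def funpow_add o_apply)
    qed
    finally show ?thesis .
  qed
  \<comment> \<open>For m \<ge> n + m0 the factor m beats the accumulated constant 2 n M r^n; the
    finitely many earlier orders are absorbed into \<open>A\<close>.\<close>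
  obtain m0 :: nat where m0: "2 * real n * M * r ^ n \<le> real m0"
    using real_arch_simple by blast
  define A where "A = (\<Sum>j<n + m0. norm (d j) * r ^ j / fact j)"
  have A: "A \<ge> 0" unfolding A_def using r by (intro sum_nonneg) auto
  have "norm (d m) \<le> A * fact m / r ^ m" for m
  proof (induction m rule: less_induct)
    case (less m)
    show ?case
    proof (cases "m < n + m0")
      case True
      have "norm (d m) * r ^ m / fact m \<le> A"
        unfolding A_def using True r by (intro member_le_sum[of m _ "\<lambda>j. norm (d j) * r ^ j / fact j"]) auto
      then show ?thesis using r by (simp add: field_simps)
    next
      case False
      define l where "l = m - n"
      have l: "m = n + l" "l \<ge> m0" using False by (auto simp: l_def)
      have tb: "norm (of_nat (l choose i) * (deriv ^^ i) (p k) c * d (l - i + k))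
          \<le> (1 / 2) ^ i * (M * A * fact (l + n - 1) / r ^ l)" if "k < n" "i \<le> l" for k i
      proof -
        have "l - i + k < m" using that l by simp
        then have "norm (of_nat (l choose i) * (deriv ^^ i) (p k) c * d (l - i + k))
            \<le> real (l choose i) * (fact i * M / R ^ i) * (A * fact (l - i + k) / r ^ (l - i + k))"
          unfolding norm_mult using pb[OF that(1)] less M R by (intro mult_mono) auto
        also have "\<dots> = (1 / 2) ^ i * (M * A * (real (l choose i) * fact i * fact (l - i + k)) / (r ^ i * r ^ (l - i + k)))"
          by (simp add: R_def power_mult_distrib power_divide mult_ac)
        also have "\<dots> \<le> (1 / 2) ^ i * (M * A * fact (l + n - 1) / r ^ l)"
        proof (intro mult_left_mono frac_le)
          have "real ((l choose i) * fact i * fact (l - i + k)) \<le> real (fact (l + k))"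
            by (intro of_nat_mono choose_fact_fact_le that)
          also have "\<dots> \<le> fact (l + n - 1)" using that by (simp add: fact_mono)
          finally show "real (l choose i) * fact i * fact (l - i + k) \<le> fact (l + n - 1)" by simp
          have "r ^ l \<le> r ^ (i + (l - i + k))" using r that by (intro power_increasing) auto
          then show "r ^ l \<le> r ^ i * r ^ (l - i + k)" by (simp only: power_add)
        qed (use M A r in auto)
        finally show ?thesis .
      qed
      have "norm (d m) \<le> (\<Sum>k<n. \<Sum>i = 0..l. (1 / 2) ^ i * (M * A * fact (l + n - 1) / r ^ l))"
        unfolding l rec by (intro sum_norm_le tb) auto
      also have "\<dots> = real n * ((\<Sum>i = 0..l. (1 / 2) ^ i) * (M * A * fact (l + n - 1) / r ^ l))"
        by (simp only: sum_distrib_right sum_constant card_lessThan)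
      also have "\<dots> \<le> real n * (2 * (M * A * fact (l + n - 1) / r ^ l))"
      proof -
        have "t \<le> 2" if "(1 - 1 / 2) * t = 1 - q" "0 \<le> q" for t q :: real
          using that by simp
        from this[OF sum_gp_basic[of "1 / 2" l]]
        have "(\<Sum>i = 0..l. (1 / 2 :: real) ^ i) \<le> 2"
          unfolding atLeast0AtMost by simp
        then show ?thesis using M A r by (intro mult_left_mono mult_right_mono) auto
      qed
      also have "\<dots> = (2 * real n * M * r ^ n) * (A * fact (l + n - 1) / r ^ m)"
        using r by (simp add: l power_add field_simps)
      also have "\<dots> \<le> real m * (A * fact (l + n - 1) / r ^ m)"
        using m0 l A r by (intro mult_right_mono) auto
      also have "\<dots> = A * fact m / r ^ m"
      proof (cases "m = 0")
        case True
        then show ?thesis using l by (simp add: A_def)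
      next
        case False
        have "l + n - 1 = m - 1" using l by simp
        moreover have "(fact m :: real) = real m * fact (m - 1)" using False by (simp add: fact_reduce)
        ultimately show ?thesis by simp
      qed
      finally show ?thesis .
    qed
  qed
  then show ?thesis unfolding d_def by blast
qed

text \<open>The derivative bounds are available for arbitrarily large r, so the Taylor series at one
  point converges everywhere. The identity theorem on the connected set S carries agreement near
  that point to all of S.\<close>

lemma linear_ode_entire_continuation:
  fixes p :: "nat \<Rightarrow> complex \<Rightarrow> complex"
  assumes S: "open S" "connected S" "S \<noteq> {}" and g: "g holomorphic_on S"
    and p: "\<And>k. k < n \<Longrightarrow> p k holomorphic_on UNIV"
    and ode: "\<And>s. s \<in> S \<Longrightarrow> (deriv ^^ n) g s = (\<Sum>k<n. p k s * (deriv ^^ k) g s)"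
  shows "\<exists>y. y holomorphic_on UNIV \<and> (\<forall>s\<in>S. y s = g s)"
proof -
  obtain c where c: "c \<in> S" using S(3) by blast
  define F where "F = Abs_fps (\<lambda>m. (deriv ^^ m) g c / fact m)"
  have "conv_radius (\<lambda>m. (deriv ^^ m) g c / fact m) = \<infinity>"
  proof (rule conv_radius_inftyI'')
    fix z :: complex
    define r where "r = 2 * (norm z + 1)"
    have r: "r \<ge> 1" by (simp add: r_def)
    obtain A where A: "\<And>m. norm ((deriv ^^ m) g c) \<le> A * fact m / r ^ m"
      using linear_ode_higher_deriv_bound[OF S(1) c g p ode r] by blast
    have "norm ((deriv ^^ m) g c / fact m * z ^ m) \<le> A * (1 / 2) ^ m" for m
    proof -
      have A0: "A \<ge> 0" using order_trans[OF norm_ge_zero A[of 0]] by simp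
      have "norm ((deriv ^^ m) g c / fact m * z ^ m) = norm ((deriv ^^ m) g c) * norm z ^ m / fact m"
        by (simp add: norm_mult norm_divide norm_power)
      also have "\<dots> \<le> (A * fact m / r ^ m) * norm z ^ m / fact m"
        by (intro divide_right_mono mult_right_mono A) auto
      also have "\<dots> = A * (norm z / r) ^ m" by (simp add: power_divide)
      also have "\<dots> \<le> A * (1 / 2) ^ m"
      proof -
        have "norm z / r \<le> 1 / 2" using r by (subst pos_divide_le_eq) (auto simp: r_def add_nonneg_pos)
        then show ?thesis using A0 r by (intro mult_left_mono power_mono) auto
      qed
      finally show ?thesis .
    qed
    then show "summable (\<lambda>m. (deriv ^^ m) g c / fact m * z ^ m)"
      by (rule summable_comparison_test'[of "\<lambda>m. A * (1 / 2) ^ m" 0, rotated])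
         (intro summable_mult summable_geometric, simp)
  qed
  then have rad: "fps_conv_radius F = \<infinity>" by (simp add: F_def fps_conv_radius_def)
  define y where "y = (\<lambda>s. eval_fps F (s - c))"
  have y: "y holomorphic_on UNIV"
    unfolding y_def
    by (intro holomorphic_on_compose_gen[of "\<lambda>s. s - c" UNIV "eval_fps F" UNIV, unfolded o_def]
        holomorphic_on_eval_fps holomorphic_intros) (auto simp: rad)
  obtain e where e: "e > 0" "ball c e \<subseteq> S" using S(1) c open_contains_ball by blast
  have "y s = g s" if "s \<in> ball c e" for s
  proof -
    have "(\<lambda>m. (deriv ^^ m) g c / fact m * (s - c) ^ m) sums g s"
      using holomorphic_power_series[OF holomorphic_on_subset[OF g e(2)] that] .
    then show ?thesis by (simp add: y_def eval_fps_def F_def sums_iff)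
  qed
  then have "y s = g s" if "s \<in> S" for s
    using analytic_continuation_open[of "ball c e" S y g s] e S g y that
    by (auto intro: holomorphic_on_subset)
  then show ?thesis using y by blast
qed

text \<open>In the variable s = log z the operator z^j D^j is t(t-1)...(t-j+1) with t = d/ds, hence
  has constant coefficients. Its leading coefficient 1 keeps the transformed equation monic of order
  n.\<close>

lemma euler_operator_exp:
  assumes W: "W holomorphic_on \<Omega>" "open \<Omega>" and T: "open T" "\<And>s. s \<in> T \<Longrightarrow> exp s \<in> \<Omega>"
  shows "\<exists>c. c j = 1 \<and> (\<forall>s\<in>T. exp s ^ j * (deriv ^^ j) W (exp s) = (\<Sum>k\<le>j. c k * (deriv ^^ k) (W \<circ> exp) s))"
proof (induction j)
  case 0
  then show ?case by (intro exI[of _ "\<lambda>_. 1"]) simp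
next
  case (Suc j)
  then obtain c where c: "c j = 1"
    "\<And>s. s \<in> T \<Longrightarrow> exp s ^ j * (deriv ^^ j) W (exp s) = (\<Sum>k\<le>j. c k * (deriv ^^ k) (W \<circ> exp) s)"
    by blast
  \<comment> \<open>The coefficients of the polynomial obtained so far, multiplied by t - j.\<close>
  define c' where "c' = (\<lambda>k. (if k = 0 then 0 else c (k - 1)) - of_nat j * (if k \<le> j then c k else 0))"
  have g: "(W \<circ> exp) holomorphic_on T"
    using T by (intro holomorphic_on_compose_gen[OF holomorphic_on_exp W(1)]) auto
  have "exp s ^ Suc j * (deriv ^^ Suc j) W (exp s) = (\<Sum>k\<le>Suc j. c' k * (deriv ^^ k) (W \<circ> exp) s)"
    if s: "s \<in> T" for s
  proof -
    let ?g = "\<lambda>k. (deriv ^^ k) (W \<circ> exp) s"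
    let ?h = "exp s ^ j * (deriv ^^ j) W (exp s)"
    have "((deriv ^^ j) W has_field_derivative (deriv ^^ Suc j) W (exp s)) (at (exp s))"
      using W T(2)[OF s] by (intro has_field_derivative_higher_deriv)
    then have "((\<lambda>s. (deriv ^^ j) W (exp s)) has_field_derivative (deriv ^^ Suc j) W (exp s) * exp s) (at s)"
      by (rule DERIV_chain2) (rule DERIV_exp)
    moreover have "((\<lambda>s. exp s ^ j) has_field_derivative of_nat j * exp s ^ j) (at s)"
      by (rule derivative_eq_intros refl)+ (cases j, auto)
    ultimately have "((\<lambda>s. exp s ^ j * (deriv ^^ j) W (exp s)) has_field_derivative
        of_nat j * exp s ^ j * (deriv ^^ j) W (exp s) + (deriv ^^ Suc j) W (exp s) * exp s * exp s ^ j) (at s)"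
      by (intro DERIV_mult)
    moreover have "((\<lambda>s. exp s ^ j * (deriv ^^ j) W (exp s)) has_field_derivative (\<Sum>k\<le>j. c k * ?g (Suc k))) (at s)"
    proof (rule has_field_derivative_transform_within_open[OF _ T(1) s])
      show "((\<lambda>s. \<Sum>k\<le>j. c k * (deriv ^^ k) (W \<circ> exp) s) has_field_derivative (\<Sum>k\<le>j. c k * ?g (Suc k))) (at s)"
        using g T(1) s by (intro DERIV_sum DERIV_cmult has_field_derivative_higher_deriv)
    qed (simp add: c(2))
    ultimately have "of_nat j * exp s ^ j * (deriv ^^ j) W (exp s) + (deriv ^^ Suc j) W (exp s) * exp s * exp s ^ j
        = (\<Sum>k\<le>j. c k * ?g (Suc k))"
      by (rule DERIV_unique)
    then have "exp s ^ Suc j * (deriv ^^ Suc j) W (exp s) = (\<Sum>k\<le>j. c k * ?g (Suc k)) - of_nat j * ?h"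
      by (simp add: algebra_simps)
    also have "?h = (\<Sum>k\<le>j. c k * ?g k)" by (rule c(2)[OF s])
    also have "(\<Sum>k\<le>j. c k * ?g k) = (\<Sum>k\<le>Suc j. (if k \<le> j then c k else 0) * ?g k)"
      by simp
    also have "(\<Sum>k\<le>j. c k * ?g (Suc k)) = (\<Sum>k\<le>Suc j. (if k = 0 then 0 else c (k - 1)) * ?g k)"
      by (subst sum.atMost_Suc_shift) simp
    finally show ?thesis
      by (simp only: c'_def left_diff_distrib sum_subtractf sum_distrib_left mult.assoc)
  qed
  moreover have "c' (Suc j) = 1" by (simp add: c'_def c(1))
  ultimately show ?case by blast
qed

section \<open>The chart of the universal cover\<close>

lemma Rep_upoint: "r > 0 \<Longrightarrow> Rep_ucover (upoint r \<theta>) = (r, \<theta>)"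
  unfolding upoint_def by (rule Abs_ucover_inverse) simp

lemma umod_upoint [simp]: "r > 0 \<Longrightarrow> umod (upoint r \<theta>) = r"
  and uarg_upoint [simp]: "r > 0 \<Longrightarrow> uarg (upoint r \<theta>) = \<theta>"
  by (simp_all add: umod_def uarg_def Rep_upoint)

lemma umod_pos [simp]: "umod z > 0"
  using Rep_ucover[of z] by (simp add: umod_def)

lemma umod_nonneg [simp]: "umod z \<ge> 0"
  by (rule order_less_imp_le) simp

lemma ucover_eq_iff: "z = u \<longleftrightarrow> umod z = umod u \<and> uarg z = uarg u"
  unfolding umod_def uarg_def by (metis Rep_ucover_inject prod_eq_iff)

lemma umod_uexp [simp]: "umod (uexp s) = exp (Re s)"
  and uarg_uexp [simp]: "uarg (uexp s) = Im s"
  by (simp_all add: uexp_def)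

lemma ulog_uexp [simp]: "ulog (uexp s) = s"
  by (simp add: ulog_def)

lemma uexp_ulog [simp]: "uexp (ulog z) = z"
  by (simp add: ucover_eq_iff ulog_def)

lemma ulog_eq_iff: "ulog z = ulog u \<longleftrightarrow> z = u"
  by (metis uexp_ulog)

lemma uproj_eq_exp: "uproj z = exp (ulog z)"
  by (simp add: uproj_def ulog_def rcis_def exp_eq_polar scaleR_conv_of_real)

lemma uproj_uexp [simp]: "uproj (uexp s) = exp s"
  by (simp add: uproj_eq_exp)

lemma uproj_nonzero [simp]: "uproj z \<noteq> 0"
  by (simp add: uproj_eq_exp)

lemma norm_uproj [simp]: "norm (uproj z) = umod z"
  by (simp add: uproj_eq_exp ulog_def)

lemma umult_uexp: "umult (uexp s) (uexp t) = uexp (s + t)"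
  by (simp add: umult_def ucover_eq_iff exp_add)

lemma ulog_umult [simp]: "ulog (umult z u) = ulog z + ulog u"
  by (metis umult_uexp uexp_ulog ulog_uexp)

lemma uproj_umult [simp]: "uproj (umult z u) = uproj z * uproj u"
  by (simp add: uproj_eq_exp exp_add)

lemma uexp_Ln_uproj:
  assumes "\<bar>uarg z\<bar> < pi / 2"
  shows "uexp (Ln (uproj z)) = z"
proof -
  have "Im (ulog z) = uarg z" by (simp add: ulog_def)
  then have "Ln (uproj z) = ulog z"
    unfolding uproj_eq_exp using assms pi_gt_zero by (intro Ln_exp) (auto simp: abs_less_iff)
  then show ?thesis by simp
qed

lemma uproj_half_plane_ext:
  assumes "\<bar>uarg z\<bar> < pi / 2" "umod z > 1"
  shows "uproj z \<in> half_plane_ext"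
  unfolding uproj_eq_exp using assms by (intro exp_in_half_plane_ext) (auto simp: ulog_def)

section \<open>Derivatives on the cover and on the half-plane\<close>

lemma uderiv_uexp: "(uderiv w \<circ> uexp) s = deriv (w \<circ> uexp) s / exp s"
  by (simp add: uderiv_def)

lemma uholomorphic_uderiv:
  assumes "uholomorphic w"
  shows "uholomorphic (uderiv w)"
proof -
  have "(\<lambda>s. deriv (w \<circ> uexp) s / exp s) holomorphic_on UNIV"
    using assms unfolding uholomorphic_def by (intro holomorphic_intros holomorphic_deriv) auto
  moreover have "uderiv w \<circ> uexp = (\<lambda>s. deriv (w \<circ> uexp) s / exp s)"
    by (rule ext) (rule uderiv_uexp)
  ultimately show ?thesis by (simp add: uholomorphic_def)
qed

lemma uholomorphic_uderiv_funpow: "uholomorphic w \<Longrightarrow> uholomorphic ((uderiv ^^ j) w)"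
  by (induction j) (simp_all add: uholomorphic_uderiv)

lemma has_field_derivative_uexp_Ln:
  assumes w: "uholomorphic w" and z: "z \<in> half_plane_ext"
  shows "((\<lambda>z. w (uexp (Ln z))) has_field_derivative uderiv w (uexp (Ln z))) (at z)"
proof -
  note Lz = Ln_half_plane_ext[OF z]
  have "((w \<circ> uexp) has_field_derivative deriv (w \<circ> uexp) (Ln z)) (at (Ln z))"
    using w unfolding uholomorphic_def by (intro holomorphic_derivI[of _ UNIV]) auto
  moreover have "(Ln has_field_derivative inverse z) (at z)"
    using z by (intro has_field_derivative_Ln) (auto simp: half_plane_ext_def complex_nonpos_Reals_iff)
  ultimately have "((\<lambda>z. (w \<circ> uexp) (Ln z)) has_field_derivative deriv (w \<circ> uexp) (Ln z) * inverse z) (at z)"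
    by (rule DERIV_chain2)
  then show ?thesis using Lz(3) by (simp add: uderiv_def divide_inverse)
qed

lemma holomorphic_uexp_Ln:
  "uholomorphic w \<Longrightarrow> (\<lambda>z. w (uexp (Ln z))) holomorphic_on half_plane_ext"
  using has_field_derivative_uexp_Ln open_half_plane_ext holomorphic_on_open by blast

lemma higher_deriv_uexp_Ln:
  assumes "uholomorphic w" "z \<in> half_plane_ext"
  shows "(deriv ^^ j) (\<lambda>z. w (uexp (Ln z))) z = (uderiv ^^ j) w (uexp (Ln z))"
  using assms(2)
proof (induction j arbitrary: z)
  case (Suc j)
  have "\<forall>\<^sub>F x in nhds z. (deriv ^^ j) (\<lambda>z. w (uexp (Ln z))) x = (uderiv ^^ j) w (uexp (Ln x))"
    using eventually_nhds_in_open[OF open_half_plane_ext Suc.prems] by eventually_elim (rule Suc.IH)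
  then have "deriv ((deriv ^^ j) (\<lambda>z. w (uexp (Ln z)))) z = deriv (\<lambda>x. (uderiv ^^ j) w (uexp (Ln x))) z"
    by (rule deriv_cong_ev) simp
  also have "\<dots> = uderiv ((uderiv ^^ j) w) (uexp (Ln z))"
    by (intro DERIV_imp_deriv has_field_derivative_uexp_Ln uholomorphic_uderiv_funpow assms Suc.prems)
  finally show ?case by simp
qed simp

lemma bessel_diff_op_times_power:
  assumes "z \<noteq> 0"
  shows "z ^ n * bessel_diff_op n V W z =
    (\<Sum>j = 1..n. V j * z ^ j * (deriv ^^ j) W z) + (V 0 - (- of_nat n) ^ n * z ^ n) * W z"
proof -
  have "z ^ n * (\<Sum>j\<le>n. V j * (deriv ^^ j) W z / z ^ (n - j)) = (\<Sum>j\<le>n. V j * z ^ j * (deriv ^^ j) W z)"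
    unfolding sum_distrib_left
  proof (intro sum.cong refl)
    fix j
    assume "j \<in> {..n}"
    then have "z ^ n = z ^ j * z ^ (n - j)" by (simp add: power_add[symmetric])
    then show "z ^ n * (V j * (deriv ^^ j) W z / z ^ (n - j)) = V j * z ^ j * (deriv ^^ j) W z"
      using assms by simp
  qed
  moreover have "{..n} = insert 0 {1..n}" by auto
  ultimately have "z ^ n * (\<Sum>j\<le>n. V j * (deriv ^^ j) W z / z ^ (n - j)) =
      V 0 * W z + (\<Sum>j = 1..n. V j * z ^ j * (deriv ^^ j) W z)"
    by simp
  then show ?thesis by (simp add: bessel_diff_op_def algebra_simps)
qed

lemma bessel_solution_half_plane_ext:
  fixes lam :: "complex ^ 'n"
  assumes w: "bessel_solution lam (\<i> ^ CARD('n)) w" and z: "z \<in> half_plane_ext"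
  shows "bessel_diff_op CARD('n) (bessel_V lam) (\<lambda>z. w (uexp (Ln z))) z = 0"
proof -
  have uh: "uholomorphic w" using w by (simp add: bessel_solution_def)
  note nz = Ln_half_plane_ext(3)[OF z]
  have "\<i> ^ CARD('n) * (\<i> * of_nat CARD('n)) ^ CARD('n) = (- of_nat CARD('n)) ^ CARD('n)"
    by (simp only: power_mult_distrib[symmetric] mult.assoc[symmetric]) simp
  then have "z ^ CARD('n) * bessel_diff_op CARD('n) (bessel_V lam) (\<lambda>z. w (uexp (Ln z))) z = 0"
    unfolding bessel_diff_op_times_power[OF nz]
    using w[unfolded bessel_solution_def, THEN conjunct2, rule_format, of "uexp (Ln z)"] nz
    by (simp add: higher_deriv_uexp_Ln[OF uh z])
  then show ?thesis using nz by simp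
qed

text \<open>The chart s = log z moves the regular singularity at 0 to infinity and leaves a monic
  equation with entire coefficients, so the solution on the half-strip continues to an entire
  function. The left-hand side of the equation is then entire and zero on the strip, hence zero
  everywhere.\<close>

lemma bessel_solution_extend:
  fixes lam :: "complex ^ 'n"
  assumes W: "W holomorphic_on half_plane_ext"
    and eq: "\<And>z. z \<in> half_plane_ext \<Longrightarrow> bessel_diff_op CARD('n) (bessel_V lam) W z = 0"
  shows "\<exists>w. bessel_solution lam (\<i> ^ CARD('n)) w \<and> (\<forall>z\<in>half_plane_ext. w (uexp (Ln z)) = W z)"
proof -
  define n where "n = CARD('n)"
  define V where "V = bessel_V lam"
  define \<kappa> :: complex where "\<kappa> = (- of_nat n) ^ n"
  have V: "V n = 1" by (simp add: V_def n_def bessel_V_card)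
  have n: "n \<ge> 1" by (simp add: n_def Suc_le_eq)
  define T where "T = {s. Re s > 0} \<inter> {s. Im s < pi / 2} \<inter> {s. Im s > - pi / 2}"
  have cT: "convex T" and oT: "open T"
    unfolding T_def
    by (intro convex_Int convex_halfspace_Re_gt convex_halfspace_Im_lt convex_halfspace_Im_gt)
       (intro open_Int open_halfspace_Re_gt open_halfspace_Im_lt open_halfspace_Im_gt)
  have "1 \<in> T" by (simp add: T_def)
  then have T: "open T" "connected T" "T \<noteq> {}" using oT cT convex_connected by auto
  have expT: "exp s \<in> half_plane_ext" if "s \<in> T" for s
    using that by (intro exp_in_half_plane_ext) (auto simp: T_def abs_less_iff)
  have LnT: "Ln z \<in> T" if "z \<in> half_plane_ext" for z
    using Ln_half_plane_ext[OF that] by (auto simp: T_def abs_less_iff)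
  have Ln_exp_T: "Ln (exp s) = s" if "s \<in> T" for s
    using that pi_gt_zero by (intro Ln_exp) (auto simp: T_def)
  define g where "g = W \<circ> exp"
  have g: "g holomorphic_on T"
    unfolding g_def using expT by (intro holomorphic_on_compose_gen[OF holomorphic_on_exp W]) auto
  have "\<forall>j. \<exists>c. c j = 1 \<and> (\<forall>s\<in>T. exp s ^ j * (deriv ^^ j) W (exp s) = (\<Sum>k\<le>j. c k * (deriv ^^ k) g s))"
    unfolding g_def by (intro allI euler_operator_exp[OF W open_half_plane_ext oT expT])
  from choice[OF this] obtain c where c: "\<And>j. c j j = 1"
    "\<And>j s. s \<in> T \<Longrightarrow> exp s ^ j * (deriv ^^ j) W (exp s) = (\<Sum>k\<le>j. c j k * (deriv ^^ k) g s)"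
    by blast
  \<comment> \<open>The equation in s is solved for its top derivative: minus the constant
    combinations of the V_j, plus \<kappa> exp(ns) at order 0.\<close>
  define p where "p = (\<lambda>k s. (if k = 0 then \<kappa> * exp s ^ n else 0) - (\<Sum>j\<le>n. V j * (if k \<le> j then c j k else 0)))"
  have ode: "(deriv ^^ n) g s = (\<Sum>k<n. p k s * (deriv ^^ k) g s)" if s: "s \<in> T" for s
  proof -
    have "0 = exp s ^ n * bessel_diff_op n V W (exp s)"
      using eq[OF expT[OF s]] by (simp add: n_def V_def)
    also have "\<dots> = (\<Sum>j\<le>n. V j * exp s ^ j * (deriv ^^ j) W (exp s)) - \<kappa> * exp s ^ n * g s"
    proof -
      have "{..n} = insert 0 {1..n}" by auto
      then show ?thesis
        by (simp add: bessel_diff_op_times_power algebra_simps \<kappa>_def g_def)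
    qed
    also have "(\<Sum>j\<le>n. V j * exp s ^ j * (deriv ^^ j) W (exp s)) = (\<Sum>j\<le>n. V j * (\<Sum>k\<le>n. (if k \<le> j then c j k else 0) * (deriv ^^ k) g s))"
    proof (intro sum.cong refl)
      fix j
      assume "j \<in> {..n}"
      then have "(\<Sum>k\<le>n. (if k \<le> j then c j k else 0) * (deriv ^^ k) g s) = (\<Sum>k\<le>j. c j k * (deriv ^^ k) g s)"
        by (intro sum.mono_neutral_cong_right) auto
      then show "V j * exp s ^ j * (deriv ^^ j) W (exp s) = V j * (\<Sum>k\<le>n. (if k \<le> j then c j k else 0) * (deriv ^^ k) g s)"
        using c(2)[OF s, of j] by (simp add: mult.assoc)
    qed
    also have "\<dots> = (\<Sum>k\<le>n. (\<Sum>j\<le>n. V j * (if k \<le> j then c j k else 0)) * (deriv ^^ k) g s)"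
      unfolding sum_distrib_left sum_distrib_right by (subst sum.swap) (simp only: mult.assoc)
    also have "\<dots> = (\<Sum>k<n. (\<Sum>j\<le>n. V j * (if k \<le> j then c j k else 0)) * (deriv ^^ k) g s) + (deriv ^^ n) g s"
    proof -
      have "(\<Sum>j\<le>n. V j * (if n \<le> j then c j n else 0)) = (\<Sum>j\<in>{n}. V j * (if n \<le> j then c j n else 0))"
        by (rule sum.mono_neutral_right) auto
      then show ?thesis using V c(1) by (simp add: lessThan_Suc_atMost[symmetric])
    qed
    finally have "(deriv ^^ n) g s = \<kappa> * exp s ^ n * g s - (\<Sum>k<n. (\<Sum>j\<le>n. V j * (if k \<le> j then c j k else 0)) * (deriv ^^ k) g s)"
      by (simp add: algebra_simps)
    also have "\<kappa> * exp s ^ n * g s = (\<Sum>k<n. (if k = 0 then \<kappa> * exp s ^ n else 0) * (deriv ^^ k) g s)"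
      using n by (subst sum.remove[of _ 0]) auto
    finally show ?thesis
      unfolding p_def left_diff_distrib sum_subtractf .
  qed
  have "p k holomorphic_on UNIV" for k
    unfolding p_def by (cases "k = 0") (auto intro!: holomorphic_intros)
  from linear_ode_entire_continuation[OF T g this ode]
  obtain y where y: "y holomorphic_on UNIV" "\<And>s. s \<in> T \<Longrightarrow> y s = g s" by blast
  define w where "w = (\<lambda>z. y (ulog z))"
  have wW: "w (uexp (Ln z)) = W z" if "z \<in> half_plane_ext" for z
    using y(2)[OF LnT[OF that]] Ln_half_plane_ext(3)[OF that] by (simp add: w_def g_def)
  have uh: "uholomorphic w"
    using y(1) by (simp add: uholomorphic_def w_def o_def)
  define D where "D = (\<lambda>s. (\<Sum>j = 1..n. V j * exp s ^ j * ((uderiv ^^ j) w \<circ> uexp) s)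
        + (V 0 - \<kappa> * exp s ^ n) * (w \<circ> uexp) s)"
  have "D holomorphic_on UNIV"
    unfolding D_def o_def
    using uholomorphic_uderiv_funpow[OF uh, unfolded uholomorphic_def o_def] uh[unfolded uholomorphic_def o_def]
    by (intro holomorphic_intros) auto
  moreover have "D s = 0" if s: "s \<in> T" for s
  proof -
    note es = expT[OF s]
    have "(deriv ^^ j) W (exp s) = (uderiv ^^ j) w (uexp s)" for j
    proof -
      have "(deriv ^^ j) W (exp s) = (deriv ^^ j) (\<lambda>z. w (uexp (Ln z))) (exp s)"
        by (intro higher_deriv_transform_within_open[OF W holomorphic_uexp_Ln[OF uh] open_half_plane_ext es])
           (simp add: wW)
      then show ?thesis using higher_deriv_uexp_Ln[OF uh es] Ln_exp_T[OF s] by simp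
    qed
    then have "D s = exp s ^ n * bessel_diff_op n V W (exp s)"
      using wW[OF es] Ln_exp_T[OF s] by (simp add: D_def bessel_diff_op_times_power \<kappa>_def)
    then show ?thesis using eq[OF es] by (simp add: n_def V_def)
  qed
  ultimately have D0: "D s = 0" for s
    using analytic_continuation_open[of T UNIV D "\<lambda>_. 0" s] T by auto
  have "\<i> ^ n * (\<i> * of_nat n) ^ n = \<kappa>"
    unfolding \<kappa>_def by (simp only: power_mult_distrib[symmetric] mult.assoc[symmetric]) simp
  then have "bessel_solution lam (\<i> ^ CARD('n)) w"
    unfolding bessel_solution_def n_def[symmetric] using uh D0[of "ulog _"]
    by (simp add: D_def V_def uproj_eq_exp)
  then show ?thesis using wW by blast
qed

section \<open>Truncated formal solutions\<close>

lemma entire_fps_mult: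
  fixes F G :: "complex fps"
  shows "fps_conv_radius F = \<infinity> \<Longrightarrow> fps_conv_radius G = \<infinity> \<Longrightarrow> fps_conv_radius (F * G) = \<infinity>"
  using fps_conv_radius_mult[of F G] by simp

lemma entire_fps_add:
  fixes F G :: "complex fps"
  shows "fps_conv_radius F = \<infinity> \<Longrightarrow> fps_conv_radius G = \<infinity> \<Longrightarrow> fps_conv_radius (F + G) = \<infinity>"
  using fps_conv_radius_add[of F G] by simp

lemma entire_fps_diff:
  fixes F G :: "complex fps"
  shows "fps_conv_radius F = \<infinity> \<Longrightarrow> fps_conv_radius G = \<infinity> \<Longrightarrow> fps_conv_radius (F - G) = \<infinity>"
  using fps_conv_radius_diff[of F G] by simp

lemma entire_fps_deriv:
  fixes F :: "complex fps"
  shows "fps_conv_radius F = \<infinity> \<Longrightarrow> fps_conv_radius (fps_deriv F) = \<infinity>"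
  using fps_conv_radius_deriv[of F] by simp

lemmas entire_fps = entire_fps_mult entire_fps_add entire_fps_diff entire_fps_deriv

lemma entire_fps_formal_deriv:
  "fps_conv_radius F = \<infinity> \<Longrightarrow> fps_conv_radius (formal_deriv a \<rho> F) = \<infinity>"
  unfolding formal_deriv_def by (intro entire_fps) auto

lemma entire_fps_formal_deriv_funpow:
  "fps_conv_radius F = \<infinity> \<Longrightarrow> fps_conv_radius ((formal_deriv a \<rho> ^^ j) F) = \<infinity>"
  by (induction j) (auto simp: entire_fps_formal_deriv)

lemma eval_fps_formal_deriv:
  assumes "fps_conv_radius F = \<infinity>"
  shows "eval_fps (formal_deriv a \<rho> F) x =
    a * eval_fps F x + \<rho> * x * eval_fps F x - x\<^sup>2 * eval_fps (fps_deriv F) x"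
  unfolding formal_deriv_def
  using assms by (simp add: eval_fps_diff eval_fps_add eval_fps_mult entire_fps)

lemma entire_fps_sum:
  fixes F :: "'b \<Rightarrow> complex fps"
  shows "(\<And>i. i \<in> I \<Longrightarrow> fps_conv_radius (F i) = \<infinity>) \<Longrightarrow> fps_conv_radius (\<Sum>i\<in>I. F i) = \<infinity>"
  by (induction I rule: infinite_finite_induct) (auto intro: entire_fps)

lemma eval_fps_sum:
  fixes F :: "'b \<Rightarrow> complex fps"
  shows "(\<And>i. i \<in> I \<Longrightarrow> fps_conv_radius (F i) = \<infinity>) \<Longrightarrow>
    eval_fps (\<Sum>i\<in>I. F i) x = (\<Sum>i\<in>I. eval_fps (F i) x)"
  by (induction I rule: infinite_finite_induct) (auto simp: eval_fps_add entire_fps_sum)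

lemma entire_fps_bessel_op:
  "fps_conv_radius F = \<infinity> \<Longrightarrow> fps_conv_radius (bessel_op n V \<kappa> a \<rho> F) = \<infinity>"
  unfolding bessel_op_def by (intro entire_fps entire_fps_sum entire_fps_formal_deriv_funpow) auto

lemma eval_fps_bessel_op:
  assumes F: "fps_conv_radius F = \<infinity>"
  shows "eval_fps (bessel_op n V \<kappa> a \<rho> F) x =
    (\<Sum>j\<le>n. V j * x ^ (n - j) * eval_fps ((formal_deriv a \<rho> ^^ j) F) x) - \<kappa> * eval_fps F x"
proof -
  have t: "fps_conv_radius (fps_const (V j) * fps_X ^ (n - j)) = \<infinity>" for j
    by (intro entire_fps) auto
  have s: "fps_conv_radius (fps_const (V j) * fps_X ^ (n - j) * (formal_deriv a \<rho> ^^ j) F) = \<infinity>" for j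
    by (intro entire_fps t entire_fps_formal_deriv_funpow F)
  show ?thesis
    unfolding bessel_op_def
    using F by (simp add: eval_fps_diff eval_fps_sum entire_fps_sum s t eval_fps_mult entire_fps
        entire_fps_formal_deriv_funpow)
qed

text \<open>This is applied to series with infinite radius of convergence, such as truncations of
  the formal solution, which are polynomials in 1/z. On them the formal derivative becomes the true
  one.\<close>

definition formal_eval :: "complex \<Rightarrow> complex \<Rightarrow> complex fps \<Rightarrow> complex \<Rightarrow> complex" where
  "formal_eval a \<rho> F z = exp (a * z + \<rho> * Ln z) * eval_fps F (inverse z)"

lemma has_field_derivative_formal_eval:
  assumes F: "fps_conv_radius F = \<infinity>" and z: "z \<in> half_plane_ext"
  shows "(formal_eval a \<rho> F has_field_derivative formal_eval a \<rho> (formal_deriv a \<rho> F) z) (at z)"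
proof -
  have z0: "z \<noteq> 0" "z \<notin> \<real>\<^sub>\<le>\<^sub>0"
    using z by (auto simp: half_plane_ext_def complex_nonpos_Reals_iff)
  have d1: "((\<lambda>z. exp (a * z + \<rho> * Ln z)) has_field_derivative exp (a * z + \<rho> * Ln z) * (a + \<rho> * inverse z)) (at z)"
    using z0 by (auto intro!: derivative_eq_intros simp: divide_inverse)
  have d2: "((\<lambda>z. eval_fps F (inverse z)) has_field_derivative eval_fps (fps_deriv F) (inverse z) * (- (inverse z)\<^sup>2)) (at z)"
  proof (rule DERIV_chain2[where f = "eval_fps F" and g = inverse])
    show "(eval_fps F has_field_derivative eval_fps (fps_deriv F) (inverse z)) (at (inverse z))"
      by (rule has_field_derivative_eval_fps) (simp add: F)
    show "(inverse has_field_derivative - (inverse z)\<^sup>2) (at z)"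
      using DERIV_inverse[OF z0(1)] by (simp add: power2_eq_square)
  qed
  show ?thesis
    using DERIV_mult[OF d1 d2] unfolding formal_eval_def[abs_def] eval_fps_formal_deriv[OF F]
    by (simp add: algebra_simps)
qed

lemma holomorphic_formal_eval:
  "fps_conv_radius F = \<infinity> \<Longrightarrow> formal_eval a \<rho> F holomorphic_on half_plane_ext"
  using has_field_derivative_formal_eval open_half_plane_ext holomorphic_on_open by blast

lemma higher_deriv_formal_eval:
  assumes "fps_conv_radius F = \<infinity>" "z \<in> half_plane_ext"
  shows "(deriv ^^ j) (formal_eval a \<rho> F) z = formal_eval a \<rho> ((formal_deriv a \<rho> ^^ j) F) z"
  using assms(2)
proof (induction j arbitrary: z)
  case (Suc j)
  have "\<forall>\<^sub>F x in nhds z. (deriv ^^ j) (formal_eval a \<rho> F) x = formal_eval a \<rho> ((formal_deriv a \<rho> ^^ j) F) x"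
    using eventually_nhds_in_open[OF open_half_plane_ext Suc.prems] by eventually_elim (rule Suc.IH)
  then have "deriv ((deriv ^^ j) (formal_eval a \<rho> F)) z = deriv (formal_eval a \<rho> ((formal_deriv a \<rho> ^^ j) F)) z"
    by (rule deriv_cong_ev) simp
  also have "\<dots> = formal_eval a \<rho> (formal_deriv a \<rho> ((formal_deriv a \<rho> ^^ j) F)) z"
    by (intro DERIV_imp_deriv has_field_derivative_formal_eval entire_fps_formal_deriv_funpow assms Suc.prems)
  finally show ?case by simp
qed simp

lemma bessel_diff_op_formal_eval:
  assumes F: "fps_conv_radius F = \<infinity>" and z: "z \<in> half_plane_ext"
  shows "bessel_diff_op n V (formal_eval a \<rho> F) z = formal_eval a \<rho> (bessel_op n V ((- of_nat n) ^ n) a \<rho> F) z"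
proof -
  have "bessel_diff_op n V (formal_eval a \<rho> F) z =
    (\<Sum>j\<le>n. V j * (exp (a * z + \<rho> * Ln z) * eval_fps ((formal_deriv a \<rho> ^^ j) F) (inverse z)) / z ^ (n - j))
      - (- of_nat n) ^ n * (exp (a * z + \<rho> * Ln z) * eval_fps F (inverse z))"
    unfolding bessel_diff_op_def higher_deriv_formal_eval[OF F z] formal_eval_def ..
  also have "\<dots> = formal_eval a \<rho> (bessel_op n V ((- of_nat n) ^ n) a \<rho> F) z"
    unfolding formal_eval_def eval_fps_bessel_op[OF F] right_diff_distrib sum_distrib_left
    by (intro arg_cong2[of _ _ _ _ "(-)"] sum.cong refl) (simp_all add: divide_inverse power_inverse mult_ac)
  finally show ?thesis .
qed

text \<open>As the exponent r is real, the argument of z does not contribute to the modulus of z^r.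
  The second bound gives away a power |z|^n, which a larger p recovers.\<close>

lemma dominated_factor_bounds:
  fixes r :: real
  assumes "norm z \<ge> 1" "r \<le> 0" "- real n \<le> r"
  defines "E \<equiv> exp (- of_nat n * z + of_real r * Ln z)"
  shows "norm E \<le> exp (- real n * Re z)" "exp (- real n * Re z) \<le> norm E * norm z ^ n"
proof -
  have z: "z \<noteq> 0" using assms(1) by auto
  have E: "norm E = exp (- real n * Re z) * exp (r * ln (norm z))"
    using z by (simp add: E_def exp_add[symmetric])
  have l: "ln (norm z) \<ge> 0" using assms(1) by simp
  have "exp (r * ln (norm z)) \<le> 1" using l assms(2) by (simp add: mult_nonpos_nonneg)
  then show "norm E \<le> exp (- real n * Re z)" unfolding E by (intro mult_left_le) auto
  have "norm z ^ n = exp (real n * ln (norm z))"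
    using z by (simp add: exp_of_nat_mult)
  then have "exp (r * ln (norm z)) * norm z ^ n = exp ((r + real n) * ln (norm z))"
    by (simp add: exp_add[symmetric] algebra_simps)
  also have "\<dots> \<ge> 1" using l assms(3) by simp
  finally show "exp (- real n * Re z) \<le> norm E * norm z ^ n"
    unfolding E by (simp add: mult.assoc)
qed

lemma contraction_exponent:
  assumes "C \<ge> 0"
  shows "\<exists>q\<ge>1. \<forall>p\<ge>q. real n * C * (pi / (2 * sqrt (real p))) \<le> 1 / 2"
proof -
  obtain q :: nat where q: "(real n * C * pi)\<^sup>2 + 1 \<le> real q" using real_arch_simple by blast
  have q1: "q \<ge> 1" using q zero_le_power2[of "real n * C * pi"] by linarith
  have "real n * C * (pi / (2 * sqrt (real p))) \<le> 1 / 2" if "p \<ge> q" for p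
  proof -
    have "(real n * C * pi)\<^sup>2 \<le> real p" using q that by linarith
    then have "real n * C * pi \<le> sqrt (real p)" by (rule real_le_rsqrt)
    moreover have "sqrt (real p) > 0" using that q1 by simp
    ultimately show ?thesis by (simp add: field_simps)
  qed
  then show ?thesis using q1 by blast
qed

text \<open>Cutting the series after 2p terms leaves a residual of relative size |z|^(-2p), which a
  solution of the inhomogeneous equation cancels. The result may depend on M, since p does.\<close>

lemma bessel_approximate_solution:
  fixes r :: real
  assumes n: "n \<ge> 1" and V: "V n = 1" and r: "r \<le> 0" "- real n \<le> r"
    and F: "bessel_op n V ((- of_nat n) ^ n) (- of_nat n) (of_real r) F = 0"
  shows "\<exists>W C. W holomorphic_on half_plane_ext \<and>
    (\<forall>z\<in>half_plane_ext. bessel_diff_op n V W z = 0 \<and>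
      norm (W z / exp (- of_nat n * z + of_real r * Ln z) - (\<Sum>m<M. fps_nth F m / z ^ m)) \<le> C / norm z ^ M)"
proof -
  define E where "E = (\<lambda>z. exp (- of_nat n * z + of_real r * Ln z))"
  define \<kappa> :: complex where "\<kappa> = (- of_nat n) ^ n"
  have "0 \<le> (\<Sum>j<n. norm (V j))" by (intro sum_nonneg) simp
  then obtain q where q: "q \<ge> 1" "\<And>p. p \<ge> q \<Longrightarrow> real n * (\<Sum>j<n. norm (V j)) * (pi / (2 * sqrt (real p))) \<le> 1 / 2"
    using contraction_exponent by blast
  \<comment> \<open>The correction loses |z| in the ray estimate and |z|^n in comparing exp(-n Re z)
    with the dominant factor; 2p \<ge> M+n+1 still leaves |z|^(-M).\<close>
  define p where "p = max q (M + n + 1)"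
  have "p \<ge> q" "p \<ge> M + n + 1" unfolding p_def by (rule max.cobounded1, rule max.cobounded2)
  have p: "p \<ge> 1" "real n * (\<Sum>j<n. norm (V j)) * (pi / (2 * sqrt (real p))) \<le> 1 / 2" "2 * p \<ge> M + n + 1"
    using q(1) \<open>p \<ge> q\<close> q(2)[OF \<open>p \<ge> q\<close>] \<open>p \<ge> M + n + 1\<close> by linarith+
  define G where "G = fps_cutoff (2 * p) F"
  have Gp: "G = fps_of_poly (Poly (map (fps_nth F) [0..<2 * p]))"
    by (rule fps_ext) (simp add: G_def nth_default_def)
  have G: "fps_conv_radius G = \<infinity>" by (simp add: Gp)
  have evG: "eval_fps G x = (\<Sum>m<2 * p. fps_nth F m * x ^ m)" for x
  proof -
    have "(\<lambda>m. fps_nth G m * x ^ m) sums (\<Sum>m<2 * p. fps_nth G m * x ^ m)"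
      by (rule sums_finite) (auto simp: G_def)
    then show ?thesis by (simp add: eval_fps_def sums_iff G_def)
  qed
  define R where "R = bessel_op n V \<kappa> (- of_nat n) (of_real r) G"
  have R: "fps_conv_radius R = \<infinity>" unfolding R_def by (rule entire_fps_bessel_op[OF G])
  \<comment> \<open>By triangularity, coefficient i of the residual involves only coefficients up to
    i, where the truncation agrees with the formal solution.\<close>
  have R0: "fps_nth R i = 0" if "i < 2 * p" for i
  proof -
    have "fps_nth R i = fps_nth (bessel_op n V \<kappa> (- of_nat n) (of_real r) F) i"
      unfolding R_def fps_nth_bessel_op using that by (intro sum.cong) (auto simp: G_def)
    then show ?thesis using F by (simp add: \<kappa>_def)
  qed
  define R' where "R' = fps_shift (2 * p) R"
  have RR': "R = R' * fps_X ^ (2 * p)"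
    by (rule fps_ext) (auto simp: R'_def fps_X_power_mult_right_nth R0)
  have rad': "fps_conv_radius R' = \<infinity>" by (simp add: R'_def R)
  have evR: "eval_fps R x = eval_fps R' x * x ^ (2 * p)" for x
    by (subst RR') (simp add: eval_fps_mult rad')
  have "bounded (eval_fps R' ` cball 0 1)"
    by (intro compact_imp_bounded compact_continuous_image continuous_on_eval_fps') (auto simp: R'_def R)
  then obtain K where K: "\<And>x. norm x \<le> 1 \<Longrightarrow> norm (eval_fps R' x) \<le> K"
    unfolding bounded_iff by (metis image_eqI mem_cball_0)
  define W0 where "W0 = formal_eval (- of_nat n) (of_real r) G"
  define f where "f = (\<lambda>z. - formal_eval (- of_nat n) (of_real r) R z)"
  have nz: "norm z > 1" "z \<noteq> 0" if "z \<in> half_plane_ext" for z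
    using that by (auto simp: half_plane_ext_def)
  have fh: "f holomorphic_on half_plane_ext"
    unfolding f_def by (intro holomorphic_intros holomorphic_formal_eval R)
  have fb: "norm (f z) \<le> K * exp (- real n * Re z) / norm z ^ (2 * p)" if z: "z \<in> half_plane_ext" for z
  proof -
    have "norm (inverse z) \<le> 1" using nz[OF z] by (simp add: norm_inverse inverse_le_1_iff)
    note K' = K[OF this]
    have "norm (f z) = norm (E z) * (norm (eval_fps R' (inverse z)) / norm z ^ (2 * p))"
      by (simp add: f_def formal_eval_def evR E_def norm_mult norm_power norm_inverse divide_inverse power_inverse)
    also have "\<dots> \<le> exp (- real n * Re z) * (K / norm z ^ (2 * p))"
      using dominated_factor_bounds(1)[OF _ r, of z] nz[OF z] K'
      by (intro mult_mono divide_right_mono) (auto simp: E_def r)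
    finally show ?thesis by (simp add: mult.commute)
  qed
  obtain W1 B where W1: "W1 holomorphic_on half_plane_ext"
    "\<And>z. z \<in> half_plane_ext \<Longrightarrow> bessel_diff_op n V W1 z = f z"
    "\<And>z. z \<in> half_plane_ext \<Longrightarrow> norm (W1 z) \<le> B * exp (- real n * Re z) * norm z / norm z ^ (2 * p)"
    using bessel_diff_op_solvable[OF n V p(1,2) fh fb] by blast
  define W where "W = (\<lambda>z. W0 z + W1 z)"
  have W0h: "W0 holomorphic_on half_plane_ext"
    unfolding W0_def by (rule holomorphic_formal_eval[OF G])
  have "bessel_diff_op n V W z = 0" if z: "z \<in> half_plane_ext" for z
  proof -
    have "(deriv ^^ j) W z = (deriv ^^ j) W0 z + (deriv ^^ j) W1 z" for j
      unfolding W_def by (rule higher_deriv_add[OF W0h W1(1) open_half_plane_ext z])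
    then have "bessel_diff_op n V W z = bessel_diff_op n V W0 z + bessel_diff_op n V W1 z"
      unfolding bessel_diff_op_def by (simp add: W_def algebra_simps add_divide_distrib sum.distrib)
    also have "bessel_diff_op n V W0 z = - f z"
      unfolding W0_def f_def R_def \<kappa>_def by (simp add: bessel_diff_op_formal_eval[OF G z])
    finally show ?thesis using W1(2)[OF z] by simp
  qed
  moreover have "norm (W z / E z - (\<Sum>m<M. fps_nth F m / z ^ m)) \<le> (\<bar>B\<bar> + (\<Sum>m=M..<2 * p. norm (fps_nth F m))) / norm z ^ M"
    if z: "z \<in> half_plane_ext" for z
  proof -
    have E0: "E z \<noteq> 0" by (simp add: E_def)
    have "W0 z = E z * (\<Sum>m<2 * p. fps_nth F m / z ^ m)"
      by (simp add: W0_def formal_eval_def E_def evG divide_inverse power_inverse)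
    then have "W z / E z = (\<Sum>m<2 * p. fps_nth F m / z ^ m) + W1 z / E z"
      using E0 by (simp add: W_def add_divide_distrib)
    also have "(\<Sum>m<2 * p. fps_nth F m / z ^ m) = (\<Sum>m<M. fps_nth F m / z ^ m) + (\<Sum>m=M..<2 * p. fps_nth F m / z ^ m)"
      using sum.atLeastLessThan_concat[of 0 M "2 * p" "\<lambda>m. fps_nth F m / z ^ m"] p(3)
      by (simp add: atLeast0LessThan)
    finally have eq: "W z / E z - (\<Sum>m<M. fps_nth F m / z ^ m) = W1 z / E z + (\<Sum>m=M..<2 * p. fps_nth F m / z ^ m)"
      by simp
    have "norm (W1 z / E z) \<le> \<bar>B\<bar> / norm z ^ M"
    proof -
      have "norm (W1 z) \<le> \<bar>B\<bar> * exp (- real n * Re z) * norm z / norm z ^ (2 * p)"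
        by (rule order_trans[OF W1(3)[OF z]]) (intro divide_right_mono mult_right_mono, auto)
      also have "\<dots> \<le> \<bar>B\<bar> * (norm (E z) * norm z ^ n) * norm z / norm z ^ (2 * p)"
        using dominated_factor_bounds(2)[OF _ r, of z] nz[OF z]
        by (intro divide_right_mono mult_right_mono mult_left_mono) (auto simp: E_def)
      also have "\<dots> = norm (E z) * (\<bar>B\<bar> * (norm z ^ (n + 1) / norm z ^ (2 * p)))" by simp
      also have "\<dots> \<le> norm (E z) * (\<bar>B\<bar> * (1 / norm z ^ M))"
      proof (intro mult_left_mono)
        have "norm z ^ (M + (n + 1)) \<le> norm z ^ (2 * p)" using nz[OF z] p(3) by (intro power_increasing) auto
        then have "norm z ^ M * norm z ^ (n + 1) \<le> norm z ^ (2 * p)" by (simp only: power_add)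
        moreover have "norm z ^ M > 0" "norm z ^ (2 * p) > 0" using nz[OF z] by auto
        ultimately show "norm z ^ (n + 1) / norm z ^ (2 * p) \<le> 1 / norm z ^ M"
          by (simp only: divide_le_eq) (simp add: pos_le_divide_eq mult.commute)
      qed auto
      finally have "norm (W1 z) \<le> norm (E z) * (\<bar>B\<bar> / norm z ^ M)" by simp
      then show ?thesis
        unfolding norm_divide by (subst pos_divide_le_eq) (use E0 in \<open>simp_all add: mult.commute\<close>)
    qed
    moreover have "norm (\<Sum>m=M..<2 * p. fps_nth F m / z ^ m) \<le> (\<Sum>m=M..<2 * p. norm (fps_nth F m) / norm z ^ M)"
    proof (rule sum_norm_le)
      fix m
      assume "m \<in> {M..<2 * p}"
      then have "norm z ^ M \<le> norm z ^ m" using nz[OF z] by (intro power_increasing) auto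
      then show "norm (fps_nth F m / z ^ m) \<le> norm (fps_nth F m) / norm z ^ M"
        using nz[OF z] by (auto simp: norm_divide norm_power intro!: divide_left_mono mult_pos_pos)
    qed
    ultimately show ?thesis
      unfolding eq add_divide_distrib sum_divide_distrib by (intro norm_triangle_le add_mono)
  qed
  moreover have "W holomorphic_on half_plane_ext"
    unfolding W_def by (intro holomorphic_intros W0h W1)
  ultimately show ?thesis unfolding E_def by blast
qed

section \<open>Existence and uniqueness of the recessive solution\<close>

text \<open>The asymptotic condition with explicit constants and an arbitrary coefficient sequence,
  so that it can be rotated independently of the B_m.\<close>

definition bessel_expansion ::
    "'n itself \<Rightarrow> (nat \<Rightarrow> complex) \<Rightarrow> ucover \<Rightarrow> (ucover \<Rightarrow> complex) \<Rightarrow> bool" where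
  "bessel_expansion _ b \<xi> w \<longleftrightarrow>
     (\<forall>M. \<exists>C R. \<forall>z\<in>bessel_sector TYPE('n) \<xi>. R \<le> umod z \<longrightarrow>
        norm (w z / (exp (\<i> * of_nat CARD('n) * uproj \<xi> * uproj z) * upowr z (bessel_rho TYPE('n)))
              - (\<Sum>m<M. b m / uproj z ^ m)) \<le> C / umod z ^ M)"

lemma bessel_asymptotic_iff:
  fixes lam :: "complex ^ 'n"
  shows "bessel_asymptotic lam \<xi> w \<longleftrightarrow> bessel_expansion TYPE('n) (\<lambda>m. bessel_B m lam \<xi>) \<xi> w"
proof -
  have *: "f \<in> O[inf (filtercomap umod at_top) (principal S)](\<lambda>z. 1 / of_real (umod z) ^ M) \<longleftrightarrow>
      (\<exists>C R. \<forall>z\<in>S. R \<le> umod z \<longrightarrow> norm (f z) \<le> C / umod z ^ M)"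
    for f :: "ucover \<Rightarrow> complex" and S M
  proof -
    have "f \<in> O[inf (filtercomap umod at_top) (principal S)](\<lambda>z. 1 / of_real (umod z) ^ M) \<longleftrightarrow>
        (\<exists>C>0. \<exists>R. \<forall>z. R \<le> umod z \<longrightarrow> z \<in> S \<longrightarrow> norm (f z) \<le> C / umod z ^ M)"
      unfolding bigo_def eventually_inf_principal eventually_filtercomap_at_top_linorder
      by (simp add: norm_divide norm_power order_less_imp_le)
    also have "\<dots> \<longleftrightarrow> (\<exists>C R. \<forall>z\<in>S. R \<le> umod z \<longrightarrow> norm (f z) \<le> C / umod z ^ M)"
    proof
      assume "\<exists>C R. \<forall>z\<in>S. R \<le> umod z \<longrightarrow> norm (f z) \<le> C / umod z ^ M"
      then obtain C R where CR: "\<And>z. z \<in> S \<Longrightarrow> R \<le> umod z \<Longrightarrow> norm (f z) \<le> C / umod z ^ M" by blast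
      \<comment> \<open>The Landau symbol demands a positive constant.\<close>
      have "norm (f z) \<le> (\<bar>C\<bar> + 1) / umod z ^ M" if "z \<in> S" "R \<le> umod z" for z
        by (rule order_trans[OF CR[OF that]]) (intro divide_right_mono, auto)
      then show "\<exists>C>0. \<exists>R. \<forall>z. R \<le> umod z \<longrightarrow> z \<in> S \<longrightarrow> norm (f z) \<le> C / umod z ^ M"
        by (intro exI[of _ "\<bar>C\<bar> + 1"] conjI exI[of _ R]) auto
    qed blast
    finally show ?thesis .
  qed
  show ?thesis unfolding bessel_asymptotic_def bessel_expansion_def * ..
qed

text \<open>The point \<open>\<i>\<close>: its expansion is dominated by \<open>exp (- n z)\<close> on a sector around the positive
  real axis.\<close>

definition u_ii :: ucover where
  "u_ii = upoint 1 (pi / 2)"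

lemma uproj_u_ii [simp]: "uproj u_ii = \<i>"
  by (simp add: uproj_def u_ii_def rcis_def complex_eq_iff)

lemma bessel_sector_u_ii: "z \<in> bessel_sector TYPE('n) u_ii \<longleftrightarrow> \<bar>uarg z\<bar> < pi / of_nat CARD('n)"
  by (simp add: bessel_sector_def u_ii_def)

lemma bessel_expansion_u_ii:
  "bessel_expansion TYPE('n) b u_ii w \<longleftrightarrow>
     (\<forall>M. \<exists>C R. \<forall>z. \<bar>uarg z\<bar> < pi / of_nat CARD('n) \<longrightarrow> R \<le> umod z \<longrightarrow>
        norm (w z / (exp (- of_nat CARD('n) * uproj z + bessel_rho TYPE('n) * ulog z))
              - (\<Sum>m<M. b m / uproj z ^ m)) \<le> C / umod z ^ M)"
proof -
  have "exp (\<i> * of_nat CARD('n) * uproj u_ii * uproj z) * upowr z (bessel_rho TYPE('n))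
      = exp (- of_nat CARD('n) * uproj z + bessel_rho TYPE('n) * ulog z)" for z
    by (simp add: upowr_def exp_add[symmetric] algebra_simps)
  then show ?thesis
    unfolding bessel_expansion_def by (simp add: Ball_def bessel_sector_u_ii)
qed

section \<open>Uniqueness from decay of a fixed order\<close>

lemma uderiv_diff:
  assumes "uholomorphic v" "uholomorphic w"
  shows "uderiv (\<lambda>z. v z - w z) = (\<lambda>z. uderiv v z - uderiv w z)"
proof
  fix z
  have h: "(v \<circ> uexp) holomorphic_on UNIV" "(w \<circ> uexp) holomorphic_on UNIV"
    using assms by (auto simp: uholomorphic_def)
  have "(\<lambda>z. v z - w z) \<circ> uexp = (\<lambda>s. (v \<circ> uexp) s - (w \<circ> uexp) s)" by auto
  moreover have "deriv (\<lambda>s. (v \<circ> uexp) s - (w \<circ> uexp) s) s = deriv (v \<circ> uexp) s - deriv (w \<circ> uexp) s" for s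
    by (rule deriv_diff[OF holomorphic_on_imp_differentiable_at[OF h(1)] holomorphic_on_imp_differentiable_at[OF h(2)]]) auto
  ultimately show "uderiv (\<lambda>z. v z - w z) z = uderiv v z - uderiv w z"
    unfolding uderiv_def by (simp only: diff_divide_distrib)
qed

lemma uderiv_funpow_diff:
  assumes "uholomorphic v" "uholomorphic w"
  shows "(uderiv ^^ j) (\<lambda>z. v z - w z) = (\<lambda>z. (uderiv ^^ j) v z - (uderiv ^^ j) w z)"
  by (induction j) (simp_all add: uderiv_diff uholomorphic_uderiv_funpow assms)

lemma bessel_solution_diff:
  assumes "bessel_solution lam sg v" "bessel_solution lam sg w"
  shows "bessel_solution lam sg (\<lambda>z. v z - w z)"
proof -
  have h: "uholomorphic v" "uholomorphic w" using assms by (auto simp: bessel_solution_def)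
  have "(\<lambda>s. (v \<circ> uexp) s - (w \<circ> uexp) s) holomorphic_on UNIV"
    using h unfolding uholomorphic_def by (intro holomorphic_intros)
  then have "uholomorphic (\<lambda>z. v z - w z)" by (simp add: uholomorphic_def o_def)
  moreover have "(\<Sum>j\<in>I. V j * x j * (y j - y' j)) + k * (v z - w z)
      = ((\<Sum>j\<in>I. V j * x j * y j) + k * v z) - ((\<Sum>j\<in>I. V j * x j * y' j) + k * w z)"
    for I :: "nat set" and V x y y' k z
    by (simp add: right_diff_distrib sum_subtractf)
  ultimately show ?thesis
    using assms unfolding bessel_solution_def uderiv_funpow_diff[OF h] by simp
qed

lemma bessel_rho_real:
  "bessel_rho TYPE('n :: finite) = of_real (- ((real CARD('n) - 1) / 2))"
  "- ((real CARD('n) - 1) / 2) \<le> 0" "- real CARD('n) \<le> - ((real CARD('n) - 1) / 2)"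
proof -
  have "real CARD('n) \<ge> 1 \<or> CARD('n) = 0" by linarith
  then show "bessel_rho TYPE('n) = of_real (- ((real CARD('n) - 1) / 2))"
    by (simp add: bessel_rho_def)
qed (simp_all add: field_simps Suc_le_eq)

text \<open>The order K = 2p is chosen from n and the indices before the solution d. Cauchy
  estimates on unit discs turn the bound for d into bounds for its derivatives along the real axis,
  where the half-plane uniqueness gives zeros; the identity theorem spreads them over the
  cover.\<close>

lemma bessel_solution_eq_0:
  fixes lam :: "complex ^ 'n"
  assumes n: "CARD('n) \<ge> 2"
  shows "\<exists>K. \<forall>d C R. bessel_solution lam (\<i> ^ CARD('n)) d \<longrightarrow>
    (\<forall>z. \<bar>uarg z\<bar> < pi / of_nat CARD('n) \<longrightarrow> R \<le> umod z \<longrightarrow>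
      norm (d z / exp (- of_nat CARD('n) * uproj z + bessel_rho TYPE('n) * ulog z)) \<le> C / umod z ^ K) \<longrightarrow>
    (\<forall>z. d z = 0)"
proof -
  define n where "n = CARD('n)"
  define V where "V = bessel_V lam"
  have n1: "n \<ge> 1" and n2: "n \<ge> 2" using n by (auto simp: n_def)
  have V: "V n = 1" by (simp add: V_def n_def bessel_V_card)
  have "0 \<le> (\<Sum>j<n. norm (V j))" by (intro sum_nonneg) simp
  then obtain p where p: "p \<ge> 1" "real n * (\<Sum>j<n. norm (V j)) * (pi / (2 * sqrt (real p))) \<le> 1 / 2"
    using contraction_exponent by blast
  have "d z = 0"
    if d: "bessel_solution lam (\<i> ^ n) d"
      and b: "\<And>z. \<bar>uarg z\<bar> < pi / of_nat n \<Longrightarrow> R \<le> umod z \<Longrightarrow>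
        norm (d z / exp (- of_nat n * uproj z + bessel_rho TYPE('n) * ulog z)) \<le> C / umod z ^ (2 * p)"
    for d C R z
  proof -
    define D where "D = (\<lambda>z. d (uexp (Ln z)))"
    have uh: "uholomorphic d" using d by (simp add: bessel_solution_def)
    have Dh: "D holomorphic_on half_plane_ext" unfolding D_def by (rule holomorphic_uexp_Ln[OF uh])
    have Deq: "bessel_diff_op n V D z = 0" if "z \<in> half_plane_ext" for z
      using bessel_solution_half_plane_ext[of lam d, OF _ that] d by (simp add: D_def n_def V_def)
    \<comment> \<open>For x \<ge> X the unit disc around x lies in the region and in |y| \<ge> R,
      and its arguments, at most 1/(n+2), stay in the sector. In \<open>B\<close>, exp(n) pays for
      replacing x by x - 1 in the exponent and 2^(2p) for |y| \<ge> x/2.\<close>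
    define X where "X = \<bar>R\<bar> + real n + 3"
    define B where "B = \<bar>C\<bar> * exp (real n) * 2 ^ (2 * p)"
    have bnd: "y \<in> half_plane_ext \<and> norm (D y) \<le> B * exp (- real n * x) / x ^ (2 * p)"
      if x: "x \<ge> X" and y: "norm (of_real x - y) \<le> 1" for x y
    proof -
      have x': "x - 1 \<ge> real n + 2" "x - 1 \<ge> R" "x > 0" using x by (auto simp: X_def)
      have Rey: "Re y \<ge> x - 1" using abs_Re_le_cmod[of "of_real x - y"] y by simp
      have Imy: "\<bar>Im y\<bar> \<le> 1" using abs_Im_le_cmod[of "of_real x - y"] y by simp
      have ny: "norm y \<ge> x - 1" using Rey complex_Re_le_cmod[of y] by linarith
      have Re0: "Re y > 0" using Rey x' by linarith
      then have y0: "y \<noteq> 0" by auto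
      have yin: "y \<in> half_plane_ext" using Re0 ny x' by (simp add: half_plane_ext_def)
      have "\<bar>Im (Ln y)\<bar> < pi / real n"
      proof -
        have "\<bar>Im (Ln y)\<bar> = \<bar>arctan (Im y / Re y)\<bar>" using Re0 by (simp add: Im_Ln_eq y0)
        also have "\<dots> \<le> \<bar>Im y / Re y\<bar>" by (rule abs_arctan_le)
        also have "\<dots> \<le> 1 / (real n + 2)"
          unfolding abs_divide using Imy Rey x' Re0 by (intro frac_le) auto
        also have "\<dots> < pi / real n"
          using n1 pi_gt3 by (intro frac_less2) auto
        finally show ?thesis .
      qed
      then have "norm (d (uexp (Ln y)) / exp (- of_nat n * uproj (uexp (Ln y)) + bessel_rho TYPE('n) * ulog (uexp (Ln y))))
          \<le> C / umod (uexp (Ln y)) ^ (2 * p)"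
        using ny x' y0 by (intro b) auto
      then have "norm (D y) / norm (exp (- of_nat n * y + bessel_rho TYPE('n) * Ln y)) \<le> C / norm y ^ (2 * p)"
        using y0 by (simp add: D_def norm_divide)
      then have "norm (D y) \<le> C / norm y ^ (2 * p) * norm (exp (- of_nat n * y + bessel_rho TYPE('n) * Ln y))"
        by (simp add: pos_divide_le_eq)
      also have "\<dots> \<le> \<bar>C\<bar> / (x / 2) ^ (2 * p) * exp (- real n * (x - 1))"
      proof (intro mult_mono)
        have "C / norm y ^ (2 * p) \<le> \<bar>C\<bar> / norm y ^ (2 * p)" by (intro divide_right_mono) auto
        also have "\<dots> \<le> \<bar>C\<bar> / (x / 2) ^ (2 * p)"
          using ny x' by (intro divide_left_mono power_mono mult_pos_pos zero_less_power) auto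
        finally show "C / norm y ^ (2 * p) \<le> \<bar>C\<bar> / (x / 2) ^ (2 * p)" .
        have "norm (exp (- of_nat n * y + bessel_rho TYPE('n) * Ln y)) \<le> exp (- real n * Re y)"
          unfolding bessel_rho_real(1) n_def
          by (intro dominated_factor_bounds bessel_rho_real) (use ny x' in auto)
        also have "\<dots> \<le> exp (- real n * (x - 1))" using Rey by (simp add: mult_left_mono)
        finally show "norm (exp (- of_nat n * y + bessel_rho TYPE('n) * Ln y)) \<le> exp (- real n * (x - 1))" .
      qed (use x' in auto)
      also have "exp (- real n * (x - 1)) = exp (real n) * exp (- real n * x)"
        by (simp add: exp_add[symmetric] algebra_simps)
      finally show ?thesis
        using yin by (simp add: B_def power_divide mult_ac)
    qed
    have Dx: "D (of_real x) = 0" if x: "x \<ge> X" for x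
    proof (rule bessel_diff_op_unique[OF n1 V p Dh Deq, where X = X and B = "fact n * B"])
      fix x j
      assume x: "x \<ge> X" and j: "j < n"
      have x0: "x \<ge> 1" using x by (simp add: X_def)
      have c: "cball (of_real x) 1 \<subseteq> half_plane_ext"
        using bnd[OF x] by (auto simp: dist_norm)
      have "norm ((deriv ^^ j) D (of_real x)) \<le> fact j * (B * exp (- real n * x) / x ^ (2 * p)) / 1 ^ j"
      proof (rule Cauchy_inequality)
        show "D holomorphic_on ball (of_real x) 1" "continuous_on (cball (of_real x) 1) D"
          by (rule holomorphic_on_subset[OF Dh order_trans[OF ball_subset_cball c]],
              rule holomorphic_on_imp_continuous_on[OF holomorphic_on_subset[OF Dh c]])
      qed (use bnd[OF x] in auto)
      also have "\<dots> = fact j * (B * exp (- real n * x) * 1 / x ^ (2 * p))" by simp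
      also have "\<dots> \<le> fact n * (B * exp (- real n * x) * x / x ^ (2 * p))"
        using x0 j by (intro mult_mono divide_right_mono mult_left_mono fact_mono) (auto simp: B_def)
      finally show "norm ((deriv ^^ j) D (of_real x)) \<le> fact n * B * exp (- real n * x) * x / x ^ (2 * p)"
        by (simp add: mult.assoc)
    qed (use x in \<open>auto simp: X_def\<close>)
    have z0: "(d \<circ> uexp) (of_real t) = 0" if t: "t \<ge> ln X" for t
    proof -
      have "X > 0" by (simp add: X_def add_nonneg_pos)
      then have "exp t \<ge> X" using t by (metis exp_le_cancel_iff exp_ln)
      from Dx[OF this] show ?thesis
        by (simp add: D_def exp_of_real[symmetric] del: exp_of_real)
    qed
    have "(d \<circ> uexp) (ulog z) = 0"
    proof (rule analytic_continuation[of "d \<circ> uexp" UNIV "of_real ` {ln X..}" "of_real (ln X)"])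
      show "d \<circ> uexp holomorphic_on UNIV" using uh by (simp add: uholomorphic_def)
      show "of_real (ln X) islimpt (of_real ` {ln X..} :: complex set)"
        unfolding islimpt_approachable
      proof (intro allI impI)
        fix e :: real
        assume "e > 0"
        show "\<exists>x'\<in>of_real ` {ln X..}. x' \<noteq> complex_of_real (ln X) \<and> dist x' (of_real (ln X)) < e"
        proof (rule bexI[of _ "of_real (ln X + e / 2)"])
          show "complex_of_real (ln X + e / 2) \<noteq> of_real (ln X) \<and>
              dist (complex_of_real (ln X + e / 2)) (of_real (ln X)) < e"
            using \<open>e > 0\<close> by (simp only: of_real_eq_iff dist_of_real) (simp add: dist_real_def)
          show "complex_of_real (ln X + e / 2) \<in> of_real ` {ln X..}"
            using \<open>e > 0\<close> by (intro imageI) simp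
        qed
      qed
    qed (use z0 in auto)
    then show ?thesis by simp
  qed
  then show ?thesis unfolding n_def by blast
qed

text \<open>For each M some solution has the right expansion to order M. Two solutions with the
  right expansion to order K differ by one that decays fast enough to vanish, so for M \<ge> K the
  solution is the one found for K; smaller orders follow by dropping terms.\<close>

lemma bessel_solution_ex1:
  fixes lam :: "complex ^ 'n"
  assumes n: "CARD('n) \<ge> 2"
    and b: "bessel_op CARD('n) (bessel_V lam) ((- of_nat CARD('n)) ^ CARD('n)) (- of_nat CARD('n))
      (bessel_rho TYPE('n)) (Abs_fps b) = 0"
  shows "\<exists>!w. bessel_solution lam (\<i> ^ CARD('n)) w \<and> bessel_expansion TYPE('n) b u_ii w"
proof -
  define n where "n = CARD('n)"
  define E where "E = (\<lambda>z. exp (- of_nat n * uproj z + bessel_rho TYPE('n) * ulog z))"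
  define P where "P = (\<lambda>z. \<bar>uarg z\<bar> < pi / of_nat n)"
  obtain K where K0: "\<forall>d C R. bessel_solution lam (\<i> ^ n) d \<longrightarrow>
    (\<forall>z. P z \<longrightarrow> R \<le> umod z \<longrightarrow> norm (d z / E z) \<le> C / umod z ^ K) \<longrightarrow> (\<forall>z. d z = 0)"
    using bessel_solution_eq_0[OF n, of lam] unfolding n_def P_def E_def by blast
  have K: "d z = 0" if "bessel_solution lam (\<i> ^ n) d"
    "\<And>z. P z \<Longrightarrow> R \<le> umod z \<Longrightarrow> norm (d z / E z) \<le> C / umod z ^ K" for d C R z
    using K0 that by blast
  have Ph: "uproj z \<in> half_plane_ext" "uexp (Ln (uproj z)) = z" "Ln (uproj z) = ulog z" if "P z" "umod z \<ge> 2" for z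
  proof -
    \<comment> \<open>Here n \<ge> 2 puts the sector inside the right half-plane.\<close>
    have "pi / of_nat n \<le> pi / 2" using n by (intro divide_left_mono) (auto simp: n_def)
    then have "\<bar>uarg z\<bar> < pi / 2" using that(1) unfolding P_def by linarith
    then show "uproj z \<in> half_plane_ext" "uexp (Ln (uproj z)) = z"
      using that by (auto intro: uproj_half_plane_ext uexp_Ln_uproj)
    then show "Ln (uproj z) = ulog z" by (metis ulog_uexp)
  qed
  have ex: "\<exists>w C. bessel_solution lam (\<i> ^ n) w \<and>
      (\<forall>z. P z \<longrightarrow> 2 \<le> umod z \<longrightarrow> norm (w z / E z - (\<Sum>m<M. b m / uproj z ^ m)) \<le> C / umod z ^ M)" for M
  proof -
    have "\<exists>W C. W holomorphic_on half_plane_ext \<and>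
      (\<forall>z\<in>half_plane_ext. bessel_diff_op n (bessel_V lam) W z = 0 \<and>
        norm (W z / exp (- of_nat n * z + of_real (- ((real n - 1) / 2)) * Ln z)
          - (\<Sum>m<M. fps_nth (Abs_fps b) m / z ^ m)) \<le> C / norm z ^ M)"
      unfolding n_def using n b[unfolded bessel_rho_real(1)]
      by (intro bessel_approximate_solution bessel_V_card bessel_rho_real) auto
    then obtain W C where W: "W holomorphic_on half_plane_ext"
      "\<And>z. z \<in> half_plane_ext \<Longrightarrow> bessel_diff_op n (bessel_V lam) W z = 0"
      "\<And>z. z \<in> half_plane_ext \<Longrightarrow> norm (W z / exp (- of_nat n * z + bessel_rho TYPE('n) * Ln z)
          - (\<Sum>m<M. b m / z ^ m)) \<le> C / norm z ^ M"
      unfolding bessel_rho_real(1) n_def by auto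
    obtain w where w: "bessel_solution lam (\<i> ^ n) w" "\<And>z. z \<in> half_plane_ext \<Longrightarrow> w (uexp (Ln z)) = W z"
      using bessel_solution_extend[OF W(1), of lam] W(2) unfolding n_def by blast
    have "norm (w z / E z - (\<Sum>m<M. b m / uproj z ^ m)) \<le> C / umod z ^ M" if "P z" "2 \<le> umod z" for z
      using W(3)[OF Ph(1)[OF that]] w(2)[OF Ph(1)[OF that]] Ph(2,3)[OF that] by (simp add: E_def)
    then show ?thesis using w(1) by blast
  qed
  have sumb: "norm ((\<Sum>m<M. b m / uproj z ^ m) - (\<Sum>m<L. b m / uproj z ^ m)) \<le> (\<Sum>m=L..<M. norm (b m)) / umod z ^ L"
    if "L \<le> M" "2 \<le> umod z" for L M z
  proof -
    have "(\<Sum>m<M. b m / uproj z ^ m) - (\<Sum>m<L. b m / uproj z ^ m) = (\<Sum>m=L..<M. b m / uproj z ^ m)"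
      using sum.atLeastLessThan_concat[of 0 L M "\<lambda>m. b m / uproj z ^ m"] that(1)
      by (simp add: atLeast0LessThan algebra_simps)
    also have "norm \<dots> \<le> (\<Sum>m=L..<M. norm (b m) / umod z ^ L)"
    proof (rule sum_norm_le)
      fix m
      assume "m \<in> {L..<M}"
      then have "umod z ^ L \<le> umod z ^ m" using that(2) by (intro power_increasing) auto
      then show "norm (b m / uproj z ^ m) \<le> norm (b m) / umod z ^ L"
        by (auto simp: norm_divide norm_power intro!: divide_left_mono mult_pos_pos)
    qed
    finally show ?thesis by (simp add: sum_divide_distrib)
  qed
  obtain w0 C0 where w0: "bessel_solution lam (\<i> ^ n) w0"
    "\<And>z. P z \<Longrightarrow> 2 \<le> umod z \<Longrightarrow> norm (w0 z / E z - (\<Sum>m<K. b m / uproj z ^ m)) \<le> C0 / umod z ^ K"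
    using ex[of K] by blast
  have uniq: "w z = w0 z"
    if w: "bessel_solution lam (\<i> ^ n) w"
      and bd: "\<And>z. P z \<Longrightarrow> R \<le> umod z \<Longrightarrow> norm (w z / E z - (\<Sum>m<K. b m / uproj z ^ m)) \<le> C / umod z ^ K"
    for w C R z
  proof -
    have "w z - w0 z = 0"
    proof (rule K[where d = "\<lambda>z. w z - w0 z" and R = "max 2 R" and C = "C + C0"])
      show "bessel_solution lam (\<i> ^ n) (\<lambda>z. w z - w0 z)" by (rule bessel_solution_diff[OF w w0(1)])
      fix z
      assume z: "P z" "max 2 R \<le> umod z"
      have "(w z - w0 z) / E z = (w z / E z - (\<Sum>m<K. b m / uproj z ^ m)) - (w0 z / E z - (\<Sum>m<K. b m / uproj z ^ m))"
        by (simp add: diff_divide_distrib)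
      also have "norm \<dots> \<le> C / umod z ^ K + C0 / umod z ^ K"
        using z by (intro norm_triangle_le_diff add_mono bd w0(2)) auto
      finally show "norm ((w z - w0 z) / E z) \<le> (C + C0) / umod z ^ K" by (simp add: add_divide_distrib)
    qed
    then show ?thesis by simp
  qed
  have exp0: "\<exists>C. \<forall>z. P z \<longrightarrow> 2 \<le> umod z \<longrightarrow> norm (w0 z / E z - (\<Sum>m<M. b m / uproj z ^ m)) \<le> C / umod z ^ M" for M
  proof (cases "K \<le> M")
    case True
    obtain w C where w: "bessel_solution lam (\<i> ^ n) w"
      "\<And>z. P z \<Longrightarrow> 2 \<le> umod z \<Longrightarrow> norm (w z / E z - (\<Sum>m<M. b m / uproj z ^ m)) \<le> C / umod z ^ M"
      using ex[of M] by blast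
    have "w z = w0 z" for z
    proof (rule uniq[OF w(1)])
      fix z
      assume z: "P z" "2 \<le> umod z"
      have "C / umod z ^ M \<le> \<bar>C\<bar> / umod z ^ M" by (intro divide_right_mono) auto
      also have "\<dots> \<le> \<bar>C\<bar> / umod z ^ K"
        using True z by (intro divide_left_mono power_increasing mult_pos_pos) auto
      finally have "norm (w z / E z - (\<Sum>m<M. b m / uproj z ^ m)) \<le> \<bar>C\<bar> / umod z ^ K"
        using w(2)[OF z] by linarith
      then have "norm ((w z / E z - (\<Sum>m<M. b m / uproj z ^ m)) +
          ((\<Sum>m<M. b m / uproj z ^ m) - (\<Sum>m<K. b m / uproj z ^ m)))
          \<le> \<bar>C\<bar> / umod z ^ K + (\<Sum>m=K..<M. norm (b m)) / umod z ^ K"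
        using sumb[OF True z(2)] by (intro norm_triangle_le add_mono)
      then show "norm (w z / E z - (\<Sum>m<K. b m / uproj z ^ m)) \<le> (\<bar>C\<bar> + (\<Sum>m=K..<M. norm (b m))) / umod z ^ K"
        by (simp add: add_divide_distrib)
    qed
    then show ?thesis using w(2) by auto
  next
    case False
    have "norm (w0 z / E z - (\<Sum>m<M. b m / uproj z ^ m)) \<le> (\<bar>C0\<bar> + (\<Sum>m=M..<K. norm (b m))) / umod z ^ M"
      if z: "P z" "2 \<le> umod z" for z
    proof -
      have "C0 / umod z ^ K \<le> \<bar>C0\<bar> / umod z ^ K" by (intro divide_right_mono) auto
      also have "\<dots> \<le> \<bar>C0\<bar> / umod z ^ M"
        using False z by (intro divide_left_mono power_increasing mult_pos_pos) auto
      finally have "norm (w0 z / E z - (\<Sum>m<K. b m / uproj z ^ m)) \<le> \<bar>C0\<bar> / umod z ^ M"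
        using w0(2)[OF z] by linarith
      then have "norm ((w0 z / E z - (\<Sum>m<K. b m / uproj z ^ m)) +
          ((\<Sum>m<K. b m / uproj z ^ m) - (\<Sum>m<M. b m / uproj z ^ m)))
          \<le> \<bar>C0\<bar> / umod z ^ M + (\<Sum>m=M..<K. norm (b m)) / umod z ^ M"
        using sumb[of M K z] False z(2) by (intro norm_triangle_le add_mono) auto
      then show ?thesis by (simp add: add_divide_distrib)
    qed
    then show ?thesis by blast
  qed
  have expn: "bessel_expansion TYPE('n) b u_ii w \<longleftrightarrow>
      (\<forall>M. \<exists>C R. \<forall>z. P z \<longrightarrow> R \<le> umod z \<longrightarrow> norm (w z / E z - (\<Sum>m<M. b m / uproj z ^ m)) \<le> C / umod z ^ M)" for w
    unfolding bessel_expansion_u_ii P_def E_def n_def ..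
  show ?thesis
  proof (rule ex1I[of _ w0])
    show "bessel_solution lam (\<i> ^ CARD('n)) w0 \<and> bessel_expansion TYPE('n) b u_ii w0"
      using w0(1) exp0 unfolding expn n_def by blast
    fix w
    assume w: "bessel_solution lam (\<i> ^ CARD('n)) w \<and> bessel_expansion TYPE('n) b u_ii w"
    then obtain C R where "\<And>z. P z \<Longrightarrow> R \<le> umod z \<Longrightarrow> norm (w z / E z - (\<Sum>m<K. b m / uproj z ^ m)) \<le> C / umod z ^ K"
      unfolding expn by blast
    then show "w = w0"
      using uniq w unfolding n_def by blast
  qed
qed

section \<open>Rotations\<close>

definition fps_rescale :: "complex \<Rightarrow> complex fps \<Rightarrow> complex fps" where
  "fps_rescale c F = Abs_fps (\<lambda>m. fps_nth F m / c ^ m)"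

lemma formal_deriv_rescale:
  assumes "c \<noteq> 0"
  shows "(formal_deriv (c * a) \<rho> ^^ j) (fps_rescale c F) = fps_const (c ^ j) * fps_rescale c ((formal_deriv a \<rho> ^^ j) F)"
proof (induction j)
  case (Suc j)
  have "formal_deriv (c * a) \<rho> (fps_const k * fps_rescale c G) = fps_const (c * k) * fps_rescale c (formal_deriv a \<rho> G)" for k G
  proof (rule fps_ext)
    fix i
    show "fps_nth (formal_deriv (c * a) \<rho> (fps_const k * fps_rescale c G)) i
        = fps_nth (fps_const (c * k) * fps_rescale c (formal_deriv a \<rho> G)) i"
      using assms by (cases i) (simp_all add: fps_nth_formal_deriv fps_rescale_def field_simps)
  qed
  then show ?case by (simp add: Suc.IH)
qed (simp add: fps_rescale_def)

text \<open>Under z \<mapsto> cz each derivative acquires a factor c, and the normalisation by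
  z^(-n) makes all terms scale by the same c^n. Only a and \<kappa> have to be adjusted.\<close>

lemma bessel_op_rescale:
  assumes "c \<noteq> 0"
  shows "bessel_op n V (c ^ n * \<kappa>) (c * a) \<rho> (fps_rescale c F) = fps_const (c ^ n) * fps_rescale c (bessel_op n V \<kappa> a \<rho> F)"
proof (rule fps_ext)
  fix i
  have "fps_nth (fps_const (V j) * fps_X ^ (n - j) * (formal_deriv (c * a) \<rho> ^^ j) (fps_rescale c F)) i
      = c ^ n * (fps_nth (fps_const (V j) * fps_X ^ (n - j) * (formal_deriv a \<rho> ^^ j) F) i / c ^ i)" if "j \<le> n" for j
  proof (cases "i < n - j")
    case True
    then show ?thesis by (simp add: fps_X_power_mult_nth mult.assoc)
  next
    case False
    then have pw: "c ^ j * c ^ i = c ^ n * c ^ (i - (n - j))"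
      using that by (simp add: power_add[symmetric] add.commute)
    have e2: "fps_nth ((formal_deriv (c * a) \<rho> ^^ j) (fps_rescale c F)) k
        = c ^ j * (fps_nth ((formal_deriv a \<rho> ^^ j) F) k / c ^ k)" for k
      unfolding formal_deriv_rescale[OF assms] by (simp add: fps_rescale_def)
    have e1: "fps_nth (fps_const (V j) * fps_X ^ (n - j) * G) i = V j * fps_nth G (i - (n - j))" for G
      using False by (simp add: fps_X_power_mult_nth mult.assoc)
    have alg: "v * (x * (y / z)) = u * (v * y / w)" if "x * w = u * z" "z \<noteq> 0" "w \<noteq> 0" for u v w x y z :: complex
      using that by (simp add: field_simps)
    show ?thesis
      unfolding e1 e2 by (rule alg[OF pw]) (use assms in simp_all)
  qed
  then show "fps_nth (bessel_op n V (c ^ n * \<kappa>) (c * a) \<rho> (fps_rescale c F)) i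
      = fps_nth (fps_const (c ^ n) * fps_rescale c (bessel_op n V \<kappa> a \<rho> F)) i"
    by (simp add: bessel_op_def fps_sum_nth fps_rescale_def sum_distrib_left sum_divide_distrib
        right_diff_distrib diff_divide_distrib mult.assoc)
qed

lemma bessel_coeff_family_rotate:
  fixes b :: "nat \<Rightarrow> complex ^ 'n \<Rightarrow> complex"
  assumes "bessel_coeff_family \<eta> b"
  shows "bessel_coeff_family (umult \<zeta> \<eta>) (\<lambda>m lam. b m lam / uproj \<zeta> ^ m)"
  unfolding bessel_coeff_family_def
proof (intro conjI allI impI)
  fix m
  have "symmetric_polynomial (\<lambda>lam. (1 / uproj \<zeta> ^ m) * b m lam)"
    using assms by (intro symmetric_polynomial_cmult) (simp add: bessel_coeff_family_def)
  then show "symmetric_polynomial (\<lambda>lam. b m lam / uproj \<zeta> ^ m)" by simp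
next
  fix lam :: "complex ^ 'n"
  assume l: "(\<Sum>l\<in>UNIV. lam $ l) = 0"
  let ?n = "CARD('n)"
  have "bessel_op ?n (bessel_V lam) (uproj \<zeta> ^ ?n * (uproj \<eta> ^ ?n * (\<i> * of_nat ?n) ^ ?n))
      (uproj \<zeta> * (\<i> * of_nat ?n * uproj \<eta>)) (bessel_rho TYPE('n)) (fps_rescale (uproj \<zeta>) (Abs_fps (\<lambda>m. b m lam))) = 0"
    using assms l by (subst bessel_op_rescale)
      (simp_all add: bessel_coeff_family_def formal_bessel_solution_iff fps_rescale_def fps_eq_iff)
  then show "formal_bessel_solution lam (uproj (umult \<zeta> \<eta>) ^ ?n) (\<i> * of_nat ?n * uproj (umult \<zeta> \<eta>))
      (bessel_rho TYPE('n)) (Abs_fps (\<lambda>m. b m lam / uproj \<zeta> ^ m))"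
    unfolding formal_bessel_solution_iff fps_rescale_def by (simp add: power_mult_distrib mult_ac)
qed (use assms in \<open>simp add: bessel_coeff_family_def\<close>)

lemma formal_bessel_solution_u_ii:
  fixes lam :: "complex ^ 'n"
  shows "formal_bessel_solution lam (uproj u_ii ^ CARD('n)) (\<i> * of_nat CARD('n) * uproj u_ii) \<rho> F \<longleftrightarrow>
    bessel_op CARD('n) (bessel_V lam) ((- of_nat CARD('n)) ^ CARD('n)) (- of_nat CARD('n)) \<rho> F = 0"
proof -
  have "\<i> ^ CARD('n) * (\<i> * of_nat CARD('n)) ^ CARD('n) = (- of_nat CARD('n)) ^ CARD('n)"
    by (simp only: power_mult_distrib[symmetric] mult.assoc[symmetric]) simp
  moreover have "\<i> * of_nat CARD('n) * \<i> = - of_nat CARD('n)" by (simp add: mult_ac)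
  ultimately show ?thesis unfolding formal_bessel_solution_iff by simp
qed

lemma bessel_op_u_ii_iff:
  fixes lam :: "complex ^ 'n"
  assumes "(\<Sum>l\<in>UNIV. lam $ l) = 0" "fps_nth F 0 = 1"
  shows "bessel_op CARD('n) (bessel_V lam) ((- of_nat CARD('n)) ^ CARD('n)) (- of_nat CARD('n)) (bessel_rho TYPE('n)) F = 0 \<longleftrightarrow>
    F = Abs_fps (bessel_formal_coeff CARD('n) (bessel_V lam) ((- of_nat CARD('n)) ^ CARD('n)) (- of_nat CARD('n)) (bessel_rho TYPE('n)))"
  using assms by (intro bessel_op_eq_0_iff bessel_V_card bessel_V_card_minus_1) (auto simp: Suc_le_eq)

lemma bessel_coeff_family_u_ii:
  "bessel_coeff_family u_ii (\<lambda>m lam :: complex ^ 'n.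
     bessel_formal_coeff CARD('n) (bessel_V lam) ((- of_nat CARD('n)) ^ CARD('n)) (- of_nat CARD('n)) (bessel_rho TYPE('n)) m)"
  unfolding bessel_coeff_family_def formal_bessel_solution_u_ii
  by (auto simp: symmetric_polynomial_bessel_formal_coeff bessel_op_u_ii_iff)

definition uinv :: "ucover \<Rightarrow> ucover" where
  "uinv z = uexp (- ulog z)"

lemma umult_uinv_cancel [simp]:
  "umult (umult z (uinv u)) u = z" "umult (uinv z) (umult z u) = u" "umult z (umult (uinv z) u) = u"
  by (simp_all flip: ulog_eq_iff add: uinv_def)

text \<open>Multiplication by \<open>\<i>\<close>/\<xi> brings both families to the parameter
  \<open>\<i>\<close>, where the recursion determines every coefficient at each point of the
  hyperplane.\<close>

lemma bessel_coeff_family_unique: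
  fixes lam :: "complex ^ 'n"
  assumes "bessel_coeff_family \<xi> b" "bessel_coeff_family \<xi> b'" "(\<Sum>l\<in>UNIV. lam $ l) = 0"
  shows "b m lam = b' m lam"
proof -
  define \<zeta> where "\<zeta> = umult u_ii (uinv \<xi>)"
  have ii: "umult \<zeta> \<xi> = u_ii" by (simp add: \<zeta>_def)
  have f: "bessel_coeff_family u_ii (\<lambda>m lam. b m lam / uproj \<zeta> ^ m)"
    "bessel_coeff_family u_ii (\<lambda>m lam. b' m lam / uproj \<zeta> ^ m)"
    using bessel_coeff_family_rotate[OF assms(1), of \<zeta>] bessel_coeff_family_rotate[OF assms(2), of \<zeta>]
    unfolding ii by simp_all
  have "Abs_fps (\<lambda>m. c m lam) = Abs_fps (bessel_formal_coeff CARD('n) (bessel_V lam)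
      ((- of_nat CARD('n)) ^ CARD('n)) (- of_nat CARD('n)) (bessel_rho TYPE('n)))"
    if "bessel_coeff_family u_ii c" for c :: "nat \<Rightarrow> complex ^ 'n \<Rightarrow> complex"
  proof (rule bessel_op_u_ii_iff[OF assms(3), THEN iffD1])
    show "fps_nth (Abs_fps (\<lambda>m. c m lam)) 0 = 1" using that by (simp add: bessel_coeff_family_def)
    show "bessel_op CARD('n) (bessel_V lam) ((- of_nat CARD('n)) ^ CARD('n)) (- of_nat CARD('n))
        (bessel_rho TYPE('n)) (Abs_fps (\<lambda>m. c m lam)) = 0"
      using that assms(3) unfolding bessel_coeff_family_def formal_bessel_solution_u_ii by blast
  qed
  from this[OF f(1)] this[OF f(2)]
  have "Abs_fps (\<lambda>m. b m lam / uproj \<zeta> ^ m) = Abs_fps (\<lambda>m. b' m lam / uproj \<zeta> ^ m)"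
    by (rule trans[OF _ sym])
  then have "b m lam / uproj \<zeta> ^ m = b' m lam / uproj \<zeta> ^ m" by (simp add: fps_eq_iff)
  then show ?thesis by simp
qed

lemma bessel_coeff_family_exists: "\<exists>b :: nat \<Rightarrow> complex ^ 'n \<Rightarrow> complex. bessel_coeff_family \<xi> b"
  using bessel_coeff_family_rotate[OF bessel_coeff_family_u_ii, of "umult \<xi> (uinv u_ii)"] by auto

lemma bessel_B_eq:
  fixes lam :: "complex ^ 'n"
  assumes "bessel_coeff_family \<xi> b" "(\<Sum>l\<in>UNIV. lam $ l) = 0"
  shows "bessel_B m lam \<xi> = b m lam"
  unfolding bessel_B_def using assms bessel_coeff_family_unique by (intro the_equality) blast+

lemma bessel_B_rotate:
  fixes lam :: "complex ^ 'n"
  assumes "(\<Sum>l\<in>UNIV. lam $ l) = 0"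
  shows "bessel_B m lam (umult \<zeta> \<eta>) = bessel_B m lam \<eta> / uproj \<zeta> ^ m"
proof -
  obtain b :: "nat \<Rightarrow> complex ^ 'n \<Rightarrow> complex" where b: "bessel_coeff_family \<eta> b"
    using bessel_coeff_family_exists by blast
  show ?thesis
    using bessel_B_eq[OF b assms] bessel_B_eq[OF bessel_coeff_family_rotate[OF b] assms] by simp
qed

section \<open>Rotation of solutions on the cover\<close>

lemma uderiv_funpow_rotate:
  assumes "uholomorphic w"
  shows "(uderiv ^^ j) (\<lambda>z. c * w (umult \<zeta> z)) = (\<lambda>z. c * uproj \<zeta> ^ j * (uderiv ^^ j) w (umult \<zeta> z))"
proof (induction j)
  case (Suc j)
  define v where "v = (uderiv ^^ j) w"
  have v: "(v \<circ> uexp) holomorphic_on UNIV"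
    using uholomorphic_uderiv_funpow[OF assms] by (simp add: v_def uholomorphic_def)
  have r: "uderiv (\<lambda>z. k * v (umult \<zeta> z)) z = k * uproj \<zeta> * uderiv v (umult \<zeta> z)" for k z
  proof -
    \<comment> \<open>In the logarithmic chart, multiplication by \<zeta> is translation by
      \<open>ulog \<zeta>\<close>.\<close>
    have "umult \<zeta> (uexp s) = uexp (ulog \<zeta> + s)" for s by (metis umult_uexp uexp_ulog)
    then have "(\<lambda>z. k * v (umult \<zeta> z)) \<circ> uexp = (\<lambda>s. k * (v \<circ> uexp) (ulog \<zeta> + s))" by auto
    moreover have "((\<lambda>s. k * (v \<circ> uexp) (ulog \<zeta> + s)) has_field_derivative
        k * (deriv (v \<circ> uexp) (ulog \<zeta> + ulog z) * 1)) (at (ulog z))"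
    proof (intro DERIV_cmult DERIV_chain2[where f = "v \<circ> uexp" and g = "\<lambda>s. ulog \<zeta> + s"])
      show "((v \<circ> uexp) has_field_derivative deriv (v \<circ> uexp) (ulog \<zeta> + ulog z)) (at (ulog \<zeta> + ulog z))"
        by (rule holomorphic_derivI[OF v]) auto
    qed (auto intro!: derivative_eq_intros)
    ultimately show ?thesis
      by (simp add: uderiv_def DERIV_imp_deriv)
  qed
  show ?case
  proof
    fix z
    show "(uderiv ^^ Suc j) (\<lambda>z. c * w (umult \<zeta> z)) z = c * uproj \<zeta> ^ Suc j * (uderiv ^^ Suc j) w (umult \<zeta> z)"
      using r[of "c * uproj \<zeta> ^ j" z] by (simp add: Suc.IH v_def mult_ac)
  qed
qed simp

text \<open>The operators z^j D^j commute with the substitution z \<mapsto> \<zeta>z; only the term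
  with z^n picks up \<zeta>^n, which moves into the parameter \<open>sg\<close>.\<close>

lemma bessel_solution_rotate:
  fixes lam :: "complex ^ 'n"
  assumes "bessel_solution lam sg w"
  shows "bessel_solution lam (uproj \<zeta> ^ CARD('n) * sg) (\<lambda>z. c * w (umult \<zeta> z))"
proof -
  have w: "uholomorphic w" using assms by (simp add: bessel_solution_def)
  have "umult \<zeta> (uexp s) = uexp (ulog \<zeta> + s)" for s by (metis umult_uexp uexp_ulog)
  then have "(\<lambda>z. c * w (umult \<zeta> z)) \<circ> uexp = (\<lambda>s. c * ((w \<circ> uexp) \<circ> (\<lambda>s. ulog \<zeta> + s)) s)" by auto
  moreover have "(\<lambda>s. c * ((w \<circ> uexp) \<circ> (\<lambda>s. ulog \<zeta> + s)) s) holomorphic_on UNIV"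
    using w unfolding uholomorphic_def
    by (intro holomorphic_intros holomorphic_on_compose_gen[of _ UNIV _ UNIV]) auto
  ultimately have "uholomorphic (\<lambda>z. c * w (umult \<zeta> z))" by (simp add: uholomorphic_def)
  moreover have "(\<Sum>j = 1..CARD('n). bessel_V lam j * uproj z ^ j * (uderiv ^^ j) (\<lambda>z. c * w (umult \<zeta> z)) z)
        + (bessel_V lam 0 - uproj \<zeta> ^ CARD('n) * sg * (\<i> * of_nat CARD('n)) ^ CARD('n) * uproj z ^ CARD('n))
          * (c * w (umult \<zeta> z)) = 0" for z
  proof -
    let ?y = "umult \<zeta> z"
    have "(\<Sum>j = 1..CARD('n). bessel_V lam j * uproj ?y ^ j * (uderiv ^^ j) w ?y)
        + (bessel_V lam 0 - sg * (\<i> * of_nat CARD('n)) ^ CARD('n) * uproj ?y ^ CARD('n)) * w ?y = 0"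
      using assms[unfolded bessel_solution_def, THEN conjunct2, rule_format, of ?y] .
    then have "c * ((\<Sum>j = 1..CARD('n). bessel_V lam j * uproj ?y ^ j * (uderiv ^^ j) w ?y)
        + (bessel_V lam 0 - sg * (\<i> * of_nat CARD('n)) ^ CARD('n) * uproj ?y ^ CARD('n)) * w ?y) = 0"
      by (simp only: mult_zero_right)
    then show ?thesis
      unfolding uderiv_funpow_rotate[OF w] distrib_left sum_distrib_left
      by (simp add: power_mult_distrib mult_ac)
  qed
  ultimately show ?thesis by (simp add: bessel_solution_def)
qed

text \<open>The exponential depends on \<eta> and z through \<eta>z, the sector through arg \<eta> +
  arg z, and modulus one preserves the error terms. Only z^\<rho> changes, by \<zeta>^\<rho>, and
  the prefactor \<zeta>^(-\<rho>) = \<zeta>^((n-1)/2) compensates for this.\<close>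

lemma bessel_expansion_rotate:
  assumes "bessel_expansion TYPE('n) b \<eta> w" "umod \<zeta> = 1"
  shows "bessel_expansion TYPE('n) (\<lambda>m. b m / uproj \<zeta> ^ m) (umult \<zeta> \<eta>)
    (\<lambda>z. upowr \<zeta> (- bessel_rho TYPE('n)) * w (umult \<zeta> z))"
  unfolding bessel_expansion_def
proof
  fix M
  let ?\<rho> = "bessel_rho TYPE('n)"
  have um: "umod (umult \<zeta> z) = umod z" "uarg (umult \<zeta> z) = uarg \<zeta> + uarg z" for z
    using assms(2) by (simp_all add: umult_def)
  obtain C R where CR: "\<And>z. z \<in> bessel_sector TYPE('n) \<eta> \<Longrightarrow> R \<le> umod z \<Longrightarrow>
      norm (w z / (exp (\<i> * of_nat CARD('n) * uproj \<eta> * uproj z) * upowr z ?\<rho>)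
              - (\<Sum>m<M. b m / uproj z ^ m)) \<le> C / umod z ^ M"
    using assms(1) unfolding bessel_expansion_def by blast
  have "norm (upowr \<zeta> (- ?\<rho>) * w (umult \<zeta> z)
        / (exp (\<i> * of_nat CARD('n) * uproj (umult \<zeta> \<eta>) * uproj z) * upowr z ?\<rho>)
      - (\<Sum>m<M. b m / uproj \<zeta> ^ m / uproj z ^ m)) \<le> C / umod z ^ M"
    if z: "z \<in> bessel_sector TYPE('n) (umult \<zeta> \<eta>)" "R \<le> umod z" for z
  proof -
    have "umult \<zeta> z \<in> bessel_sector TYPE('n) \<eta>"
      using z(1) unfolding bessel_sector_def um by (simp add: algebra_simps um(2))
    from CR[OF this] z(2) have
      "norm (w (umult \<zeta> z) / (exp (\<i> * of_nat CARD('n) * uproj \<eta> * uproj (umult \<zeta> z)) * upowr (umult \<zeta> z) ?\<rho>)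
        - (\<Sum>m<M. b m / uproj (umult \<zeta> z) ^ m)) \<le> C / umod z ^ M"
      by (simp add: um)
    moreover have "upowr (umult \<zeta> z) ?\<rho> = upowr \<zeta> ?\<rho> * upowr z ?\<rho>"
      by (simp add: upowr_def exp_add[symmetric] algebra_simps)
    moreover have "upowr \<zeta> (- ?\<rho>) = inverse (upowr \<zeta> ?\<rho>)"
      by (simp add: upowr_def exp_minus)
    ultimately show ?thesis
      by (simp add: power_mult_distrib divide_inverse mult_ac)
  qed
  then show "\<exists>C R. \<forall>z\<in>bessel_sector TYPE('n) (umult \<zeta> \<eta>). R \<le> umod z \<longrightarrow>
      norm (upowr \<zeta> (- ?\<rho>) * w (umult \<zeta> z)
        / (exp (\<i> * of_nat CARD('n) * uproj (umult \<zeta> \<eta>) * uproj z) * upowr z ?\<rho>)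
      - (\<Sum>m<M. b m / uproj \<zeta> ^ m / uproj z ^ m)) \<le> C / umod z ^ M"
    by blast
qed

definition bessel_second_kind :: "complex ^ 'n \<Rightarrow> ucover \<Rightarrow> (ucover \<Rightarrow> complex) \<Rightarrow> bool" where
  "bessel_second_kind lam \<xi> w \<longleftrightarrow> bessel_solution lam (uproj \<xi> ^ CARD('n)) w \<and> bessel_asymptotic lam \<xi> w"

lemma bessel_second_kind_rotate:
  fixes lam :: "complex ^ 'n"
  assumes "bessel_second_kind lam \<eta> w" "umod \<zeta> = 1" "(\<Sum>l\<in>UNIV. lam $ l) = 0"
  shows "bessel_second_kind lam (umult \<zeta> \<eta>) (\<lambda>z. upowr \<zeta> (- bessel_rho TYPE('n)) * w (umult \<zeta> z))"
proof -
  have "bessel_solution lam (uproj \<zeta> ^ CARD('n) * uproj \<eta> ^ CARD('n))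
      (\<lambda>z. upowr \<zeta> (- bessel_rho TYPE('n)) * w (umult \<zeta> z))"
    using assms(1) by (intro bessel_solution_rotate) (simp add: bessel_second_kind_def)
  moreover have "bessel_expansion TYPE('n) (\<lambda>m. bessel_B m lam \<eta> / uproj \<zeta> ^ m) (umult \<zeta> \<eta>)
      (\<lambda>z. upowr \<zeta> (- bessel_rho TYPE('n)) * w (umult \<zeta> z))"
    using assms(1,2) by (intro bessel_expansion_rotate) (simp_all add: bessel_second_kind_def bessel_asymptotic_iff)
  ultimately show ?thesis
    by (simp add: bessel_second_kind_def bessel_asymptotic_iff bessel_B_rotate[OF assms(3)] power_mult_distrib)
qed

text \<open>The analytic work is the case of \<open>\<i>\<close>. Rotation by
  \<xi>/\<open>\<i>\<close> carries existence over, and the inverse rotation, injective on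
  functions, carries uniqueness over.\<close>

lemma bessel_second_kind_ex1:
  fixes lam :: "complex ^ 'n"
  assumes n: "CARD('n) \<ge> 2" and l: "(\<Sum>l\<in>UNIV. lam $ l) = 0" and \<xi>: "umod \<xi> = 1"
  shows "\<exists>!w. bessel_second_kind lam \<xi> w"
proof -
  have B: "(\<lambda>m. bessel_B m lam u_ii) = bessel_formal_coeff CARD('n) (bessel_V lam) ((- of_nat CARD('n)) ^ CARD('n)) (- of_nat CARD('n)) (bessel_rho TYPE('n))"
    by (rule ext) (rule bessel_B_eq[OF bessel_coeff_family_u_ii l])
  have ii: "\<exists>!w. bessel_second_kind lam u_ii w"
    unfolding bessel_second_kind_def bessel_asymptotic_iff uproj_u_ii
    by (rule bessel_solution_ex1[OF n]) (simp add: B bessel_op_u_ii_iff[OF l])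
  define \<zeta> where "\<zeta> = umult \<xi> (uinv u_ii)"
  have \<zeta>: "umod \<zeta> = 1" "umod (uinv \<zeta>) = 1"
    using \<xi> by (auto simp: \<zeta>_def umult_def uinv_def ulog_def u_ii_def)
  have \<zeta>_ii: "umult \<zeta> u_ii = \<xi>" by (simp add: \<zeta>_def)
  then have \<zeta>': "umult (uinv \<zeta>) \<xi> = u_ii" by (metis umult_uinv_cancel(2))
  obtain w where w: "bessel_second_kind lam u_ii w" using ii by blast
  show ?thesis
  proof (rule ex_ex1I)
    show "\<exists>w. bessel_second_kind lam \<xi> w"
      using bessel_second_kind_rotate[OF w \<zeta>(1) l] \<zeta>_ii by auto
    fix v v'
    assume v: "bessel_second_kind lam \<xi> v" "bessel_second_kind lam \<xi> v'"
    have "bessel_second_kind lam u_ii (\<lambda>z. upowr (uinv \<zeta>) (- bessel_rho TYPE('n)) * v (umult (uinv \<zeta>) z))"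
      "bessel_second_kind lam u_ii (\<lambda>z. upowr (uinv \<zeta>) (- bessel_rho TYPE('n)) * v' (umult (uinv \<zeta>) z))"
      using bessel_second_kind_rotate[OF v(1) \<zeta>(2) l] bessel_second_kind_rotate[OF v(2) \<zeta>(2) l]
      unfolding \<zeta>' .
    then have eq: "(\<lambda>z. upowr (uinv \<zeta>) (- bessel_rho TYPE('n)) * v (umult (uinv \<zeta>) z))
        = (\<lambda>z. upowr (uinv \<zeta>) (- bessel_rho TYPE('n)) * v' (umult (uinv \<zeta>) z))"
      using ii by blast
    show "v = v'"
    proof
      fix z
      show "v z = v' z"
        using fun_cong[OF eq, of "umult \<zeta> z"] by (simp add: upowr_def)
    qed
  qed
qed

lemma bessel_J_rotate:
  fixes lam :: "complex ^ 'n"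
  assumes "CARD('n) \<ge> 2" "(\<Sum>l\<in>UNIV. lam $ l) = 0" "umod \<zeta> = 1" "umod \<eta> = 1"
  shows "bessel_J z lam (umult \<zeta> \<eta>) = upowr \<zeta> ((of_nat CARD('n) - 1) / 2) * bessel_J (umult \<zeta> z) lam \<eta>"
proof -
  have J: "bessel_J z lam \<xi> = (THE w. bessel_second_kind lam \<xi> w) z" for z \<xi>
    unfolding bessel_J_def bessel_second_kind_def ..
  have "bessel_second_kind lam \<eta> (THE w. bessel_second_kind lam \<eta> w)"
    by (rule theI'[OF bessel_second_kind_ex1[OF assms(1,2,4)]])
  from bessel_second_kind_rotate[OF this assms(3,2)]
  have "bessel_second_kind lam (umult \<zeta> \<eta>) (\<lambda>z. upowr \<zeta> (- bessel_rho TYPE('n)) * (THE w. bessel_second_kind lam \<eta> w) (umult \<zeta> z))" .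
  note rot = this
  have "umod (umult \<zeta> \<eta>) = 1" using assms by (simp add: umult_def)
  note ex1 = bessel_second_kind_ex1[OF assms(1,2) this]
  have "(THE w. bessel_second_kind lam (umult \<zeta> \<eta>) w)
      = (\<lambda>z. upowr \<zeta> (- bessel_rho TYPE('n)) * (THE w. bessel_second_kind lam \<eta> w) (umult \<zeta> z))"
    by (rule the1_equality) (rule ex1, rule rot)
  then show ?thesis by (simp add: J bessel_rho_def)
qed

lemma upowr_minus_of_nat: "upowr \<zeta> (- of_nat m) = inverse (uproj \<zeta> ^ m)"
  by (simp add: upowr_def uproj_eq_exp exp_minus exp_of_nat_mult)

theorem lemma11p21:
  fixes lam :: "complex ^ 'n" and \<xi> :: ucover
  assumes "CARD('n) \<ge> 2"
    and "(\<Sum>l\<in>UNIV. lam $ l) = 0"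
    and "uproj \<xi> ^ (2 * CARD('n)) = 1"
  shows "(\<forall>z. bessel_J z lam \<xi> =
             upowr \<xi> ((of_nat CARD('n) - 1) / 2) * bessel_J (umult \<xi> z) lam u_one) \<and>
         (\<forall>z. bessel_J z lam \<xi> =
             upowr (u_neg \<xi>) ((of_nat CARD('n) - 1) / 2)
               * bessel_J (umult (u_neg \<xi>) z) lam u_minus_one) \<and>
         (\<forall>m. bessel_B m lam \<xi> = upowr \<xi> (- of_nat m) * bessel_B m lam u_one) \<and>
         (\<forall>m. bessel_B m lam \<xi> = upowr (u_neg \<xi>) (- of_nat m) * bessel_B m lam u_minus_one)"
proof -
  have "norm (uproj \<xi>) = 1"
  proof (rule power_eq_imp_eq_base)
    show "norm (uproj \<xi>) ^ (2 * CARD('n)) = 1 ^ (2 * CARD('n))"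
      unfolding norm_power[symmetric] assms(3) by simp
  qed (use assms(1) in auto)
  then have \<xi>: "umod \<xi> = 1" by simp
  have m: "umod (u_neg \<xi>) = 1" "umod u_one = 1" "umod u_minus_one = 1"
    by (simp_all add: u_neg_def u_one_def u_minus_one_def \<xi>)
  \<comment> \<open>Both factorisations hold on the cover, arguments included: the shift by -pi in
    \<open>u_neg\<close> cancels the argument pi of \<open>u_minus_one\<close>. With the other
    choice of argument for -\<xi> the product would be a different point over \<xi>.\<close>
  have e: "umult \<xi> u_one = \<xi>" "umult (u_neg \<xi>) u_minus_one = \<xi>"
    by (simp_all add: ucover_eq_iff umult_def u_one_def u_minus_one_def u_neg_def \<xi>)
  have J: "bessel_J z lam \<xi> = upowr \<zeta> ((of_nat CARD('n) - 1) / 2) * bessel_J (umult \<zeta> z) lam \<eta>"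
    if "umult \<zeta> \<eta> = \<xi>" "umod \<zeta> = 1" "umod \<eta> = 1" for \<zeta> \<eta> z
    using bessel_J_rotate[OF assms(1,2) that(2,3), of z] unfolding that(1) .
  have B: "bessel_B k lam \<xi> = upowr \<zeta> (- of_nat k) * bessel_B k lam \<eta>"
    if "umult \<zeta> \<eta> = \<xi>" for \<zeta> \<eta> k
    using bessel_B_rotate[OF assms(2), of k \<zeta> \<eta>]
    unfolding that upowr_minus_of_nat by (simp only: divide_inverse mult.commute)
  show ?thesis
    by (intro conjI allI J B e \<xi> m)
qed

end
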